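(* Let $q\in\mathbb N$, $c_1,c_2\in\mathbb C$, and let $V$ be a simple $\mathfrak g^{(0,-q)}$-module of central charge $(c_1,c_2)$. Assume that there exists $t\in\mathbb N$ satisfying the following two conditions: (a) if $t>0$, the action of $M_t$ on $V$ is injective; if $t=0$, the action of $M_0+\frac1{24}(n^2-1)\mathbf c_2$ on $V$ is injective for all nonzero integers $n$; (b) $M_iV=0$ for all $i>t$, and $L_jV=0$ for all $j>t+q$. Then: (i) $Q_{i-\frac12}V=0$ for all integers $i>t$; (ii) the induced module $\mathrm{Ind}_q(V)=U(\mathfrak g)\otimes_{U(\mathfrak g^{(0,-q)})}V$ is a simple $\mathfrak g$-module and belongs to $\mathcal R_{\mathfrak g}(c_1,c_2)$, i.e. it is smooth of central charge $(c_1,c_2)$.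
   Context: $\mathbb N$ denotes nonnegative integers. The N=1 BMS superalgebra $\mathfrak g$ is the complex Lie superalgebra with even basis $L_n,M_n$ ($n\in\mathbb Z$), $\mathbf c_1,\mathbf c_2$, odd basis $Q_r$ ($r\in\mathbb Z+\frac12$), and brackets $[L_m,L_n]=(m-n)L_{m+n}+\frac1{12}\delta_{m+n,0}(m^3-m)\mathbf c_1$, $[L_m,M_n]=(m-n)M_{m+n}+\frac1{12}\delta_{m+n,0}(m^3-m)\mathbf c_2$, $[Q_r,Q_s]=2M_{r+s}+\frac13\delta_{r+s,0}(r^2-\frac14)\mathbf c_2$, $[L_m,Q_r]=(\frac m2-r)Q_{m+r}$, $[M_m,M_n]=[M_n,Q_r]=0$, with $\mathbf c_1,\mathbf c_2$ central. For $q\in\mathbb N$, $\mathfrak g^{(0,-q)}$ is the subalgebra $\bigoplus_{i\ge0}\mathbb CL_i\oplus\bigoplus_{j\ge-q}\mathbb CM_j\oplus\bigoplus_{k\ge1}\mathbb CQ_{k-\frac12}\oplus\mathbb C\mathbf c_1\oplus\mathbb C\mathbf c_2$. A module has central charge $(c_1,c_2)$ if $\mathbf c_1,\mathbf c_2$ act as the scalars $c_1,c_2$. A $\mathfrak g$-module $W$ is smooth if for every $w\in W$ one has $L_iw=M_iw=Q_{i-\frac12}w=0$ for all sufficiently large $i$. $\mathcal R_{\mathfrak g}(c_1,c_2)$ is the category of smooth $\mathfrak g$-modules of central charge $(c_1,c_2)$. *)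

theory Defs
  imports
    Complex_Main
    "HOL-Library.Poly_Mapping"
    "HOL-Library.Z2"
    "HOL-Algebra.Algebra"
    "HOL-Algebra.Algebraic_Closure_Type"
begin

section \<open>The N=1 BMS superalgebra\<close>

text \<open>Parities are elements of the two-element field \<^typ>\<open>bit\<close>, with \<open>0\<close> even and \<open>1\<close> odd.
  The constructor \<open>Q_gen k\<close> stands for $Q_{k-1/2}$, so that \<^typ>\<open>int\<close> indexes
  the odd generators $Q_r$ with $r \in \mathbb{Z}+1/2$.\<close>

datatype bms_basis = L_gen int | M_gen int | Q_gen int | c1_gen | c2_gen

type_synonym bms = "bms_basis \<Rightarrow>\<^sub>0 complex"

abbreviation gen :: "bms_basis \<Rightarrow> bms" where
  "gen b \<equiv> Poly_Mapping.single b 1"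

definition pm_scale :: "complex \<Rightarrow> ('k \<Rightarrow>\<^sub>0 complex) \<Rightarrow> ('k \<Rightarrow>\<^sub>0 complex)" (infixr \<open>*\<^sub>c\<close> 75) where
  "c *\<^sub>c f = Poly_Mapping.map ((*) c) f"

fun parity :: "bms_basis \<Rightarrow> bit" where
  "parity (Q_gen k) = 1"
| "parity (L_gen n) = 0"
| "parity (M_gen n) = 0"
| "parity c1_gen = 0"
| "parity c2_gen = 0"

text \<open>The sign $(-1)^{pq}$.\<close>

definition ksign :: "bit \<Rightarrow> bit \<Rightarrow> complex" where
  "ksign p q = (if p * q = 1 then - 1 else 1)"

text \<open>The brackets $[M_m,L_n]$ and $[Q_r,L_m]$ are those forced by super skew-symmetry.
  With $r = k-\frac12$ and $s = l-\frac12$ one has $r+s = k+l-1$, and $m + r$ corresponds to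
  the index \<open>m + k\<close>.\<close>

fun basis_bracket :: "bms_basis \<Rightarrow> bms_basis \<Rightarrow> bms" where
  "basis_bracket (L_gen m) (L_gen n) =
     Poly_Mapping.single (L_gen (m + n)) (of_int (m - n))
     + Poly_Mapping.single c1_gen (if m + n = 0 then of_int (m ^ 3 - m) / 12 else 0)"
| "basis_bracket (L_gen m) (M_gen n) =
     Poly_Mapping.single (M_gen (m + n)) (of_int (m - n))
     + Poly_Mapping.single c2_gen (if m + n = 0 then of_int (m ^ 3 - m) / 12 else 0)"
| "basis_bracket (M_gen m) (L_gen n) =
     Poly_Mapping.single (M_gen (m + n)) (of_int (m - n))
     + Poly_Mapping.single c2_gen (if m + n = 0 then of_int (m ^ 3 - m) / 12 else 0)"
| "basis_bracket (Q_gen k) (Q_gen l) =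
     Poly_Mapping.single (M_gen (k + l - 1)) 2
     + Poly_Mapping.single c2_gen
         (if k + l - 1 = 0 then ((of_int k - 1 / 2) ^ 2 - 1 / 4) / 3 else 0)"
| "basis_bracket (L_gen m) (Q_gen k) =
     Poly_Mapping.single (Q_gen (m + k)) (of_int m / 2 - (of_int k - 1 / 2))"
| "basis_bracket (Q_gen k) (L_gen m) =
     Poly_Mapping.single (Q_gen (m + k)) ((of_int k - 1 / 2) - of_int m / 2)"
| "basis_bracket _ _ = 0"

definition bms_bracket :: "bms \<Rightarrow> bms \<Rightarrow> bms" where
  "bms_bracket x y =
     (\<Sum>a\<in>Poly_Mapping.keys x. \<Sum>b\<in>Poly_Mapping.keys y.
        (Poly_Mapping.lookup x a * Poly_Mapping.lookup y b) *\<^sub>c basis_bracket a b)"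

definition bms_homogeneous :: "bit \<Rightarrow> bms \<Rightarrow> bool" where
  "bms_homogeneous p x \<longleftrightarrow> (\<forall>b\<in>Poly_Mapping.keys x. parity b = p)"

definition bms_span :: "bms_basis set \<Rightarrow> bms set" where
  "bms_span B = {x. Poly_Mapping.keys x \<subseteq> B}"

text \<open>A basis of the subalgebra $\mathfrak g^{(0,-q)}$.\<close>

definition sub_basis :: "nat \<Rightarrow> bms_basis set" where
  "sub_basis q = {L_gen i | i. i \<ge> 0} \<union> {M_gen j | j. j \<ge> - int q}
     \<union> {Q_gen k | k. k \<ge> 1} \<union> {c1_gen, c2_gen}"

text \<open>The bracket is bilinear, and super skew-symmetry, the super Jacobi identity, compatibility with
  parity and closedness of $\mathfrak g^{(0,-q)}$ are checked on basis vectors.\<close>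

lemma lookup_pm_scale [simp]: "Poly_Mapping.lookup (c *\<^sub>c f) k = c * Poly_Mapping.lookup f k"
  unfolding pm_scale_def by transfer (auto simp: when_def)

lemma pm_scale_add_right: "c *\<^sub>c (f + g) = c *\<^sub>c f + c *\<^sub>c g"
  by (rule poly_mapping_eqI) (simp add: lookup_add algebra_simps)

lemma pm_scale_add_left: "(c + d) *\<^sub>c f = c *\<^sub>c f + d *\<^sub>c f"
  by (rule poly_mapping_eqI) (simp add: lookup_add algebra_simps)

lemma pm_scale_scale [simp]: "c *\<^sub>c d *\<^sub>c f = (c * d) *\<^sub>c f"
  by (rule poly_mapping_eqI) simp

lemma pm_scale_zero [simp]: "c *\<^sub>c 0 = 0" "0 *\<^sub>c f = 0"
  by (rule poly_mapping_eqI, simp)+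

lemma pm_scale_one [simp]: "1 *\<^sub>c f = f"
  by (rule poly_mapping_eqI) simp

lemma pm_scale_uminus: "c *\<^sub>c (- f) = - (c *\<^sub>c f)"
  by (rule poly_mapping_eqI) simp

lemma pm_scale_single [simp]: "c *\<^sub>c Poly_Mapping.single k d = Poly_Mapping.single k (c * d)"
  by (rule poly_mapping_eqI) (simp add: lookup_single when_def)

lemma pm_scale_sum: "c *\<^sub>c sum f A = (\<Sum>a\<in>A. c *\<^sub>c f a)"
  by (induction A rule: infinite_finite_induct) (simp_all add: pm_scale_add_right)

lemma bms_bracket_superset:
  assumes "finite A" "finite B" "Poly_Mapping.keys x \<subseteq> A" "Poly_Mapping.keys y \<subseteq> B"
  shows "bms_bracket x y =
    (\<Sum>a\<in>A. \<Sum>b\<in>B. (Poly_Mapping.lookup x a * Poly_Mapping.lookup y b) *\<^sub>c basis_bracket a b)"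
proof -
  have "(\<Sum>a\<in>A. \<Sum>b\<in>B. (Poly_Mapping.lookup x a * Poly_Mapping.lookup y b) *\<^sub>c basis_bracket a b)
      = (\<Sum>a\<in>Poly_Mapping.keys x. \<Sum>b\<in>B.
           (Poly_Mapping.lookup x a * Poly_Mapping.lookup y b) *\<^sub>c basis_bracket a b)"
    using assms by (intro sum.mono_neutral_right) (auto simp: in_keys_iff)
  also have "\<dots> = bms_bracket x y"
    unfolding bms_bracket_def using assms
    by (intro sum.cong refl sum.mono_neutral_right) (auto simp: in_keys_iff)
  finally show ?thesis by simp
qed

lemma bms_bracket_add_left: "bms_bracket (x + x') y = bms_bracket x y + bms_bracket x' y"
proof -
  let ?A = "Poly_Mapping.keys x \<union> Poly_Mapping.keys x'" and ?B = "Poly_Mapping.keys y"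
  note eq = bms_bracket_superset[of ?A ?B]
  show ?thesis
    by (subst (1 2 3) eq)
       (use keys_add[of x x'] in \<open>auto simp: lookup_add algebra_simps pm_scale_add_left sum.distrib\<close>)
qed

lemma bms_bracket_add_right: "bms_bracket x (y + y') = bms_bracket x y + bms_bracket x y'"
proof -
  let ?A = "Poly_Mapping.keys x" and ?B = "Poly_Mapping.keys y \<union> Poly_Mapping.keys y'"
  note eq = bms_bracket_superset[of ?A ?B]
  show ?thesis
    by (subst (1 2 3) eq)
       (use keys_add[of y y'] in \<open>auto simp: lookup_add algebra_simps pm_scale_add_left sum.distrib\<close>)
qed

lemma keys_pm_scale: "Poly_Mapping.keys (c *\<^sub>c f) \<subseteq> Poly_Mapping.keys f"
  by (auto simp: in_keys_iff)

lemma bms_bracket_scale_left: "bms_bracket (c *\<^sub>c x) y = c *\<^sub>c bms_bracket x y"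
  by (subst (1 2) bms_bracket_superset[of "Poly_Mapping.keys x" "Poly_Mapping.keys y"])
     (auto simp: keys_pm_scale pm_scale_sum mult.assoc)

lemma bms_bracket_scale_right: "bms_bracket x (c *\<^sub>c y) = c *\<^sub>c bms_bracket x y"
  by (subst (1 2) bms_bracket_superset[of "Poly_Mapping.keys x" "Poly_Mapping.keys y"])
     (auto simp: keys_pm_scale pm_scale_sum mult.assoc mult.left_commute)

lemma bms_bracket_zero [simp]: "bms_bracket 0 y = 0" "bms_bracket x 0 = 0"
  by (simp_all add: bms_bracket_def)

lemma bms_bracket_gen [simp]:
  "bms_bracket (Poly_Mapping.single a c) (Poly_Mapping.single b d) = (c * d) *\<^sub>c basis_bracket a b"
  by (subst bms_bracket_superset[of "{a}" "{b}"]) (auto simp: lookup_single)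

lemma bms_bracket_uminus: "bms_bracket (- x) y = - bms_bracket x y"
  "bms_bracket x (- y) = - bms_bracket x y"
  using bms_bracket_scale_left[of "-1" x y] bms_bracket_scale_right[of x "-1" y]
  by (metis (no_types) bms_bracket_add_left bms_bracket_add_right bms_bracket_zero
      add.right_inverse minus_unique)+

lemma of_int_solve:
  fixes w x y z :: int
  shows "x + (y + z) = w \<Longrightarrow> (of_int z :: complex) = of_int w - of_int x - of_int y"
    and "x + y = w \<Longrightarrow> (of_int y :: complex) = of_int w - of_int x"
  by auto

lemma basis_bracket_skew:
  "basis_bracket a b = - (ksign (parity a) (parity b) *\<^sub>c basis_bracket b a)"
  apply (rule poly_mapping_eqI; cases a; cases b)
  apply (simp_all add: ksign_def lookup_add lookup_single when_def)
  apply (auto simp: lookup_minus lookup_single algebra_simps power2_eq_square power3_eq_cube add_eq_0_iff field_simps)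
  apply (drule of_int_solve, simp (no_asm_simp) add: algebra_simps)+
  done

lemma basis_bracket_jacobi:
  "bms_bracket (gen a) (basis_bracket b c) =
   bms_bracket (basis_bracket a b) (gen c)
   + ksign (parity a) (parity b) *\<^sub>c bms_bracket (gen b) (basis_bracket a c)"
  apply (rule poly_mapping_eqI; cases a; cases b; cases c)
  apply (simp_all add: ksign_def bms_bracket_add_left bms_bracket_add_right pm_scale_add_right
    lookup_add lookup_single when_def)
  apply (auto simp add: algebra_simps add_eq_0_iff field_simps power2_eq_square power3_eq_cube)
  apply (drule of_int_solve, simp (no_asm_simp) add: algebra_simps)+
  done

lemma basis_bracket_parity:
  "bms_homogeneous (parity a + parity b) (basis_bracket a b)"
  by (cases a; cases b)
     (auto simp: bms_homogeneous_def in_keys_iff lookup_add lookup_single when_def split: if_splits)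

lemma basis_bracket_sub_basis:
  assumes "a \<in> sub_basis q" "b \<in> sub_basis q"
  shows "basis_bracket a b \<in> bms_span (sub_basis q)"
  using assms
  by (cases a; cases b)
     (auto simp: bms_span_def sub_basis_def in_keys_iff lookup_add lookup_single when_def
       split: if_splits)


section \<open>Modules\<close>

abbreviation complex_ring :: "complex ring" where
  "complex_ring \<equiv> ring_of_type_algebra"

text \<open>As usual for Lie superalgebras, modules are $\mathbb Z/2$-graded. The fields \<^const>\<open>mult\<close>
  and \<^const>\<open>one\<close> that the record inherits from \<^type>\<open>module\<close> are unused.\<close>

record 'v bms_module = "(complex, 'v) module" +
  grade :: "bit \<Rightarrow> 'v set"
  act :: "bms \<Rightarrow> 'v \<Rightarrow> 'v"

text \<open>Modules over the sub-superalgebra spanned by \<open>B\<close>; the values \<open>act V x\<close> for \<open>x\<close> outside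
  \<open>bms_span B\<close> are irrelevant. For \<open>B = UNIV\<close> these are the $\mathfrak g$-modules.\<close>

definition is_bms_module :: "bms_basis set \<Rightarrow> 'v bms_module \<Rightarrow> bool" where
  "is_bms_module B V \<longleftrightarrow>
     module complex_ring V
   \<and> (\<forall>p. submodule (grade V p) complex_ring V)
   \<and> grade V 0 <+>\<^bsub>V\<^esub> grade V 1 = carrier V \<and> grade V 0 \<inter> grade V 1 = {\<zero>\<^bsub>V\<^esub>}
   \<and> (\<forall>x\<in>bms_span B. \<forall>v\<in>carrier V. act V x v \<in> carrier V)
   \<and> (\<forall>x\<in>bms_span B. \<forall>v\<in>carrier V. \<forall>w\<in>carrier V.
        act V x (v \<oplus>\<^bsub>V\<^esub> w) = act V x v \<oplus>\<^bsub>V\<^esub> act V x w)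
   \<and> (\<forall>x\<in>bms_span B. \<forall>c. \<forall>v\<in>carrier V. act V x (c \<odot>\<^bsub>V\<^esub> v) = c \<odot>\<^bsub>V\<^esub> act V x v)
   \<and> (\<forall>x\<in>bms_span B. \<forall>y\<in>bms_span B. \<forall>v\<in>carrier V.
        act V (x + y) v = act V x v \<oplus>\<^bsub>V\<^esub> act V y v)
   \<and> (\<forall>x\<in>bms_span B. \<forall>c. \<forall>v\<in>carrier V. act V (c *\<^sub>c x) v = c \<odot>\<^bsub>V\<^esub> act V x v)
   \<and> (\<forall>p q. \<forall>x\<in>bms_span B. \<forall>v\<in>grade V q.
        bms_homogeneous p x \<longrightarrow> act V x v \<in> grade V (p + q))
   \<and> (\<forall>p q. \<forall>x\<in>bms_span B. \<forall>y\<in>bms_span B. \<forall>v\<in>carrier V.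
        bms_homogeneous p x \<longrightarrow> bms_homogeneous q y \<longrightarrow>
        act V (bms_bracket x y) v =
          act V x (act V y v) \<ominus>\<^bsub>V\<^esub> ksign p q \<odot>\<^bsub>V\<^esub> act V y (act V x v))"

definition is_bms_submodule :: "bms_basis set \<Rightarrow> 'v set \<Rightarrow> 'v bms_module \<Rightarrow> bool" where
  "is_bms_submodule B N V \<longleftrightarrow>
     submodule N complex_ring V
   \<and> N = (N \<inter> grade V 0) <+>\<^bsub>V\<^esub> (N \<inter> grade V 1)
   \<and> (\<forall>x\<in>bms_span B. \<forall>v\<in>N. act V x v \<in> N)"

definition simple_bms_module :: "bms_basis set \<Rightarrow> 'v bms_module \<Rightarrow> bool" where
  "simple_bms_module B V \<longleftrightarrow>
     is_bms_module B V \<and> carrier V \<noteq> {\<zero>\<^bsub>V\<^esub>}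
   \<and> (\<forall>N. is_bms_submodule B N V \<longrightarrow> N = {\<zero>\<^bsub>V\<^esub>} \<or> N = carrier V)"

definition has_central_charge :: "complex \<Rightarrow> complex \<Rightarrow> 'v bms_module \<Rightarrow> bool" where
  "has_central_charge c1 c2 V \<longleftrightarrow>
     (\<forall>v\<in>carrier V. act V (gen c1_gen) v = c1 \<odot>\<^bsub>V\<^esub> v \<and> act V (gen c2_gen) v = c2 \<odot>\<^bsub>V\<^esub> v)"

definition smooth_bms_module :: "'v bms_module \<Rightarrow> bool" where
  "smooth_bms_module W \<longleftrightarrow>
     (\<forall>w\<in>carrier W. \<exists>N::int. \<forall>i>N.
        act W (gen (L_gen i)) w = \<zero>\<^bsub>W\<^esub>
      \<and> act W (gen (M_gen i)) w = \<zero>\<^bsub>W\<^esub>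
      \<and> act W (gen (Q_gen i)) w = \<zero>\<^bsub>W\<^esub>)"

text \<open>The objects of the category $\mathcal R_{\mathfrak g}(c_1,c_2)$.\<close>

definition in_smooth_category :: "complex \<Rightarrow> complex \<Rightarrow> 'v bms_module \<Rightarrow> bool" where
  "in_smooth_category c1 c2 W \<longleftrightarrow>
     is_bms_module UNIV W \<and> smooth_bms_module W \<and> has_central_charge c1 c2 W"


section \<open>The universal enveloping algebra\<close>

text \<open>Lists under concatenation are the free monoid, so that the monoid algebra
  \<open>bms_basis list \<Rightarrow>\<^sub>0 complex\<close> is the free associative algebra on the basis of $\mathfrak g$,
  that is, the tensor algebra $T(\mathfrak g)$.\<close>

instantiation list :: (type) monoid_add
begin
definition zero_list :: "'a list" where "zero_list = []"
definition plus_list :: "'a list \<Rightarrow> 'a list \<Rightarrow> 'a list" where "plus_list = (@)"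
instance by standard (simp_all add: zero_list_def plus_list_def)
end

type_synonym tensor_alg = "bms_basis list \<Rightarrow>\<^sub>0 complex"

abbreviation tensor_ring :: "tensor_alg ring" where
  "tensor_ring \<equiv> ring_of_type_algebra"

definition tensor_const :: "complex \<Rightarrow> tensor_alg" where
  "tensor_const c = Poly_Mapping.single [] c"

definition tensor_emb :: "bms \<Rightarrow> tensor_alg" where
  "tensor_emb x = (\<Sum>b\<in>Poly_Mapping.keys x. Poly_Mapping.single [b] (Poly_Mapping.lookup x b))"

definition env_ideal :: "tensor_alg set" where
  "env_ideal = Idl\<^bsub>tensor_ring\<^esub>
     {tensor_emb x * tensor_emb y - ksign p q *\<^sub>c (tensor_emb y * tensor_emb x)
        - tensor_emb (bms_bracket x y)
      | p q x y. bms_homogeneous p x \<and> bms_homogeneous q y}"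

definition env :: "tensor_alg set ring" where
  "env = tensor_ring Quot env_ideal"

definition env_class :: "tensor_alg \<Rightarrow> tensor_alg set" where
  "env_class a = env_ideal +>\<^bsub>tensor_ring\<^esub> a"

definition env_grade :: "bit \<Rightarrow> tensor_alg set set" where
  "env_grade p = {env_class a | a. \<forall>w\<in>Poly_Mapping.keys a. sum_list (map parity w) = p}"


section \<open>Induced modules\<close>

text \<open>The subalgebra $T(\mathfrak h)$ of $T(\mathfrak g)$ for $\mathfrak h$ spanned by \<open>B\<close>, and its
  action on an $\mathfrak h$-module. Every element of $U(\mathfrak h)$ is the class of
  some \<open>a \<in> sub_tensor B\<close>; it acts on $U(\mathfrak g)$ from the right as multiplication by
  \<open>env_class a\<close>, and on the module as \<open>tensor_act V a\<close>.\<close>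

definition sub_tensor :: "bms_basis set \<Rightarrow> tensor_alg set" where
  "sub_tensor B = {a. Poly_Mapping.keys a \<subseteq> lists B}"

definition tensor_act :: "'v bms_module \<Rightarrow> tensor_alg \<Rightarrow> 'v \<Rightarrow> 'v" where
  "tensor_act V a v =
     (\<Oplus>\<^bsub>V\<^esub>w\<in>Poly_Mapping.keys a.
        Poly_Mapping.lookup a w \<odot>\<^bsub>V\<^esub> foldr (\<lambda>b. act V (gen b)) w v)"

text \<open>The complex vector space with basis \<open>S\<close>.\<close>

definition free_space :: "'k set \<Rightarrow> (complex, 'k \<Rightarrow>\<^sub>0 complex) module" where
  "free_space S = \<lparr>carrier = {f. Poly_Mapping.keys f \<subseteq> S}, monoid.mult = undefined, one = undefined,
     ring.zero = 0, add = (+), module.smult = (*\<^sub>c)\<rparr>"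

text \<open>The tensor product $U(\mathfrak g)\otimes_{U(\mathfrak h)}V$ is the quotient of the vector space
  with basis $U(\mathfrak g)\times V$ by the subspace spanned by the following elements, which make
  $(u,v)\mapsto u\otimes v$ bilinear and $U(\mathfrak h)$-balanced.\<close>

type_synonym 'v pre_tensor = "(tensor_alg set \<times> 'v) \<Rightarrow>\<^sub>0 complex"

abbreviation pure :: "tensor_alg set \<Rightarrow> 'v \<Rightarrow> 'v pre_tensor" where
  "pure u v \<equiv> Poly_Mapping.single (u, v) 1"

definition pre_tensor_space :: "'v bms_module \<Rightarrow> (complex, 'v pre_tensor) module" where
  "pre_tensor_space V = free_space (carrier env \<times> carrier V)"

definition tensor_relations :: "bms_basis set \<Rightarrow> 'v bms_module \<Rightarrow> 'v pre_tensor set" where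
  "tensor_relations B V =
     {pure (u \<oplus>\<^bsub>env\<^esub> u') v - pure u v - pure u' v
        | u u' v. u \<in> carrier env \<and> u' \<in> carrier env \<and> v \<in> carrier V}
   \<union> {pure u (v \<oplus>\<^bsub>V\<^esub> v') - pure u v - pure u v'
        | u v v'. u \<in> carrier env \<and> v \<in> carrier V \<and> v' \<in> carrier V}
   \<union> {pure (env_class (tensor_const c) \<otimes>\<^bsub>env\<^esub> u) v - c *\<^sub>c pure u v
        | c u v. u \<in> carrier env \<and> v \<in> carrier V}
   \<union> {pure u (c \<odot>\<^bsub>V\<^esub> v) - c *\<^sub>c pure u v
        | c u v. u \<in> carrier env \<and> v \<in> carrier V}
   \<union> {pure (u \<otimes>\<^bsub>env\<^esub> env_class a) v - pure u (tensor_act V a v)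
        | u a v. u \<in> carrier env \<and> a \<in> sub_tensor B \<and> v \<in> carrier V}"

definition tensor_kernel :: "bms_basis set \<Rightarrow> 'v bms_module \<Rightarrow> 'v pre_tensor set" where
  "tensor_kernel B V =
     \<Inter>{H. submodule H complex_ring (pre_tensor_space V) \<and> tensor_relations B V \<subseteq> H}"

definition tensor_class :: "bms_basis set \<Rightarrow> 'v bms_module \<Rightarrow> 'v pre_tensor \<Rightarrow> 'v pre_tensor set" where
  "tensor_class B V f = tensor_kernel B V +>\<^bsub>pre_tensor_space V\<^esub> f"

text \<open>Left multiplication by \<open>u \<in>\<close> \<^const>\<open>env\<close> on the first factor.\<close>

definition pre_tensor_lmult :: "tensor_alg set \<Rightarrow> 'v pre_tensor \<Rightarrow> 'v pre_tensor" where
  "pre_tensor_lmult u f =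
     (\<Sum>(u', v)\<in>Poly_Mapping.keys f.
        Poly_Mapping.lookup f (u', v) *\<^sub>c pure (u \<otimes>\<^bsub>env\<^esub> u') v)"

text \<open>Scalars and $\mathfrak g$ act on a coset by acting on representatives.
  The parity of $u\otimes v$ is the sum of the parities of $u$ and $v$.\<close>

definition induced_module :: "bms_basis set \<Rightarrow> 'v bms_module \<Rightarrow> 'v pre_tensor set bms_module" where
  "induced_module B V =
     \<lparr>carrier = a_rcosets\<^bsub>pre_tensor_space V\<^esub> (tensor_kernel B V),
      monoid.mult = undefined,
      one = undefined,
      ring.zero = tensor_kernel B V,
      add = set_add (pre_tensor_space V),
      module.smult = (\<lambda>c A. \<Union>f\<in>A. tensor_class B V (c *\<^sub>c f)),
      grade = (\<lambda>p. {tensor_class B V f | f.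
         \<forall>(u, v)\<in>Poly_Mapping.keys f. \<exists>r s. r + s = p \<and> u \<in> env_grade r \<and> v \<in> grade V s}),
      act = (\<lambda>x A. \<Union>f\<in>A. tensor_class B V (pre_tensor_lmult (env_class (tensor_emb x)) f))\<rparr>"

definition Ind :: "nat \<Rightarrow> 'v bms_module \<Rightarrow> 'v pre_tensor set bms_module" where
  "Ind q V = induced_module (sub_basis q) V"

end

theory Submission
  imports Defs "HOL-Library.Countable"
begin

text \<open>By the Poincare-Birkhoff-Witt theorem \<open>V\<close> embeds in $\mathrm{Ind}_q(V)$ as $1\otimes V$, so
  it suffices to show that a nonzero submodule \<open>N\<close> meets $1\otimes V$: the intersection is then
  a nonzero submodule of \<open>V\<close>, hence everything.
  Commutators of a positive with a negative generator produce the operator $M_t$ (plus a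
  multiple of $\mathbf c_2$ if $t=0$), which is injective on \<open>V\<close>. Applied to an element of \<open>N\<close>,
  the operators $M_{t+i}$ lower the degree in the $L_{-i}$ without killing the leading part, and
  in the absence of \<open>L\<close>'s the $Q_r$ and, finally, the $L_{t+j}$ do the same for the negative
  $Q$'s and for the $M_{-j}$, $j>q$.
  Each of these steps needs $M_t$ to be injective on a larger subspace than the previous one; this
  follows by applying the lowering argument to the kernel of $M_t$ itself.\<close>

text \<open>Poincare-Birkhoff-Witt enters through one consequence: \<open>1 \<otimes> v = 0\<close>
  forces \<open>v = 0\<close>. It is proved in dual form: linear functionals on words are extended
  along a rewriting system whose ambiguities are resolved by the super Jacobi identity. All other
  nonvanishing descends from it: an expansion into leading monomials is merely chosen, and
  commutators turn a nonzero coefficient $y$ into a nonzero multiple of $(M_t+\<kappa>)y$. The order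
  L, Q, M of the removals reflects what commutes: $M_{t+i}$ passes every $M$ and $Q$ and dies on
  $V$, so the coefficients of an $L$-monomial can be arbitrary words in $M$ and $Q$; a negative $Q$
  squares to an $M$; the $L_{t+j}$ are controlled on words in $M$ alone. Injectivity is built up in
  the opposite order. For $t=0$ the shifts in hypothesis (a) are those of $[M_n,L_{-n}] =
  2n(M_0+(n^2-1)c_2/24)$ and of $[Q_r,Q_{-r}] = 2(M_0+(n^2-1)c_2/24)$ with $n=2r$ odd.\<close>

instance bms_basis :: countable by countable_datatype

section \<open>Linear extension of maps and functionals given on basis vectors\<close>

lemma pm_vector_space: "vector_space ((*\<^sub>c) :: complex \<Rightarrow> ('k \<Rightarrow>\<^sub>0 complex) \<Rightarrow> _)"
  by unfold_locales (simp_all add: pm_scale_add_right pm_scale_add_left)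

global_interpretation pm: vector_space "(*\<^sub>c) :: complex \<Rightarrow> ('k \<Rightarrow>\<^sub>0 complex) \<Rightarrow> _"
  by (rule pm_vector_space)

definition lin :: "('k \<Rightarrow> ('l \<Rightarrow>\<^sub>0 complex)) \<Rightarrow> ('k \<Rightarrow>\<^sub>0 complex) \<Rightarrow> ('l \<Rightarrow>\<^sub>0 complex)" where
  "lin h f = (\<Sum>k\<in>Poly_Mapping.keys f. Poly_Mapping.lookup f k *\<^sub>c h k)"

lemma lin_superset:
  assumes "finite A" "Poly_Mapping.keys f \<subseteq> A"
  shows "lin h f = (\<Sum>k\<in>A. Poly_Mapping.lookup f k *\<^sub>c h k)"
  unfolding lin_def using assms by (intro sum.mono_neutral_left) (auto simp: in_keys_iff)

lemma lin_zero [simp]: "lin h 0 = 0"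
  by (simp add: lin_def)

lemma lin_add: "lin h (f + g) = lin h f + lin h g"
proof -
  let ?A = "Poly_Mapping.keys f \<union> Poly_Mapping.keys g"
  show ?thesis
    using keys_add[of f g]
    by (subst (1 2 3) lin_superset[of ?A])
       (auto simp: lookup_add pm_scale_add_left sum.distrib)
qed

lemma lin_scale: "lin h (c *\<^sub>c f) = c *\<^sub>c lin h f"
  by (subst (1 2) lin_superset[of "Poly_Mapping.keys f"]) (auto simp: keys_pm_scale pm_scale_sum)

lemma lin_single [simp]: "lin h (Poly_Mapping.single k c) = c *\<^sub>c h k"
  by (subst lin_superset[of "{k}"]) auto

lemma lin_uminus: "lin h (- f) = - lin h f"
  using lin_scale[of h "-1" f] by (simp add: pm.scale_minus_left)

lemma lin_diff: "lin h (f - g) = lin h f - lin h g"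
  using lin_add[of h f "-g"] by (simp add: lin_uminus)

lemma lin_sum: "lin h (sum f A) = (\<Sum>a\<in>A. lin h (f a))"
  by (induction A rule: infinite_finite_induct) (simp_all add: lin_add)

lemma lin_cong [fundef_cong]:
  "f = g \<Longrightarrow> (\<And>k. k \<in> Poly_Mapping.keys g \<Longrightarrow> h k = h' k) \<Longrightarrow> lin h f = lin h' g"
  by (simp add: lin_def)

lemma lin_fun_add: "lin (\<lambda>k. h k + h' k) f = lin h f + lin h' f"
  by (simp add: lin_def pm_scale_add_right sum.distrib)

lemma lin_fun_scale: "lin (\<lambda>k. c *\<^sub>c h k) f = c *\<^sub>c lin h f"
  by (simp add: lin_def pm_scale_sum mult.commute)

lemma lin_fun_uminus: "lin (\<lambda>k. - h k) f = - lin h f"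
  by (simp add: lin_def pm_scale_uminus sum_negf)

lemma lin_fun_diff: "lin (\<lambda>k. h k - h' k) f = lin h f - lin h' f"
  using lin_fun_add[of h "\<lambda>k. - h' k" f] by (simp add: lin_fun_uminus)

lemma lin_lin: "lin h (lin g f) = lin (\<lambda>k. lin h (g k)) f"
  by (simp add: lin_def[of _ f] lin_sum lin_scale)

lemma lin_ident: "lin (\<lambda>k. Poly_Mapping.single k 1) f = f"
  by (rule poly_mapping_eqI)
     (auto simp: lin_def lookup_sum lookup_single when_def in_keys_iff)

lemma lin_in_subspace:
  assumes "pm.subspace S" "\<And>k. k \<in> Poly_Mapping.keys f \<Longrightarrow> h k \<in> S"
  shows "lin h f \<in> S"
  unfolding lin_def using assms by (auto intro!: pm.subspace_sum pm.subspace_scale)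

lemma pm_scale_diff: "c *\<^sub>c (f - g) = c *\<^sub>c f - c *\<^sub>c g"
  by (rule pm.scale_right_diff_distrib)

text \<open>Scalar-valued counterpart of \<open>lin\<close>. The detour through functions on the
  one-point type lets linearity and composition be inherited from \<open>lin\<close>.\<close>

definition leval :: "('k \<Rightarrow> complex) \<Rightarrow> ('k \<Rightarrow>\<^sub>0 complex) \<Rightarrow> complex" where
  "leval F f = Poly_Mapping.lookup (lin (\<lambda>k. Poly_Mapping.single () (F k)) f) ()"

lemma leval_sum: "leval F f = (\<Sum>k\<in>Poly_Mapping.keys f. Poly_Mapping.lookup f k * F k)"
  by (simp add: leval_def lin_def lookup_sum)

lemma leval_cong [fundef_cong]:
  "f = g \<Longrightarrow> (\<And>k. k \<in> Poly_Mapping.keys g \<Longrightarrow> F k = G k) \<Longrightarrow> leval F f = leval G g"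
  by (simp add: leval_sum)

lemma leval_zero [simp]: "leval F 0 = 0"
  by (simp add: leval_sum)

lemma leval_add: "leval F (f + g) = leval F f + leval F g"
  by (simp add: leval_def lin_add lookup_add)

lemma leval_scale: "leval F (c *\<^sub>c f) = c * leval F f"
  by (simp add: leval_def lin_scale)

lemma leval_uminus: "leval F (- f) = - leval F f"
  by (simp add: leval_def lin_uminus)

lemma leval_diff: "leval F (f - g) = leval F f - leval F g"
  by (simp add: leval_def lin_diff lookup_minus)

lemma leval_single [simp]: "leval F (Poly_Mapping.single k c) = c * F k"
  by (simp add: leval_def)

lemma leval_fun_add: "leval (\<lambda>k. F k + G k) f = leval F f + leval G f"
  by (simp add: leval_sum sum.distrib algebra_simps)

lemma leval_fun_scale: "leval (\<lambda>k. c * F k) f = c * leval F f"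
  by (simp add: leval_sum sum_distrib_left algebra_simps)

lemma leval_lin: "leval F (lin h f) = leval (\<lambda>k. leval F (h k)) f"
  unfolding leval_def lin_lin by (simp add: lin_def lookup_sum)

section \<open>Signs, parities and brackets with a basis vector\<close>

lemma ksign_commute: "ksign p q = ksign q p"
  by (simp add: ksign_def mult.commute)

lemma ksign_simps [simp]: "ksign 0 p = 1" "ksign p 0 = 1" "ksign 1 1 = - 1"
  by (simp_all add: ksign_def)

lemma ksign_square [simp]: "ksign p q * ksign p q = 1" "ksign p q * (ksign p q * c) = c"
  by (simp_all add: ksign_def)

lemma ksign_add: "ksign (p + p') q = ksign p q * ksign p' q" "ksign q (p + p') = ksign q p * ksign q p'"
  by (cases p; cases p'; cases q; simp add: ksign_def)+

lemma basis_bracket_keys_parity: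
  "c \<in> Poly_Mapping.keys (basis_bracket a b) \<Longrightarrow> parity c = parity a + parity b"
  using basis_bracket_parity[of a b] by (auto simp: bms_homogeneous_def)

lemma bms_bracket_lin_left: "bms_bracket x (gen b) = lin (\<lambda>c. basis_bracket c b) x"
  by (simp add: bms_bracket_def lin_def)

lemma bms_bracket_lin_right: "bms_bracket (gen b) x = lin (basis_bracket b) x"
  by (simp add: bms_bracket_def lin_def)

section \<open>The Poincare-Birkhoff-Witt theorem\<close>

text \<open>Letters of \<open>B\<close> are the largest, so in a word without bad pairs they stand
  at the right end, next to the module on which they act. Within the two groups the order is an
  arbitrary enumeration.\<close>

definition pbw_less :: "bms_basis set \<Rightarrow> bms_basis rel" where
  "pbw_less B = inv_image (less_than <*lex*> less_than) (\<lambda>b. (if b \<in> B then 1 else 0, to_nat b))"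

lemma pbw_less_wf: "wf (pbw_less B)"
  unfolding pbw_less_def by (intro wf_inv_image wf_lex_prod wf_less_than)

lemma pbw_less_irrefl [simp]: "(x, x) \<notin> pbw_less B"
  by (auto simp: pbw_less_def)

lemma pbw_less_total: "x \<noteq> y \<Longrightarrow> (x, y) \<in> pbw_less B \<or> (y, x) \<in> pbw_less B"
  by (auto simp: pbw_less_def) (metis injD inj_to_nat linorder_neqE_nat)+

lemma pbw_less_trans: "(x, y) \<in> pbw_less B \<Longrightarrow> (y, z) \<in> pbw_less B \<Longrightarrow> (x, z) \<in> pbw_less B"
  by (auto simp: pbw_less_def split: if_splits)

lemma pbw_less_upper: "(x, y) \<in> pbw_less B \<Longrightarrow> x \<in> B \<Longrightarrow> y \<in> B"
  by (auto simp: pbw_less_def split: if_splits)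

text \<open>An adjacent pair \<open>x, y\<close> of letters of a word has to be rewritten if it is out of order, or if
  it is a repeated odd letter, where $x^2 = \frac12[x,x]$.\<close>

definition bad :: "bms_basis set \<Rightarrow> bms_basis \<Rightarrow> bms_basis \<Rightarrow> bool" where
  "bad B x y \<longleftrightarrow> (y, x) \<in> pbw_less B \<or> x = y \<and> parity x = 1"

text \<open>Length is compared before the letters, so that the terms of a bracket, which replaces
  two letters by one, are always smaller; at equal length, exchanging an out-of-order pair decreases
  the word.\<close>

abbreviation word_less :: "bms_basis set \<Rightarrow> bms_basis list rel" where
  "word_less B \<equiv> lenlex (pbw_less B)"

lemma word_less_wf: "wf (word_less B)"
  by (intro wf_lenlex pbw_less_wf)

lemma word_less_shorter: "length w < length w' \<Longrightarrow> (w, w') \<in> word_less B"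
  by (simp add: lenlex_conv)

lemma word_less_swap: "(y, x) \<in> pbw_less B \<Longrightarrow> (a @ y # x # b, a @ x # y # b) \<in> word_less B"
  by (simp add: lenlex_conv lex_conv) blast

lemma word_less_trans: "(u, v) \<in> word_less B \<Longrightarrow> (v, w) \<in> word_less B \<Longrightarrow> (u, w) \<in> word_less B"
  using lenlex_transI[of "pbw_less B"] pbw_less_trans by (metis transD transI)

text \<open>The choice among several bad pairs is arbitrary; independence of it is the confluence
  statement \<open>pbw_reduct\<close>.\<close>

definition bad_pair :: "bms_basis set \<Rightarrow> bms_basis list \<Rightarrow>
    (bms_basis list \<times> bms_basis \<times> bms_basis \<times> bms_basis list) option" where
  "bad_pair B w = (if \<exists>a x y b. w = a @ x # y # b \<and> bad B x y
     then Some (SOME (a, x, y, b). w = a @ x # y # b \<and> bad B x y) else None)"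

lemma bad_pair_SomeD:
  assumes "bad_pair B w = Some (a, x, y, b)"
  shows "w = a @ x # y # b \<and> bad B x y"
proof -
  have ex: "\<exists>p. case p of (a, x, y, b) \<Rightarrow> w = a @ x # y # b \<and> bad B x y"
    using assms by (auto simp: bad_pair_def split: if_splits)
  from someI_ex[OF ex] show ?thesis
    using assms by (auto simp: bad_pair_def split: if_splits)
qed

lemma bad_pair_NoneD: "bad_pair B w = None \<Longrightarrow> w = a @ x # y # b \<Longrightarrow> \<not> bad B x y"
  by (auto simp: bad_pair_def split: if_splits)

text \<open>The value at \<open>a @ x # y # b\<close> that the relations of the enveloping algebra
  force on a functional \<open>F\<close>, given its values on smaller words. The first branch is
  meant for an odd letter, where $xx = [x,x]/2$.\<close>

definition reduct :: "(bms_basis list \<Rightarrow> complex) \<Rightarrow> bms_basis list \<Rightarrow> bms_basis \<Rightarrow> bms_basis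
    \<Rightarrow> bms_basis list \<Rightarrow> complex" where
  "reduct F a x y b =
     (if x = y then leval (\<lambda>c. F (a @ c # b)) (basis_bracket x y) / 2
      else ksign (parity x) (parity y) * F (a @ y # x # b)
           + leval (\<lambda>c. F (a @ c # b)) (basis_bracket x y))"

text \<open>Shapes the termination conditions of \<open>pbw\<close>: the exchanged word is a
  recursive call only under \<open>x' \<noteq> y'\<close>, the case in which the exchange decreases
  the word.\<close>

lemma reduct_cong [fundef_cong]:
  assumes "a = a'" "x = x'" "y = y'" "b = b'"
    and "x' \<noteq> y' \<Longrightarrow> F (a' @ y' # x' # b') = G (a' @ y' # x' # b')"
    and "\<And>c. F (a' @ c # b') = G (a' @ c # b')"
  shows "reduct F a x y b = reduct G a' x' y' b'"
  using assms by (simp add: reduct_def)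

text \<open>Evaluates the normal form of a word by \<open>\<beta>\<close> without forming it: the
  functional on the free algebra that has the values \<open>\<beta>\<close> on normal words and
  respects the rewriting rules.\<close>

function pbw :: "bms_basis set \<Rightarrow> (bms_basis list \<Rightarrow> complex) \<Rightarrow> bms_basis list \<Rightarrow> complex" where
  "pbw B \<beta> w = (case bad_pair B w of None \<Rightarrow> \<beta> w
     | Some (a, x, y, b) \<Rightarrow> reduct (pbw B \<beta>) a x y b)"
  by pat_completeness auto
termination
proof (relation "same_fst (\<lambda>_. True) (\<lambda>B. same_fst (\<lambda>_. True) (\<lambda>_. word_less B))", goal_cases)
  case 1
  show ?case by (intro wf_same_fst word_less_wf)
next
  case (2 B \<beta> w p a q x r y b)
  then have "bad_pair B w = Some (a, x, y, b)" by simp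
  from bad_pair_SomeD[OF this] 2 show ?case
    by (auto simp: same_fst_def bad_def intro: word_less_swap)
next
  case (3 B \<beta> w p a q x r y b c)
  then have "bad_pair B w = Some (a, x, y, b)" by simp
  from bad_pair_SomeD[OF this] show ?case
    by (auto simp: same_fst_def intro: word_less_shorter)
qed

declare pbw.simps [simp del]

lemma pbw_normal: "(\<And>a x y b. w = a @ x # y # b \<Longrightarrow> \<not> bad B x y) \<Longrightarrow> pbw B \<beta> w = \<beta> w"
  using bad_pair_SomeD[of B w] by (subst pbw.simps) (auto split: option.split)

section \<open>Confluence of the rewriting of words\<close>

lemma bms_bracket_skew_gen:
  assumes "\<And>c. c \<in> Poly_Mapping.keys z \<Longrightarrow> parity c = p"
  shows "bms_bracket z (gen y) = - (ksign p (parity y) *\<^sub>c bms_bracket (gen y) z)"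
proof -
  have "bms_bracket z (gen y) = lin (\<lambda>c. - (ksign p (parity y) *\<^sub>c basis_bracket y c)) z"
    unfolding bms_bracket_lin_left using assms basis_bracket_skew
    by (intro lin_cong refl) metis
  also have "\<dots> = - (ksign p (parity y) *\<^sub>c bms_bracket (gen y) z)"
    by (simp add: lin_fun_uminus lin_fun_scale bms_bracket_lin_right)
  finally show ?thesis .
qed

lemma basis_bracket_even_self: "parity x = 0 \<Longrightarrow> basis_bracket x x = 0"
  by (cases x) (auto simp: Poly_Mapping.single_zero)

text \<open>Vanishing of \<open>F\<close> on the relation for \<open>x\<close> and \<open>y\<close>
  in the context \<open>a\<close>, \<open>b\<close>. In contrast to \<open>reduct\<close> this is
  symmetric in the two letters and makes sense for every pair, in order or not.\<close>

definition commutes :: "(bms_basis list \<Rightarrow> complex) \<Rightarrow> bms_basis list \<Rightarrow> bms_basis \<Rightarrow> bms_basis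
    \<Rightarrow> bms_basis list \<Rightarrow> bool" where
  "commutes F a x y b \<longleftrightarrow> F (a @ x # y # b) =
     ksign (parity x) (parity y) * F (a @ y # x # b) + leval (\<lambda>c. F (a @ c # b)) (basis_bracket x y)"

lemma commutes_sym: "commutes F a x y b \<Longrightarrow> commutes F a y x b"
  by (simp add: commutes_def basis_bracket_skew[of y x] leval_uminus leval_scale algebra_simps
      ksign_commute[of "parity y"] mult.assoc[symmetric])

text \<open>For a repeated odd letter \<open>reduct\<close> gives $F(xx) = F([x,x])/2$, which is the
  commutation relation with sign $-1$ solved for $F(xx)$.\<close>

lemma commutes_reduct:
  assumes "bad B x y" "F (a @ x # y # b) = reduct F a x y b"
  shows "commutes F a x y b"
  using assms by (auto simp: bad_def commutes_def reduct_def ksign_def split: if_splits)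

lemma commutes_bracket_left:
  assumes "\<And>c. c \<in> Poly_Mapping.keys (basis_bracket x y) \<Longrightarrow> commutes F a c z b"
  shows "leval (\<lambda>c. F (a @ c # z # b)) (basis_bracket x y) =
    ksign (parity x) (parity z) * ksign (parity y) (parity z)
        * leval (\<lambda>c. F (a @ z # c # b)) (basis_bracket x y)
      + leval (\<lambda>c. F (a @ c # b)) (bms_bracket (basis_bracket x y) (gen z))"
proof -
  have "leval (\<lambda>c. F (a @ c # z # b)) (basis_bracket x y) =
    leval (\<lambda>c. ksign (parity x) (parity z) * ksign (parity y) (parity z) * F (a @ z # c # b)
       + leval (\<lambda>d. F (a @ d # b)) (basis_bracket c z)) (basis_bracket x y)"
    using assms by (intro leval_cong refl)
      (auto simp: commutes_def basis_bracket_keys_parity ksign_add)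
  then show ?thesis
    by (simp add: leval_fun_add leval_fun_scale bms_bracket_lin_left leval_lin)
qed

lemma commutes_bracket_right:
  assumes "\<And>c. c \<in> Poly_Mapping.keys (basis_bracket x y) \<Longrightarrow> commutes F a z c b"
  shows "leval (\<lambda>c. F (a @ z # c # b)) (basis_bracket x y) =
    ksign (parity z) (parity x) * ksign (parity z) (parity y)
        * leval (\<lambda>c. F (a @ c # z # b)) (basis_bracket x y)
      + leval (\<lambda>c. F (a @ c # b)) (bms_bracket (gen z) (basis_bracket x y))"
proof -
  have "leval (\<lambda>c. F (a @ z # c # b)) (basis_bracket x y) =
    leval (\<lambda>c. ksign (parity z) (parity x) * ksign (parity z) (parity y) * F (a @ c # z # b)
       + leval (\<lambda>d. F (a @ d # b)) (basis_bracket z c)) (basis_bracket x y)"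
    using assms by (intro leval_cong refl)
      (auto simp: commutes_def basis_bracket_keys_parity ksign_add)
  then show ?thesis
    by (simp add: leval_fun_add leval_fun_scale bms_bracket_lin_right leval_lin)
qed

text \<open>The scalar content of the ambiguity $xyz$ with distinct letters. \<open>f1\<close>,
  \<open>f2\<close>, \<open>f0\<close>, \<open>f3\<close>, \<open>f4\<close> are the values at
  $yxz$, $yzx$, $zyx$, $xzy$, $zxy$; the \<open>p\<close>'s are values at words with one bracket;
  \<open>b1\<close> to \<open>b4\<close> are those at $[[x,y],z]$, $[[y,z],x]$, $[y,[x,z]]$,
  $[x,[y,z]]$. The last two premises are the Jacobi identity and skew-symmetry.\<close>

lemma overlap_identity:
  fixes kxy kxz kyz :: complex
  assumes "kxy = 1 \<or> kxy = -1" "kxz = 1 \<or> kxz = -1" "kyz = 1 \<or> kyz = -1"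
    and "f1 = kxz * f2 + p1" "f2 = kyz * f0 + p2" "f3 = kxz * f4 + p3" "f4 = kxy * f0 + p4"
    and "p6 = kxz * kyz * p4 + b1" "p2 = kxy * kxz * p5 + b2" "p1 = kxy * kyz * p3 + b3"
    and "b4 = b1 + kxy * b3" "b2 = - (kxy * kxz * b4)"
  shows "kxy * f1 + p6 = kyz * f3 + p5"
  using assms by (elim disjE) simp_all

text \<open>The ambiguity $xxz$ with \<open>x\<close> odd: \<open>b1\<close> and \<open>b3\<close>
  stand for $[[x,x],z]$ and $[x,[x,z]]$, and the last premise is the Jacobi identity, $[x,[x,z]] =
  [[x,x],z]/2$.\<close>

lemma overlap_identity_left:
  fixes k :: complex
  assumes "k = 1 \<or> k = -1" "f1 = k * f2 + p1" "f2 = p2 / 2" "p4 = p2 + b1" "p3 = b3 - k * p1"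
    and "b3 = b1 - b3"
  shows "p4 / 2 = k * f1 + p3"
proof -
  have "b1 = 2 * b3" using assms(6) by (simp add: eq_diff_eq)
  then show ?thesis using assms(1-5) by (elim disjE) simp_all
qed

text \<open>The mirror image $xyy$ with \<open>y\<close> odd. The last three premises combine to
  $[[y,y],x] = -2k[y,[x,y]]$.\<close>

lemma overlap_identity_right:
  fixes k :: complex
  assumes "k = 1 \<or> k = -1" "f1 = k * f2 + p1" "f2 = p2 / 2" "p2 = p4 + b2" "p1 = b1 - k * p3"
    and "b4 = bb + k * b1" "bb = k * b1" "b2 = - b4"
  shows "k * f1 + p3 = p4 / 2"
proof -
  have "b2 = - (2 * (k * b1))" using assms(6-8) by simp
  then show ?thesis
    using assms(1-5) by (elim disjE) (simp_all add: add_divide_distrib diff_divide_distrib)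
qed

lemma ksign_cases: "ksign p q = 1 \<or> ksign p q = -1"
  by (simp add: ksign_def)

text \<open>The overlap ambiguities of the diamond lemma, resolved by the super Jacobi identity.
  \<open>small\<close> is the induction hypothesis that \<open>F\<close> respects rewriting below
  the given word; \<open>short\<close> also covers pairs that are in order, as they arise when a
  bracket is moved across a letter.\<close>

lemma reduct_overlap:
  assumes small: "\<And>a' x' y' b'. (a' @ x' # y' # b', a @ x # y # z # b) \<in> word_less B \<Longrightarrow>
      bad B x' y' \<Longrightarrow> F (a' @ x' # y' # b') = reduct F a' x' y' b'"
    and short: "\<And>a' x' y' b'. length (a' @ x' # y' # b') < length (a @ x # y # z # b) \<Longrightarrow>
      commutes F a' x' y' b'"
    and xy: "bad B x y" and yz: "bad B y z"
  shows "reduct F a x y (z # b) = reduct F (a @ [x]) y z b"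
proof -
  let ?k = "\<lambda>x y. ksign (parity x) (parity y)"
  let ?L = "\<lambda>u x y v. leval (\<lambda>c. F (a @ u @ c # v @ b)) (basis_bracket x y)"
  let ?B = "\<lambda>z. leval (\<lambda>c. F (a @ c # b)) z"
  have l: "?L [] u v [w] = ?k u w * ?k v w * ?L [w] u v [] + ?B (bms_bracket (basis_bracket u v) (gen w))"
    for u v w
    using commutes_bracket_left[of u v F a w b] short by simp
  have r: "?L [w] u v [] = ?k w u * ?k w v * ?L [] u v [w] + ?B (bms_bracket (gen w) (basis_bracket u v))"
    for u v w
    using commutes_bracket_right[of u v F a w b] short by simp
  have jac: "?B (bms_bracket (gen x) (basis_bracket y z)) =
     ?B (bms_bracket (basis_bracket x y) (gen z)) + ?k x y * ?B (bms_bracket (gen y) (basis_bracket x z))"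
    by (subst basis_bracket_jacobi) (simp add: leval_add leval_scale)
  have sk: "?B (bms_bracket (basis_bracket u v) (gen w)) =
     - (?k u w * ?k v w * ?B (bms_bracket (gen w) (basis_bracket u v)))" for u v w
    by (subst bms_bracket_skew_gen[where p = "parity u + parity v"])
       (auto simp: basis_bracket_keys_parity leval_uminus leval_scale ksign_add)
  have small': "commutes F a' x' y' b'"
    if "(a' @ x' # y' # b', a @ x # y # z # b) \<in> word_less B" "bad B x' y'" for a' x' y' b'
    using commutes_reduct small that by blast
  consider (1) "x \<noteq> y" "y \<noteq> z" | (2) "x = y" "y \<noteq> z" | (3) "x \<noteq> y" "y = z" | (4) "x = y" "y = z"
    by blast
  then show ?thesis
  proof cases
    case 1
    then have lt: "(y, x) \<in> pbw_less B" "(z, y) \<in> pbw_less B" "(z, x) \<in> pbw_less B"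
      using xy yz pbw_less_trans[of z y B x] by (auto simp: bad_def)
    have w: "(a @ y # x # z # b, a @ x # y # z # b) \<in> word_less B"
        "(a @ y # z # x # b, a @ x # y # z # b) \<in> word_less B"
        "(a @ x # z # y # b, a @ x # y # z # b) \<in> word_less B"
        "(a @ z # x # y # b, a @ x # y # z # b) \<in> word_less B"
      using word_less_swap[OF lt(1), of a "z # b"] word_less_swap[OF lt(2), of "a @ [x]" "b"]
        word_less_swap[OF lt(3), of "a @ [y]" "b"] word_less_swap[OF lt(3), of "a" "y # b"]
      by (auto intro: word_less_trans)
    have c: "commutes F (a @ [y]) x z b" "commutes F a y z (x # b)"
         "commutes F a x z (y # b)" "commutes F (a @ [z]) x y b"
      using w lt by (auto intro!: small' simp: bad_def)
    note kc = ksign_commute[of "parity z"] ksign_commute[of "parity y" "parity x"]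
    from c have
      "F (a @ y # x # z # b) = ?k x z * F (a @ y # z # x # b) + ?L [y] x z []"
      "F (a @ y # z # x # b) = ?k y z * F (a @ z # y # x # b) + ?L [] y z [x]"
      "F (a @ x # z # y # b) = ?k x z * F (a @ z # x # y # b) + ?L [] x z [y]"
      "F (a @ z # x # y # b) = ?k x y * F (a @ z # y # x # b) + ?L [z] x y []"
      by (simp_all add: commutes_def)
    note eqs = this
    have "?k x y * F (a @ y # x # z # b) + ?L [] x y [z] = ?k y z * F (a @ x # z # y # b) + ?L [x] y z []"
      by (rule overlap_identity[OF ksign_cases ksign_cases ksign_cases eqs
            l[where u = x and v = y and w = z] l[where u = y and v = z and w = x, unfolded kc]
            r[where u = x and v = z and w = y, unfolded kc] jac
            sk[where u = y and v = z and w = x, unfolded kc]])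
    then show ?thesis using 1 by (simp add: reduct_def)
  next
    case 2
    then have lt: "(z, x) \<in> pbw_less B" and odd: "parity x = 1"
      using xy yz by (auto simp: bad_def)
    have w: "(a @ x # z # y # b, a @ x # y # z # b) \<in> word_less B"
      "(a @ z # x # y # b, a @ x # y # z # b) \<in> word_less B"
      using word_less_swap[OF lt, of "a @ [x]" "b"] word_less_swap[OF lt, of "a" "y # b"] 2
      by (auto intro: word_less_trans)
    have "commutes F a x z (y # b)" "commutes F (a @ [z]) x y b"
      using w lt 2 odd by (auto intro!: small' simp: bad_def)
    then have
      "F (a @ x # z # x # b) = ?k x z * F (a @ z # x # x # b) + ?L [] x z [x]"
      "F (a @ z # x # x # b) = ?L [z] x x [] / 2"
      using 2 odd by (simp_all add: commutes_def ksign_def mult.commute)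
    note eqs = this
    have "?L [] x x [z] / 2 = ?k x z * F (a @ x # z # x # b) + ?L [x] x z []"
      by (rule overlap_identity_left[OF ksign_cases eqs])
         (use 2 odd l[where u = x and v = x and w = z] r[where u = x and v = z and w = x] jac in
           \<open>simp_all only: ksign_simps ksign_square mult_1_left mult_minus1 mult_minus_left add_uminus_conv_diff add.commute uminus_add_conv_diff\<close>)
    then show ?thesis using 2 by (simp add: reduct_def)
  next
    case 3
    then have lt: "(y, x) \<in> pbw_less B" and odd: "parity y = 1"
      using xy yz by (auto simp: bad_def)
    have w: "(a @ y # x # y # b, a @ x # y # z # b) \<in> word_less B"
      "(a @ y # y # x # b, a @ x # y # z # b) \<in> word_less B"
      using word_less_swap[OF lt, of "a @ [y]" "b"] word_less_swap[OF lt, of "a" "y # b"] 3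
      by (auto intro: word_less_trans)
    have c: "commutes F (a @ [y]) x y b" "commutes F a y y (x # b)"
      using w lt 3 odd by (auto intro!: small' simp: bad_def)
    note kc = ksign_commute[of "parity y" "parity x"]
    from c have
      "F (a @ y # x # y # b) = ?k x y * F (a @ y # y # x # b) + ?L [y] x y []"
      "F (a @ y # y # x # b) = ?L [] y y [x] / 2"
      using 3 odd by (simp_all add: commutes_def ksign_def mult.commute)
    note eqs = this
    have "?k x y * F (a @ y # x # y # b) + ?L [] x y [y] = ?L [x] y y [] / 2"
      by (rule overlap_identity_right[where bb = "?B (bms_bracket (basis_bracket x y) (gen y))", OF ksign_cases eqs])
         (use 3 odd l[where u = y and v = y and w = x] r[where u = x and v = y and w = y] jac
           sk[where u = x and v = y and w = y] sk[where u = y and v = y and w = x] in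
           \<open>simp_all only: kc ksign_commute[of 1 "parity x"] ksign_simps ksign_square mult_1_left mult_minus1 mult_minus_left mult_minus_right mult_1_right minus_minus add_uminus_conv_diff add.commute uminus_add_conv_diff\<close>)
    then show ?thesis using 3 by (simp add: reduct_def)
  next
    \<comment> \<open>For an odd letter the Jacobi identity and skew-symmetry give $3[x,[x,x]] = 0$,
      so $[x,x]$ can be moved across \<open>x\<close> freely.\<close>
    case 4
    then show ?thesis
      using xy l[where u = x and v = x and w = x] jac sk[of x x x]
      by (simp add: reduct_def bad_def ksign_def)
  qed
qed

text \<open>Rewriting one of two disjoint bad pairs leaves the other in place, and both orders of
  rewriting lead to the same double sum.\<close>

lemma reduct_disjoint:
  assumes small: "\<And>a' x' y' b'. (a' @ x' # y' # b', a @ x # y # m @ u # v # b) \<in> word_less B \<Longrightarrow>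
      bad B x' y' \<Longrightarrow> F (a' @ x' # y' # b') = reduct F a' x' y' b'"
    and xy: "bad B x y" and uv: "bad B u v"
  shows "reduct F a x y (m @ u # v # b) = reduct F (a @ x # y # m) u v b"
proof -
  let ?k = "\<lambda>x y. ksign (parity x) (parity y)"
  \<comment> \<open>Sign \<open>0\<close> and weight \<open>1 / 2\<close> for equal letters bring
    both branches of \<open>reduct\<close> into one formula.\<close>
  let ?kk = "\<lambda>x y. if x = y then 0 else ksign (parity x) (parity y)"
  let ?h = "\<lambda>x y :: bms_basis. if x = y then 1 / 2 else (1 :: complex)"
  have red: "reduct F a' x y b' = ?kk x y * F (a' @ y # x # b') + ?h x y * leval (\<lambda>c. F (a' @ c # b')) (basis_bracket x y)"
    for a' x y b'
    by (simp add: reduct_def)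
  have A: "F (a @ c # m @ u # v # b) = reduct F (a @ c # m) u v b" for c
    using small[of "a @ c # m" u v b] uv word_less_shorter by simp
  have A': "?kk x y * F (a @ y # x # m @ u # v # b) = ?kk x y * reduct F (a @ y # x # m) u v b"
    using small[of "a @ y # x # m" u v b] xy uv word_less_swap[of y x B a "m @ u # v # b"] 
    by (auto simp: bad_def)
  have C: "F (a @ x # y # m @ c # b) = reduct F a x y (m @ c # b)" for c
    using small[of a x y "m @ c # b"] xy word_less_shorter by simp
  have C': "?kk u v * F (a @ x # y # m @ v # u # b) = ?kk u v * reduct F a x y (m @ v # u # b)"
    using small[of a x y "m @ v # u # b"] xy uv word_less_swap[of v u B "a @ x # y # m" b]
    by (auto simp: bad_def)
  have swap: "leval (\<lambda>c. leval (\<lambda>d. F (a @ d # m @ c # b)) f) g = leval (\<lambda>d. leval (\<lambda>c. F (a @ d # m @ c # b)) g) f"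
    for f g
    by (simp add: leval_sum sum_distrib_left sum_distrib_right) (subst sum.swap, simp add: mult.left_commute)
  have "reduct F a x y (m @ u # v # b)
      = ?kk x y * reduct F (a @ y # x # m) u v b + ?h x y * leval (\<lambda>c. reduct F (a @ c # m) u v b) (basis_bracket x y)"
    unfolding red[of a x y "m @ u # v # b"] A' A ..
  also have "\<dots> = ?kk u v * reduct F a x y (m @ v # u # b) + ?h u v * leval (\<lambda>c. reduct F a x y (m @ c # b)) (basis_bracket u v)"
    unfolding red by (simp only: leval_fun_add leval_fun_scale append_Cons append_Nil append_assoc swap)
       (simp only: distrib_left mult.left_commute mult.assoc add_ac mult_ac)
  also have "\<dots> = reduct F (a @ x # y # m) u v b"
    unfolding red[of "a @ x # y # m" u v b] C[symmetric] C'[symmetric] by simp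
  finally show ?thesis .
qed

lemma reduct_confluent:
  assumes small: "\<And>a' x' y' b'. (a' @ x' # y' # b', w) \<in> word_less B \<Longrightarrow>
      bad B x' y' \<Longrightarrow> F (a' @ x' # y' # b') = reduct F a' x' y' b'"
    and w: "w = a @ x # y # b" "w = a' @ x' # y' # b'" and bad: "bad B x y" "bad B x' y'"
    and le: "length a \<le> length a'"
  shows "reduct F a x y b = reduct F a' x' y' b'"
proof -
  from w have eq: "a @ x # y # b = a' @ x' # y' # b'" by simp
  with le obtain m where m: "a' = a @ m" "x # y # b = m @ x' # y' # b'"
    by (metis append_eq_append_conv_if append_eq_conv_conj append_take_drop_id)
  consider "m = []" | "m = [x]" | n where "m = x # y # n"
    using m(2) by (cases m; cases "tl m") auto
  then show ?thesis
  proof cases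
    case 1
    then show ?thesis using m by simp
  next
    case 2
    have short: "commutes F a' x' y' b'" if "length (a' @ x' # y' # b') < length w" for a' x' y' b'
    proof (cases "x' = y'")
      case True
      then show ?thesis
        using commutes_reduct[of B x' y' F a' b'] small[OF word_less_shorter[OF that]]
        by (cases "parity x'") (auto simp: bad_def commutes_def ksign_def basis_bracket_even_self)
    next
      case False
      then have "bad B x' y' \<or> bad B y' x'"
        using pbw_less_total by (auto simp: bad_def)
      moreover have "length (a' @ y' # x' # b') < length w" using that by simp
      ultimately show ?thesis
        using that commutes_reduct small word_less_shorter commutes_sym by metis
    qed
    with 2 m show ?thesis
      using reduct_overlap[of a x y y' b' B F] small w bad by auto
  next
    case (3 n)
    with m show ?thesis
      using reduct_disjoint[of a x y n x' y' b' B F] small w bad by auto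
  qed
qed

text \<open>The recursion equation gives this for the pair picked by \<open>bad_pair\<close>;
  confluence below the word carries it over to every other bad pair.\<close>

lemma pbw_reduct: "bad B x y \<Longrightarrow> pbw B \<beta> (a @ x # y # b) = reduct (pbw B \<beta>) a x y b"
proof (induction "a @ x # y # b" arbitrary: a x y b rule: wf_induct_rule[OF word_less_wf[of B]])
  case 1
  let ?w = "a @ x # y # b"
  obtain a' x' y' b' where p: "bad_pair B ?w = Some (a', x', y', b')"
    using bad_pair_NoneD[of B ?w a x y b] 1(2) by (cases "bad_pair B ?w") auto
  note q = bad_pair_SomeD[OF p]
  have "pbw B \<beta> ?w = reduct (pbw B \<beta>) a' x' y' b'"
    by (subst pbw.simps) (simp add: p)
  also have "\<dots> = reduct (pbw B \<beta>) a x y b"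
  proof (cases "length a \<le> length a'")
    case True
    then show ?thesis
      using reduct_confluent[of ?w B "pbw B \<beta>" a x y b a' x' y' b'] q 1 by metis
  next
    case False
    then show ?thesis
      using reduct_confluent[of ?w B "pbw B \<beta>" a' x' y' b' a x y b] q 1 by (metis nat_le_linear)
  qed
  finally show ?case .
qed

lemma pbw_commutes: "commutes (pbw B \<beta>) a x y b"
proof (cases "x = y \<and> parity x = 0")
  case True
  then show ?thesis by (auto simp: commutes_def ksign_def basis_bracket_even_self)
next
  case False
  then have "bad B x y \<or> bad B y x"
    using pbw_less_total by (cases "parity x") (auto simp: bad_def)
  then show ?thesis
    using commutes_reduct pbw_reduct commutes_sym by metis
qed

text \<open>Required because \<open>\<beta>\<close> will depend linearly on a vector of the module,
  and the relations express linearity in that vector.\<close>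

lemma pbw_linear:
  assumes "\<And>w. \<beta> w = c * \<beta>' w + d * \<beta>'' w"
  shows "pbw B \<beta> w = c * pbw B \<beta>' w + d * pbw B \<beta>'' w"
proof (induction w rule: wf_induct_rule[OF word_less_wf[of B]])
  case (1 w)
  show ?case
  proof (cases "\<exists>a x y b. w = a @ x # y # b \<and> bad B x y")
    case True
    then obtain a x y b where w: "w = a @ x # y # b" and bad: "bad B x y" by blast
    have IH: "pbw B \<beta> (a @ z # b) = c * pbw B \<beta>' (a @ z # b) + d * pbw B \<beta>'' (a @ z # b)" for z
      using 1[of "a @ z # b"] word_less_shorter w by simp
    have IH': "x \<noteq> y \<Longrightarrow> pbw B \<beta> (a @ y # x # b) = c * pbw B \<beta>' (a @ y # x # b) + d * pbw B \<beta>'' (a @ y # x # b)"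
      using 1[of "a @ y # x # b"] word_less_swap[of y x B a b] w bad by (auto simp: bad_def)
    show ?thesis
      unfolding w pbw_reduct[OF bad] reduct_def
      by (simp add: IH IH' leval_fun_add leval_fun_scale algebra_simps add_divide_distrib)
  next
    case False
    then have "pbw B \<gamma> w = \<gamma> w" for \<gamma>
      by (intro pbw_normal) blast
    then show ?thesis using assms by metis
  qed
qed

section \<open>Separating functionals and induction over finitely supported functions\<close>

lemma complex_ring_simps [simp]:
  "carrier (ring_of_type_algebra :: 'a :: ring_1 ring) = UNIV"
  "\<zero>\<^bsub>ring_of_type_algebra :: 'a ring\<^esub> = 0" "\<one>\<^bsub>ring_of_type_algebra :: 'a ring\<^esub> = 1"
  "x \<oplus>\<^bsub>ring_of_type_algebra :: 'a ring\<^esub> y = x + y" "x \<otimes>\<^bsub>ring_of_type_algebra :: 'a ring\<^esub> y = x * y"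
  by (simp_all add: ring_of_type_algebra_def)

lemma pm_functional_exists:
  fixes S :: "('k \<Rightarrow>\<^sub>0 complex) set"
  assumes "pm.subspace S" "x \<notin> S"
  obtains g where "\<And>f f'. g (f + f') = g f + g f'" "\<And>c f. g (c *\<^sub>c f) = c * g f"
    "\<And>f. f \<in> S \<Longrightarrow> g f = 0" "g x = (1 :: complex)"
proof -
  interpret p: vector_space_pair "(*\<^sub>c) :: complex \<Rightarrow> ('k \<Rightarrow>\<^sub>0 complex) \<Rightarrow> _" "(*) :: complex \<Rightarrow> _"
    by unfold_locales (simp_all add: algebra_simps)
  obtain b where b: "b \<subseteq> S" "pm.independent b" "pm.span b = S"
    using pm.maximal_independent_subset[of S] assms(1)
    by (metis pm.span_eq_iff pm.span_mono subset_antisym)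
  have "pm.independent (insert x b)"
    using b assms(2) by (simp add: pm.independent_insert)
  from p.linear_independent_extend[OF this, of "\<lambda>y. if y = x then 1 else 0"]
  obtain g where g: "Vector_Spaces.linear (*\<^sub>c) (*) g"
      "\<forall>y\<in>insert x b. g y = (if y = x then 1 else 0)" by blast
  interpret g: Vector_Spaces.linear "(*\<^sub>c)" "(*)" g by (rule g)
  have "g f = 0" if "f \<in> S" for f
  proof -
    have "f \<in> pm.span b" using that b by simp
    then show ?thesis
    proof (induction rule: pm.span_induct_alt)
      case base
      show ?case by (rule g.zero)
    next
      case (step c y z)
      then have "y \<noteq> x" using b(1) assms(2) by auto
      then have "g y = 0" using g(2) step(1) by simp
      with step show ?case by (simp add: g.add g.scale)
    qed
  qed
  with g that[of g] show thesis by (auto simp: g.add g.scale)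
qed

lemma bms_span_subspace: "pm.subspace (bms_span B)"
  by (rule pm.subspaceI)
     (auto simp: bms_span_def dest!: subsetD[OF keys_add] subsetD[OF keys_pm_scale])

lemma bms_span_closed [intro]:
  "x \<in> bms_span B \<Longrightarrow> y \<in> bms_span B \<Longrightarrow> x + y \<in> bms_span B"
  "x \<in> bms_span B \<Longrightarrow> c *\<^sub>c x \<in> bms_span B"
  "0 \<in> bms_span B"
  "b \<in> B \<Longrightarrow> Poly_Mapping.single b c \<in> bms_span B"
  using bms_span_subspace[of B] pm.subspace_add pm.subspace_scale pm.subspace_0
  by (blast, blast, blast) (auto simp: bms_span_def)

lemma keys_induct [consumes 1, case_names zero add single]:
  fixes z :: "'k \<Rightarrow>\<^sub>0 complex"
  assumes z: "Poly_Mapping.keys z \<subseteq> A"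
    and P: "P 0" "\<And>x y. Poly_Mapping.keys x \<subseteq> A \<Longrightarrow> Poly_Mapping.keys y \<subseteq> A \<Longrightarrow> P x \<Longrightarrow> P y \<Longrightarrow> P (x + y)"
      "\<And>c k. k \<in> A \<Longrightarrow> P (Poly_Mapping.single k c)"
  shows "P z"
proof -
  have "Poly_Mapping.keys (\<Sum>k\<in>C. Poly_Mapping.single k (Poly_Mapping.lookup z k)) \<subseteq> A \<and>
      P (\<Sum>k\<in>C. Poly_Mapping.single k (Poly_Mapping.lookup z k))"
    if "finite C" "C \<subseteq> A" for C
    using that by (induction C) (auto intro: P dest!: subsetD[OF keys_add] split: if_splits)
  from this[of "Poly_Mapping.keys z"] z have "P (lin (\<lambda>k. Poly_Mapping.single k 1) z)"
    by (simp add: lin_def)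
  then show ?thesis by (simp add: lin_ident)
qed

lemma bms_span_induct [consumes 1, case_names zero add single]:
  assumes "z \<in> bms_span B" "P 0"
    "\<And>x y. x \<in> bms_span B \<Longrightarrow> y \<in> bms_span B \<Longrightarrow> P x \<Longrightarrow> P y \<Longrightarrow> P (x + y)"
    "\<And>c b. b \<in> B \<Longrightarrow> P (Poly_Mapping.single b c)"
  shows "P z"
proof -
  from assms(1) have "Poly_Mapping.keys z \<subseteq> B" by (simp add: bms_span_def)
  then show ?thesis
    by (induction rule: keys_induct) (use assms(2-) in \<open>auto simp: bms_span_def\<close>)
qed

section \<open>Modules over a subalgebra\<close>

locale bms_mod =
  fixes B :: "bms_basis set" and V :: "'v bms_module"
  assumes is_module: "is_bms_module B V"
begin

sublocale V: module complex_ring V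
  using is_module by (simp add: is_bms_module_def)

lemma grade_submodule: "submodule (grade V p) complex_ring V"
  and grade_sum: "grade V 0 <+>\<^bsub>V\<^esub> grade V 1 = carrier V"
  and grade_int: "grade V 0 \<inter> grade V 1 = {\<zero>\<^bsub>V\<^esub>}"
  and act_closed [simp, intro]: "x \<in> bms_span B \<Longrightarrow> v \<in> carrier V \<Longrightarrow> act V x v \<in> carrier V"
  and act_add: "x \<in> bms_span B \<Longrightarrow> v \<in> carrier V \<Longrightarrow> w \<in> carrier V \<Longrightarrow>
    act V x (v \<oplus>\<^bsub>V\<^esub> w) = act V x v \<oplus>\<^bsub>V\<^esub> act V x w"
  and act_smult: "x \<in> bms_span B \<Longrightarrow> v \<in> carrier V \<Longrightarrow> act V x (c \<odot>\<^bsub>V\<^esub> v) = c \<odot>\<^bsub>V\<^esub> act V x v"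
  and act_add_left: "x \<in> bms_span B \<Longrightarrow> y \<in> bms_span B \<Longrightarrow> v \<in> carrier V \<Longrightarrow>
    act V (x + y) v = act V x v \<oplus>\<^bsub>V\<^esub> act V y v"
  and act_smult_left: "x \<in> bms_span B \<Longrightarrow> v \<in> carrier V \<Longrightarrow> act V (c *\<^sub>c x) v = c \<odot>\<^bsub>V\<^esub> act V x v"
  and act_grade: "x \<in> bms_span B \<Longrightarrow> bms_homogeneous p x \<Longrightarrow> v \<in> grade V r \<Longrightarrow> act V x v \<in> grade V (p + r)"
  and act_bracket: "x \<in> bms_span B \<Longrightarrow> y \<in> bms_span B \<Longrightarrow> v \<in> carrier V \<Longrightarrow>
    bms_homogeneous p x \<Longrightarrow> bms_homogeneous r y \<Longrightarrow>
    act V (bms_bracket x y) v = act V x (act V y v) \<ominus>\<^bsub>V\<^esub> ksign p r \<odot>\<^bsub>V\<^esub> act V y (act V x v)"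
  using is_module unfolding is_bms_module_def by - (elim conjE, simp)+

lemma smult_zero_left [simp]: "v \<in> carrier V \<Longrightarrow> 0 \<odot>\<^bsub>V\<^esub> v = \<zero>\<^bsub>V\<^esub>"
  using V.smult_l_null by simp

lemma smult_one_left [simp]: "v \<in> carrier V \<Longrightarrow> (1 :: complex) \<odot>\<^bsub>V\<^esub> v = v"
  using V.smult_one by simp

lemma smult_minus_one: "v \<in> carrier V \<Longrightarrow> (-1) \<odot>\<^bsub>V\<^esub> v = \<ominus>\<^bsub>V\<^esub> v"
  using V.smult_l_distr[of "-1" "1" v] V.M.minus_equality[of "(-1) \<odot>\<^bsub>V\<^esub> v" v] by simp

lemma minus_eq_smult: "v \<in> carrier V \<Longrightarrow> w \<in> carrier V \<Longrightarrow> v \<ominus>\<^bsub>V\<^esub> w = v \<oplus>\<^bsub>V\<^esub> (-1) \<odot>\<^bsub>V\<^esub> w"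
  by (simp add: smult_minus_one V.M.minus_eq)

lemma gen_in_span [simp, intro]: "b \<in> B \<Longrightarrow> gen b \<in> bms_span B"
  by blast

lemma smult_in [simp]: "v \<in> carrier V \<Longrightarrow> (c :: complex) \<odot>\<^bsub>V\<^esub> v \<in> carrier V"
  by simp

lemma smult_smult [simp]: "v \<in> carrier V \<Longrightarrow> (c :: complex) \<odot>\<^bsub>V\<^esub> (d \<odot>\<^bsub>V\<^esub> v) = (c * d) \<odot>\<^bsub>V\<^esub> v"
  using V.smult_assoc1[of c d v] by simp

lemma act_zero_right [simp]: "x \<in> bms_span B \<Longrightarrow> act V x \<zero>\<^bsub>V\<^esub> = \<zero>\<^bsub>V\<^esub>"
  using act_smult[of x "\<zero>\<^bsub>V\<^esub>" 0] by simp

lemma act_zero_left [simp]: "v \<in> carrier V \<Longrightarrow> act V 0 v = \<zero>\<^bsub>V\<^esub>"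
  using act_smult_left[of 0 v 0] by (auto simp: bms_span_def)

lemma act_single: "b \<in> B \<Longrightarrow> v \<in> carrier V \<Longrightarrow>
    act V (Poly_Mapping.single b c) v = c \<odot>\<^bsub>V\<^esub> act V (gen b) v"
  using act_smult_left[of "gen b" v c] by simp

text \<open>Everything is modulo a subspace \<open>S\<close> because \<open>\<phi>\<close> will be linear only modulo the relations of the
  induced module.\<close>

lemma act_lin:
  assumes S: "pm.subspace S" and z: "z \<in> bms_span B" and v: "v \<in> carrier V"
    and add: "\<And>u u'. u \<in> carrier V \<Longrightarrow> u' \<in> carrier V \<Longrightarrow> \<phi> (u \<oplus>\<^bsub>V\<^esub> u') - \<phi> u - \<phi> u' \<in> S"
    and smult: "\<And>c u. u \<in> carrier V \<Longrightarrow> \<phi> (c \<odot>\<^bsub>V\<^esub> u) - c *\<^sub>c \<phi> u \<in> S"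
  shows "\<phi> (act V z v) - lin (\<lambda>b. \<phi> (act V (gen b) v)) z \<in> S"
  using z
proof (induction rule: bms_span_induct)
  case zero
  show ?case using smult[of "\<zero>\<^bsub>V\<^esub>" 0] v by simp
next
  case (add x y)
  have "\<phi> (act V (x + y) v) - \<phi> (act V x v) - \<phi> (act V y v) \<in> S"
    using add v by (simp add: act_add_left assms(4))
  from pm.subspace_add[OF S pm.subspace_add[OF S this add.IH(1)] add.IH(2)] show ?case
    by (simp add: lin_add algebra_simps)
next
  case (single c b)
  then show ?case
    using smult[of "act V (gen b) v" c] v by (simp add: act_single[of b v c])
qed

lemma act_leval:
  assumes z: "z \<in> bms_span B" and v: "v \<in> carrier V"
    and add: "\<And>u u'. u \<in> carrier V \<Longrightarrow> u' \<in> carrier V \<Longrightarrow> \<phi> (u \<oplus>\<^bsub>V\<^esub> u') = \<phi> u + \<phi> u'"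
    and smult: "\<And>c u. u \<in> carrier V \<Longrightarrow> \<phi> (c \<odot>\<^bsub>V\<^esub> u) = c * \<phi> u"
  shows "\<phi> (act V z v) = leval (\<lambda>b. \<phi> (act V (gen b) v)) z"
proof -
  have "Poly_Mapping.single () (\<phi> (act V z v))
      - lin (\<lambda>b. Poly_Mapping.single () (\<phi> (act V (gen b) v))) z \<in> {0}"
    by (rule act_lin[OF _ z v]) (simp_all add: add smult single_add)
  then have "Poly_Mapping.single () (\<phi> (act V z v)) = lin (\<lambda>b. Poly_Mapping.single () (\<phi> (act V (gen b) v))) z"
    by simp
  from arg_cong[OF this, of "\<lambda>f. Poly_Mapping.lookup f ()"] show ?thesis
    by (simp add: leval_def)
qed

section \<open>Action of words, and functionals on the carrier of a module\<close>

definition wact :: "bms_basis list \<Rightarrow> 'v \<Rightarrow> 'v" where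
  "wact w v = foldr (\<lambda>b. act V (gen b)) w v"

lemma wact_simps [simp]: "wact [] v = v" "wact (b # w) v = act V (gen b) (wact w v)"
    "wact (w @ w') v = wact w (wact w' v)"
  by (simp_all add: wact_def)

lemma wact_closed [simp]: "set w \<subseteq> B \<Longrightarrow> v \<in> carrier V \<Longrightarrow> wact w v \<in> carrier V"
  by (induction w) auto

lemma wact_add: "set w \<subseteq> B \<Longrightarrow> v \<in> carrier V \<Longrightarrow> u \<in> carrier V \<Longrightarrow>
    wact w (v \<oplus>\<^bsub>V\<^esub> u) = wact w v \<oplus>\<^bsub>V\<^esub> wact w u"
  by (induction w) (auto simp: act_add)

lemma wact_smult: "set w \<subseteq> B \<Longrightarrow> v \<in> carrier V \<Longrightarrow> wact w (c \<odot>\<^bsub>V\<^esub> v) = c \<odot>\<^bsub>V\<^esub> wact w v"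
  by (induction w) (auto simp: act_smult)

definition veval :: "('v \<Rightarrow>\<^sub>0 complex) \<Rightarrow> 'v" where
  "veval f = (\<Oplus>\<^bsub>V\<^esub>v\<in>Poly_Mapping.keys f. Poly_Mapping.lookup f v \<odot>\<^bsub>V\<^esub> v)"

lemma veval_superset:
  assumes "finite A" "Poly_Mapping.keys f \<subseteq> A" "A \<subseteq> carrier V"
  shows "veval f = (\<Oplus>\<^bsub>V\<^esub>v\<in>A. Poly_Mapping.lookup f v \<odot>\<^bsub>V\<^esub> v)"
  unfolding veval_def using assms
  by (intro V.M.add.finprod_mono_neutral_cong_left) (auto simp: in_keys_iff)

lemma veval_add:
  assumes "Poly_Mapping.keys f \<subseteq> carrier V" "Poly_Mapping.keys g \<subseteq> carrier V"
  shows "veval (f + g) = veval f \<oplus>\<^bsub>V\<^esub> veval g"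
proof -
  let ?A = "Poly_Mapping.keys f \<union> Poly_Mapping.keys g"
  have "veval (f + g) = (\<Oplus>\<^bsub>V\<^esub>v\<in>?A. Poly_Mapping.lookup f v \<odot>\<^bsub>V\<^esub> v \<oplus>\<^bsub>V\<^esub> Poly_Mapping.lookup g v \<odot>\<^bsub>V\<^esub> v)"
    using assms keys_add[of f g]
    by (subst veval_superset[of ?A]) (auto simp: lookup_add V.smult_l_distr[simplified] intro!: V.M.add.finprod_cong')
  also have "\<dots> = veval f \<oplus>\<^bsub>V\<^esub> veval g"
    using assms by (subst V.M.finsum_addf) (auto simp: veval_superset[of ?A])
  finally show ?thesis .
qed

lemma veval_scale:
  assumes "Poly_Mapping.keys f \<subseteq> carrier V"
  shows "veval (c *\<^sub>c f) = c \<odot>\<^bsub>V\<^esub> veval f"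
proof -
  have "veval (c *\<^sub>c f) = (\<Oplus>\<^bsub>V\<^esub>v\<in>Poly_Mapping.keys f. c \<odot>\<^bsub>V\<^esub> (Poly_Mapping.lookup f v \<odot>\<^bsub>V\<^esub> v))"
    using assms keys_pm_scale[of c f]
    by (subst veval_superset[of "Poly_Mapping.keys f"]) (auto intro!: V.M.add.finprod_cong')
  also have "\<dots> = c \<odot>\<^bsub>V\<^esub> veval f"
    unfolding veval_def using assms by (subst V.finsum_smult_ldistr) auto
  finally show ?thesis .
qed

lemma veval_single [simp]: "v \<in> carrier V \<Longrightarrow> veval (Poly_Mapping.single v c) = c \<odot>\<^bsub>V\<^esub> v"
  by (subst veval_superset[of "{v}"]) auto

text \<open>As \<open>V\<close> lives on a carrier set, basis extension is carried out in the free
  space on \<open>carrier V\<close>: a functional vanishing on the kernel of \<open>veval\<close>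
  factors through \<open>V\<close>.\<close>

lemma functional_exists:
  assumes "v \<in> carrier V" "v \<noteq> \<zero>\<^bsub>V\<^esub>"
  obtains \<phi> where "\<And>u u'. u \<in> carrier V \<Longrightarrow> u' \<in> carrier V \<Longrightarrow> \<phi> (u \<oplus>\<^bsub>V\<^esub> u') = \<phi> u + \<phi> u'"
    "\<And>c u. u \<in> carrier V \<Longrightarrow> \<phi> (c \<odot>\<^bsub>V\<^esub> u) = c * \<phi> u" "\<phi> v = (1 :: complex)"
proof -
  let ?S = "{f. Poly_Mapping.keys f \<subseteq> carrier V \<and> veval f = \<zero>\<^bsub>V\<^esub>}"
  have "pm.subspace ?S"
  proof (rule pm.subspaceI)
    show "0 \<in> ?S" by (simp add: veval_def)
    show "x + y \<in> ?S" if "x \<in> ?S" "y \<in> ?S" for x y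
      using that keys_add[of x y] by (auto simp: veval_add)
    show "c *\<^sub>c x \<in> ?S" if "x \<in> ?S" for c x
      using that keys_pm_scale[of c x] by (auto simp: veval_scale)
  qed
  moreover have "Poly_Mapping.single v 1 \<notin> ?S" using assms by simp
  ultimately obtain g where g: "\<And>f f'. g (f + f') = g f + g f'" "\<And>c f. g (c *\<^sub>c f) = c * g f"
    "\<And>f. f \<in> ?S \<Longrightarrow> g f = 0" "g (Poly_Mapping.single v 1) = (1 :: complex)"
    by (rule pm_functional_exists) (rule that)
  define \<phi> where "\<phi> u = g (Poly_Mapping.single u 1)" for u
  have g0: "g f = g h + g k" if "f - h - k \<in> ?S" for f h k
    using g(1)[of "f - h - k" "h + k"] g(1)[of h k] g(3)[OF that] by (simp add: algebra_simps)
  have "Poly_Mapping.single (u \<oplus>\<^bsub>V\<^esub> u') 1 - Poly_Mapping.single u 1 - Poly_Mapping.single u' (1 :: complex) \<in> ?S"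
    if "u \<in> carrier V" "u' \<in> carrier V" for u u'
  proof -
    have e: "Poly_Mapping.single (u \<oplus>\<^bsub>V\<^esub> u') 1 - Poly_Mapping.single u 1 - Poly_Mapping.single u' (1 :: complex)
      = Poly_Mapping.single (u \<oplus>\<^bsub>V\<^esub> u') 1 + (Poly_Mapping.single u (-1) + Poly_Mapping.single u' (-1))"
      by (simp add: single_uminus algebra_simps)
    have k: "Poly_Mapping.keys (Poly_Mapping.single u (-1) + Poly_Mapping.single u' (-1 :: complex)) \<subseteq> carrier V"
      using that keys_add[of "Poly_Mapping.single u (-1)" "Poly_Mapping.single u' (-1 :: complex)"]
      by (auto split: if_splits)
    have k2: "Poly_Mapping.keys (Poly_Mapping.single (u \<oplus>\<^bsub>V\<^esub> u') 1 + (Poly_Mapping.single u (-1) + Poly_Mapping.single u' (-1 :: complex))) \<subseteq> carrier V"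
      using that k keys_add[of "Poly_Mapping.single (u \<oplus>\<^bsub>V\<^esub> u') 1" "Poly_Mapping.single u (-1) + Poly_Mapping.single u' (-1 :: complex)"]
      by (auto split: if_splits)
    have "veval (Poly_Mapping.single (u \<oplus>\<^bsub>V\<^esub> u') 1 + (Poly_Mapping.single u (-1) + Poly_Mapping.single u' (-1 :: complex)))
       = (u \<oplus>\<^bsub>V\<^esub> u') \<oplus>\<^bsub>V\<^esub> (\<ominus>\<^bsub>V\<^esub> u \<oplus>\<^bsub>V\<^esub> \<ominus>\<^bsub>V\<^esub> u')"
      using that k by (simp add: veval_add smult_minus_one V.smult_one[simplified])
    also have "\<dots> = \<zero>\<^bsub>V\<^esub>" using that
      by (simp add: V.M.minus_add[symmetric] V.M.r_neg)
    finally show ?thesis using k2 by (simp add: e)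
  qed
  then have "\<phi> (u \<oplus>\<^bsub>V\<^esub> u') = \<phi> u + \<phi> u'" if "u \<in> carrier V" "u' \<in> carrier V" for u u'
    using g0 that by (simp add: \<phi>_def)
  moreover have "\<phi> (c \<odot>\<^bsub>V\<^esub> u) = c * \<phi> u" if u: "u \<in> carrier V" for c u
  proof -
    have "Poly_Mapping.single (c \<odot>\<^bsub>V\<^esub> u) 1 + Poly_Mapping.single u (-c) \<in> ?S"
      using u keys_add[of "Poly_Mapping.single (c \<odot>\<^bsub>V\<^esub> u) 1" "Poly_Mapping.single u (-c)"]
        V.smult_l_distr[of c "-c" u]
      by (auto simp: veval_add V.smult_one[simplified] split: if_splits)
    then have "Poly_Mapping.single (c \<odot>\<^bsub>V\<^esub> u) 1 - 0 - Poly_Mapping.single u c \<in> ?S"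
      by (simp add: single_uminus)
    from g0[OF this] g(2)[of c "Poly_Mapping.single u 1"] g(2)[of 0 0] show ?thesis
      by (simp add: \<phi>_def)
  qed
  ultimately show thesis using that[of \<phi>] g(4) by (simp add: \<phi>_def)
qed

end

section \<open>The induced module by generators and relations\<close>

type_synonym 'v word_space = "(bms_basis list \<times> 'v) \<Rightarrow>\<^sub>0 complex"

abbreviation pv :: "bms_basis list \<Rightarrow> 'v \<Rightarrow> 'v word_space" where
  "pv w v \<equiv> Poly_Mapping.single (w, v) 1"

definition lmul :: "bms_basis \<Rightarrow> 'v word_space \<Rightarrow> 'v word_space" where
  "lmul b = lin (\<lambda>(w, v). pv (b # w) v)"

definition lmulw :: "bms_basis list \<Rightarrow> 'v word_space \<Rightarrow> 'v word_space" where
  "lmulw = foldr lmul"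

lemma lmul_simps:
  "lmul b (f + g) = lmul b f + lmul b g" "lmul b (c *\<^sub>c f) = c *\<^sub>c lmul b f" "lmul b 0 = 0"
  "lmul b (f - g) = lmul b f - lmul b g" "lmul b (- f) = - lmul b f"
  "lmul b (sum s A) = (\<Sum>a\<in>A. lmul b (s a))" "lmul b (lin h z) = lin (\<lambda>k. lmul b (h k)) z"
  by (simp_all add: lmul_def lin_add lin_scale lin_diff lin_uminus lin_sum lin_lin)

lemma lmul_single [simp]: "lmul b (Poly_Mapping.single (w, v) c) = Poly_Mapping.single (b # w, v) c"
  by (simp add: lmul_def)

lemma lmulw_simps [simp]: "lmulw [] f = f" "lmulw (b # w) f = lmul b (lmulw w f)"
    "lmulw (w @ w') f = lmulw w (lmulw w' f)"
  by (simp_all add: lmulw_def)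

lemma lmulw_lin:
  "lmulw w (f + g) = lmulw w f + lmulw w g" "lmulw w (c *\<^sub>c f) = c *\<^sub>c lmulw w f" "lmulw w 0 = 0"
  "lmulw w (f - g) = lmulw w f - lmulw w g" "lmulw w (lin h z) = lin (\<lambda>k. lmulw w (h k)) z"
  by (induction w) (simp_all add: lmul_simps)

lemma lmulw_single [simp]: "lmulw w (Poly_Mapping.single (w', v) c) = Poly_Mapping.single (w @ w', v) c"
  by (induction w) simp_all

locale ind_mod = bms_mod +
  assumes B_closed: "a \<in> B \<Longrightarrow> b \<in> B \<Longrightarrow> basis_bracket a b \<in> bms_span B"
begin

text \<open>With \<open>(w, v)\<close> standing for $w\otimes v$, the induced module will turn out to be the space of
  combinations of pairs modulo the span \<open>K\<close> of the following relations.\<close>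

definition rels :: "'a word_space set" where
  "rels = {pv w (v \<oplus>\<^bsub>V\<^esub> v') - pv w v - pv w v' | w v v'. v \<in> carrier V \<and> v' \<in> carrier V}
    \<union> {pv w (c \<odot>\<^bsub>V\<^esub> v) - c *\<^sub>c pv w v | w c v. v \<in> carrier V}
    \<union> {pv (a @ x # y # b) v - ksign (parity x) (parity y) *\<^sub>c pv (a @ y # x # b) v
         - lin (\<lambda>c. pv (a @ c # b) v) (basis_bracket x y) | a x y b v. v \<in> carrier V}
    \<union> {pv (a @ [x]) v - pv a (act V (gen x) v) | a x v. x \<in> B \<and> v \<in> carrier V}"

definition K where "K = pm.span rels"

lemma K_subspace [simp]: "pm.subspace K"
  by (simp add: K_def)

lemma K_closed: "0 \<in> K" "x \<in> K \<Longrightarrow> y \<in> K \<Longrightarrow> x + y \<in> K" "x \<in> K \<Longrightarrow> c *\<^sub>c x \<in> K"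
    "x \<in> K \<Longrightarrow> y \<in> K \<Longrightarrow> x - y \<in> K" "x \<in> K \<Longrightarrow> - x \<in> K"
  by (simp_all add: K_def pm.span_zero pm.span_add pm.span_scale pm.span_diff pm.span_neg)

lemma K_rels:
  "v \<in> carrier V \<Longrightarrow> v' \<in> carrier V \<Longrightarrow> pv w (v \<oplus>\<^bsub>V\<^esub> v') - pv w v - pv w v' \<in> K"
  "v \<in> carrier V \<Longrightarrow> pv w (c \<odot>\<^bsub>V\<^esub> v) - c *\<^sub>c pv w v \<in> K"
  "v \<in> carrier V \<Longrightarrow> pv (a @ x # y # b) v - ksign (parity x) (parity y) *\<^sub>c pv (a @ y # x # b) v
         - lin (\<lambda>c. pv (a @ c # b) v) (basis_bracket x y) \<in> K"
  "x \<in> B \<Longrightarrow> v \<in> carrier V \<Longrightarrow> pv (a @ [x]) v - pv a (act V (gen x) v) \<in> K"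
     apply (unfold K_def rels_def)
     apply (rule pm.span_base, rule UnI1, rule UnI1, rule UnI1, blast)
    apply (rule pm.span_base, rule UnI1, rule UnI1, rule UnI2, blast)
   apply (rule pm.span_base, rule UnI1, rule UnI2, blast)
  apply (rule pm.span_base, rule UnI2, blast)
  done

lemma K_induct [consumes 1, case_names zero add scale r_add r_smult r_comm r_act]:
  assumes f: "f \<in> K" and P: "P 0" "\<And>f g. P f \<Longrightarrow> P g \<Longrightarrow> P (f + g)" "\<And>c f. P f \<Longrightarrow> P (c *\<^sub>c f)"
    and "\<And>w v v'. v \<in> carrier V \<Longrightarrow> v' \<in> carrier V \<Longrightarrow> P (pv w (v \<oplus>\<^bsub>V\<^esub> v') - pv w v - pv w v')"
    and "\<And>w c v. v \<in> carrier V \<Longrightarrow> P (pv w (c \<odot>\<^bsub>V\<^esub> v) - c *\<^sub>c pv w v)"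
    and "\<And>a x y b v. v \<in> carrier V \<Longrightarrow> P (pv (a @ x # y # b) v
        - ksign (parity x) (parity y) *\<^sub>c pv (a @ y # x # b) v
         - lin (\<lambda>c. pv (a @ c # b) v) (basis_bracket x y))"
    and "\<And>a x v. x \<in> B \<Longrightarrow> v \<in> carrier V \<Longrightarrow> P (pv (a @ [x]) v - pv a (act V (gen x) v))"
  shows "P f"
  using f unfolding K_def
proof (induction rule: pm.span_induct_alt)
  case base
  show ?case by (rule P)
next
  case (step c x y)
  from step(1) have "P x"
    unfolding rels_def by (elim UnE CollectE exE conjE) (simp_all only: assms(5-))
  then show ?case using step by (intro P)
qed

text \<open>In every family of relations the letters on the left are arbitrary, so prepending one
  stays in the family.\<close>

lemma lmul_K: "f \<in> K \<Longrightarrow> lmul b f \<in> K"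
proof (induction rule: K_induct)
  case (r_comm a x y b' v)
  then show ?case using K_rels(3)[of v "b # a" x y b'] by (simp add: lmul_simps)
next
  case (r_act a x v)
  then show ?case using K_rels(4)[of x v "b # a"] by (simp add: lmul_simps)
qed (simp_all add: K_closed lmul_simps K_rels pm.subspace_0 del: pm_scale_single) 

lemma lmulw_K: "f \<in> K \<Longrightarrow> lmulw w f \<in> K"
  by (induction w) (simp_all add: lmul_K)

text \<open>The assumption on \<open>\<gamma>\<close> is that a last letter in \<open>B\<close> may
  be made to act on the vector; this has to survive the passage to normal forms. A bad pair away
  from the last letter is rewritten on both sides alike. If the last letter takes part, the module
  axiom for the bracket on \<open>V\<close> matches the rewriting rule.\<close>

lemma pbw_act:
  assumes add: "\<And>u u' w. u \<in> carrier V \<Longrightarrow> u' \<in> carrier V \<Longrightarrow> \<gamma> (u \<oplus>\<^bsub>V\<^esub> u') w = \<gamma> u w + \<gamma> u' w"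
    and smult: "\<And>c u w. u \<in> carrier V \<Longrightarrow> \<gamma> (c \<odot>\<^bsub>V\<^esub> u) w = c * \<gamma> u w"
    and last: "\<And>x u w. x \<in> B \<Longrightarrow> u \<in> carrier V \<Longrightarrow> \<gamma> u (w @ [x]) = \<gamma> (act V (gen x) u) w"
    and "x \<in> B" "v \<in> carrier V"
  shows "pbw B (\<gamma> v) (a @ [x]) = pbw B (\<gamma> (act V (gen x) v)) a"
  using assms(4,5)
proof (induction "a @ [x]" arbitrary: a x v rule: wf_induct_rule[OF word_less_wf[of B]])
  case 1
  have IH: "pbw B (\<gamma> v') (a' @ [x']) = pbw B (\<gamma> (act V (gen x') v')) a'"
    if "(a' @ [x'], a @ [x]) \<in> word_less B" "x' \<in> B" "v' \<in> carrier V" for a' x' v'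
    using 1(1) that by blast
  have lin: "pbw B (\<gamma> (u \<oplus>\<^bsub>V\<^esub> u')) w = pbw B (\<gamma> u) w + pbw B (\<gamma> u') w"
      "pbw B (\<gamma> (c \<odot>\<^bsub>V\<^esub> u)) w = c * pbw B (\<gamma> u) w"
    if "u \<in> carrier V" "u' \<in> carrier V" for u u' c w
    using pbw_linear[of "\<gamma> (u \<oplus>\<^bsub>V\<^esub> u')" 1 "\<gamma> u" 1 "\<gamma> u'" B w]
      pbw_linear[of "\<gamma> (c \<odot>\<^bsub>V\<^esub> u)" c "\<gamma> u" 0 "\<gamma> u" B w] that add smult by simp_all
  consider (inner) a' u w a'' where "a = a' @ u # w # a''" "bad B u w"
    | (last) a' u where "a = a' @ [u]" "bad B u x"
    | (normal) "\<And>a' u w a''. a @ [x] = a' @ u # w # a'' \<Longrightarrow> \<not> bad B u w"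
  proof (cases "\<exists>a' u w a''. a @ [x] = a' @ u # w # a'' \<and> bad B u w")
    case True
    then obtain a' u w a'' where *: "a @ [x] = a' @ u # w # a''" "bad B u w" by blast
    then show thesis
    proof (cases a'' rule: rev_cases)
      case Nil
      then have "a = a' @ [u]" "w = x" using * by auto
      then show thesis using that(2) * by simp
    next
      case (snoc ys y)
      then have "a = a' @ u # w # ys" using * by (simp flip: append_Cons append_assoc)
      then show thesis using that(1) * by simp
    qed
  qed (use that in blast)
  then show ?case
  proof cases
    case inner
    have "pbw B (\<gamma> v) (a' @ w # u # a'' @ [x]) = pbw B (\<gamma> (act V (gen x) v)) (a' @ w # u # a'')" if "u \<noteq> w"
      using IH[of "a' @ w # u # a''" x v] word_less_swap[of w u B a' "a'' @ [x]"] inner that 1 by (auto simp: bad_def)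
    moreover have "pbw B (\<gamma> v) (a' @ c # a'' @ [x]) = pbw B (\<gamma> (act V (gen x) v)) (a' @ c # a'')" for c
      using IH[of "a' @ c # a''" x v] word_less_shorter inner 1 by simp
    ultimately have "reduct (pbw B (\<gamma> v)) a' u w (a'' @ [x]) = reduct (pbw B (\<gamma> (act V (gen x) v))) a' u w a''"
      by (simp add: reduct_def)
    then show ?thesis using inner pbw_reduct by simp
  next
    case last
    \<comment> \<open>Letters of \<open>B\<close> are the largest, so a letter that forms a bad pair
      with a following \<open>x \<in> B\<close> is itself in \<open>B\<close>, and it can act on
      \<open>V\<close>.\<close>
    then have u: "u \<in> B" using 1(2) pbw_less_upper by (auto simp: bad_def)
    note v = \<open>v \<in> carrier V\<close> \<open>x \<in> B\<close>
    let ?F = "\<lambda>v. pbw B (\<gamma> v)"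
    have F: "?F v (a' @ [c]) = ?F (act V (gen c) v) a'" if "c \<in> B" for c
      using IH[of a' c v] that v last word_less_shorter by simp
    have br: "leval (\<lambda>c. ?F v (a' @ [c])) (basis_bracket u x) = ?F (act V (basis_bracket u x) v) a'"
    proof -
      have "?F (act V (basis_bracket u x) v) a' = leval (\<lambda>c. ?F (act V (gen c) v) a') (basis_bracket u x)"
        using B_closed u v lin by (intro act_leval) auto
      also have "\<dots> = leval (\<lambda>c. ?F v (a' @ [c])) (basis_bracket u x)"
        using F B_closed[OF u v(2)] by (intro leval_cong refl) (auto simp: bms_span_def)
      finally show ?thesis by simp
    qed
    have "act V (bms_bracket (gen u) (gen x)) v = act V (gen u) (act V (gen x) v)
        \<ominus>\<^bsub>V\<^esub> ksign (parity u) (parity x) \<odot>\<^bsub>V\<^esub> act V (gen x) (act V (gen u) v)"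
      using u v by (intro act_bracket) (auto simp: bms_homogeneous_def)
    then have "?F (act V (basis_bracket u x) v) a' = ?F (act V (gen u) (act V (gen x) v)) a'
        - ksign (parity u) (parity x) * ?F (act V (gen x) (act V (gen u) v)) a'"
      using u v by (simp add: minus_eq_smult lin)
    moreover have "?F (act V (gen x) (act V (gen u) v)) a' = ?F v (a' @ [x, u])" if "u \<noteq> x"
    proof -
      have "?F v ((a' @ [x]) @ [u]) = ?F (act V (gen u) v) (a' @ [x])"
        using IH[of "a' @ [x]" u v] word_less_swap[of x u B a' "[]"] last that u v by (auto simp: bad_def)
      also have "\<dots> = ?F (act V (gen x) (act V (gen u) v)) a'"
        using IH[of a' x "act V (gen u) v"] word_less_shorter u v last by simp
      finally show ?thesis by simp
    qed
    moreover have "?F (act V (gen x) v) (a' @ [u]) = ?F (act V (gen u) (act V (gen x) v)) a'"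
      using IH[of a' u "act V (gen x) v"] word_less_shorter u v last by simp
    ultimately show ?thesis
      using br last pbw_reduct[of B u x "\<gamma> v" a' "[]"] by (auto simp: reduct_def bad_def ksign_def mult.commute)
  next
    case normal
    then have "\<not> bad B u w" if "a = a' @ u # w # a''" for a' u w a''
      using that by simp
    with normal 1 last show ?thesis
      using pbw_normal[of "a @ [x]"] pbw_normal[of a] by metis
  qed
qed

text \<open>A linear form on \<open>V\<close>, extended by zero to the normal words with a letter outside \<open>B\<close>, yields by
  the Poincare-Birkhoff-Witt construction a linear form that vanishes on \<open>K\<close>.\<close>

lemma pv_in_K_D:
  assumes v: "v \<in> carrier V" and K: "pv [] v \<in> K"
  shows "v = \<zero>\<^bsub>V\<^esub>"
proof (rule ccontr)
  assume "v \<noteq> \<zero>\<^bsub>V\<^esub>"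
  from functional_exists[OF v this] obtain \<phi> where
    \<phi>: "\<And>u u'. u \<in> carrier V \<Longrightarrow> u' \<in> carrier V \<Longrightarrow> \<phi> (u \<oplus>\<^bsub>V\<^esub> u') = \<phi> u + \<phi> u'"
    "\<And>c u. u \<in> carrier V \<Longrightarrow> \<phi> (c \<odot>\<^bsub>V\<^esub> u) = c * \<phi> u" "\<phi> v = (1 :: complex)"
    by blast
  define \<gamma> where "\<gamma> u w = (if set w \<subseteq> B then \<phi> (wact w u) else 0)" for u w
  have \<gamma>: "\<gamma> (u \<oplus>\<^bsub>V\<^esub> u') w = \<gamma> u w + \<gamma> u' w" "\<gamma> (c \<odot>\<^bsub>V\<^esub> u) w = c * \<gamma> u w"
      "x \<in> B \<Longrightarrow> \<gamma> u (w @ [x]) = \<gamma> (act V (gen x) u) w"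
    if "u \<in> carrier V" "u' \<in> carrier V" for u u' w c x
    using that by (simp_all add: \<gamma>_def \<phi> wact_add wact_smult)
  have "leval (\<lambda>(w, u). pbw B (\<gamma> u) w) f = 0" if "f \<in> K" for f
    using that
  proof (induction rule: K_induct)
    case (r_add w v v')
    then show ?case
      using pbw_linear[of "\<gamma> (v \<oplus>\<^bsub>V\<^esub> v')" 1 "\<gamma> v" 1 "\<gamma> v'" B w] \<gamma> by (simp add: leval_diff)
  next
    case (r_smult w c v)
    then show ?case
      using pbw_linear[of "\<gamma> (c \<odot>\<^bsub>V\<^esub> v)" c "\<gamma> v" 0 "\<gamma> v" B w] \<gamma> by (simp add: leval_diff)
  next
    case (r_comm a x y b v)
    then show ?case
      using pbw_commutes[of B "\<gamma> v" a x y b] by (simp add: leval_diff leval_lin commutes_def)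
  next
    case (r_act a x v)
    then show ?case
      using pbw_act[of \<gamma> x v a] \<gamma> by (simp add: leval_diff)
  qed (simp_all add: leval_add leval_scale)
  from this[OF K] have "pbw B (\<gamma> v) [] = 0" by simp
  then have "\<gamma> v [] = 0" using pbw_normal[of "[]"] by simp
  then show False using \<phi> by (simp add: \<gamma>_def)
qed


section \<open>Calculus modulo the relations\<close>

definition PV :: "'a word_space set" where
  "PV = {f. Poly_Mapping.keys f \<subseteq> UNIV \<times> carrier V}"

lemma PV_subspace: "pm.subspace PV"
  by (rule pm.subspaceI)
     (auto simp: PV_def dest!: subsetD[OF keys_add] subsetD[OF keys_pm_scale])

lemma PV_closed [simp]: "0 \<in> PV" "x \<in> PV \<Longrightarrow> y \<in> PV \<Longrightarrow> x + y \<in> PV" "x \<in> PV \<Longrightarrow> c *\<^sub>c x \<in> PV"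
    "x \<in> PV \<Longrightarrow> y \<in> PV \<Longrightarrow> x - y \<in> PV" "v \<in> carrier V \<Longrightarrow> Poly_Mapping.single (w, v) c \<in> PV" "x \<in> PV \<Longrightarrow> - x \<in> PV"
  using PV_subspace pm.subspace_0 pm.subspace_add pm.subspace_scale pm.subspace_diff
  by (blast, blast, blast, blast) (auto simp: PV_def)

lemma PV_induct [consumes 1, case_names zero add single]:
  assumes "z \<in> PV" "P 0" "\<And>x y. x \<in> PV \<Longrightarrow> y \<in> PV \<Longrightarrow> P x \<Longrightarrow> P y \<Longrightarrow> P (x + y)"
    "\<And>c w v. v \<in> carrier V \<Longrightarrow> P (c *\<^sub>c pv w v)"
  shows "P z"
proof -
  from assms(1) have "Poly_Mapping.keys z \<subseteq> UNIV \<times> carrier V" by (simp add: PV_def)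
  then show ?thesis
    by (induction rule: keys_induct) (use assms(2-) in \<open>auto simp: PV_def\<close>)
qed

lemma lmul_PV [simp]: "f \<in> PV \<Longrightarrow> lmul b f \<in> PV"
  by (induction rule: PV_induct) (simp_all add: lmul_simps del: pm_scale_single)

lemma lmulw_PV [simp]: "f \<in> PV \<Longrightarrow> lmulw w f \<in> PV"
  by (induction w) simp_all

lemma K_PV: "f \<in> K \<Longrightarrow> f \<in> PV"
proof (induction rule: K_induct)
  case (r_comm a x y b v)
  then show ?case
    by (intro PV_closed lin_in_subspace PV_subspace)
next
  case (r_act a x v)
  then show ?case by (intro PV_closed act_closed gen_in_span)
qed simp_all

definition eqv (infix "\<doteq>" 50) where "f \<doteq> g \<longleftrightarrow> f - g \<in> K"

lemma eqv_refl [simp]: "f \<doteq> f"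
  and eqv_sym: "f \<doteq> g \<Longrightarrow> g \<doteq> f"
  and eqv_trans [trans]: "f \<doteq> g \<Longrightarrow> g \<doteq> h \<Longrightarrow> f \<doteq> h"
  and eqv_add: "f \<doteq> g \<Longrightarrow> f' \<doteq> g' \<Longrightarrow> f + f' \<doteq> g + g'"
  and eqv_diff: "f \<doteq> g \<Longrightarrow> f' \<doteq> g' \<Longrightarrow> f - f' \<doteq> g - g'"
  and eqv_uminus: "f \<doteq> g \<Longrightarrow> - f \<doteq> - g"
  and eqv_scale: "f \<doteq> g \<Longrightarrow> c *\<^sub>c f \<doteq> c *\<^sub>c g"
  and eqv_lmul: "f \<doteq> g \<Longrightarrow> lmul b f \<doteq> lmul b g"
  and eqv_lmulw: "f \<doteq> g \<Longrightarrow> lmulw w f \<doteq> lmulw w g"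
  and eqv_zero: "f \<doteq> 0 \<longleftrightarrow> f \<in> K"
proof -
  show "f \<doteq> g \<Longrightarrow> g \<doteq> f" using K_closed(5)[of "f - g"] by (simp add: eqv_def)
  show "f \<doteq> g \<Longrightarrow> g \<doteq> h \<Longrightarrow> f \<doteq> h" using K_closed(2)[of "f - g" "g - h"] by (simp add: eqv_def)
  show "f \<doteq> g \<Longrightarrow> f' \<doteq> g' \<Longrightarrow> f + f' \<doteq> g + g'"
    using K_closed(2)[of "f - g" "f' - g'"] by (simp add: eqv_def algebra_simps)
  show "f \<doteq> g \<Longrightarrow> f' \<doteq> g' \<Longrightarrow> f - f' \<doteq> g - g'"
    using K_closed(4)[of "f - g" "f' - g'"] by (simp add: eqv_def algebra_simps)
  show "f \<doteq> g \<Longrightarrow> - f \<doteq> - g"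
    using K_closed(5)[of "f - g"] by (simp add: eqv_def algebra_simps)
  show "f \<doteq> g \<Longrightarrow> c *\<^sub>c f \<doteq> c *\<^sub>c g"
    using K_closed(3)[of "f - g"] by (simp add: eqv_def pm_scale_diff)
  show "f \<doteq> g \<Longrightarrow> lmul b f \<doteq> lmul b g"
    using lmul_K[of "f - g"] by (simp add: eqv_def lmul_simps)
  show "f \<doteq> g \<Longrightarrow> lmulw w f \<doteq> lmulw w g"
    using lmulw_K[of "f - g"] by (simp add: eqv_def lmulw_lin)
qed (simp_all add: eqv_def K_closed)

lemma eqv_mem: "f \<doteq> g \<Longrightarrow> pm.subspace N \<Longrightarrow> K \<subseteq> N \<Longrightarrow> f \<in> N \<longleftrightarrow> g \<in> N"
  using pm.subspace_add[of N "f - g" g] pm.subspace_diff[of N f "f - g"] by (auto simp: eqv_def)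

lemma eqv_K: "f \<doteq> g \<Longrightarrow> f \<in> K \<longleftrightarrow> g \<in> K"
  by (rule eqv_mem) auto

lemma lmul_comm:
  assumes "f \<in> PV"
  shows "lmul x (lmul y f) \<doteq> ksign (parity x) (parity y) *\<^sub>c lmul y (lmul x f)
     + lin (\<lambda>b. lmul b f) (basis_bracket x y)"
  using assms
proof (induction rule: PV_induct)
  case zero
  show ?case by (simp add: lmul_simps lin_def)
next
  case (add f g)
  from eqv_add[OF add.IH] show ?case
    by (simp add: lmul_simps lin_fun_add pm_scale_add_right algebra_simps)
next
  case (single c w v)
  have "pv (x # y # w) v \<doteq> ksign (parity x) (parity y) *\<^sub>c pv (y # x # w) v
     + lin (\<lambda>b. pv (b # w) v) (basis_bracket x y)"
    using K_rels(3)[OF single, of "[]" x y w] by (simp add: eqv_def algebra_simps)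
  from eqv_scale[OF this, of c] show ?case
    by (simp add: lmul_simps lin_fun_scale pm_scale_add_right mult.commute del: pm_scale_single)
qed

lemma pv_act: "x \<in> B \<Longrightarrow> v \<in> carrier V \<Longrightarrow> lmul x (pv [] v) \<doteq> pv [] (act V (gen x) v)"
  using K_rels(4)[of x v "[]"] by (simp add: eqv_def)

lemma pv_add: "v \<in> carrier V \<Longrightarrow> v' \<in> carrier V \<Longrightarrow> pv w (v \<oplus>\<^bsub>V\<^esub> v') \<doteq> pv w v + pv w v'"
  using K_rels(1)[of v v' w] by (simp add: eqv_def algebra_simps)

lemma pv_smult: "v \<in> carrier V \<Longrightarrow> pv w (c \<odot>\<^bsub>V\<^esub> v) \<doteq> c *\<^sub>c pv w v"
  using K_rels(2)[of v w c] by (simp add: eqv_def)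

lemma pv_zero: "pv w \<zero>\<^bsub>V\<^esub> \<in> K"
  using pv_smult[of "\<zero>\<^bsub>V\<^esub>" w 0] by (simp add: eqv_zero)

lemma pv_wact: "set w \<subseteq> B \<Longrightarrow> v \<in> carrier V \<Longrightarrow> pv w v \<doteq> pv [] (wact w v)"
proof (induction w)
  case (Cons b w)
  then have "lmul b (pv w v) \<doteq> lmul b (pv [] (wact w v))" by (intro eqv_lmul) simp
  also have "\<dots> \<doteq> pv [] (act V (gen b) (wact w v))" using Cons by (intro pv_act) auto
  finally show ?case by simp
qed simp

text \<open>Subspaces of the induced module are represented by their preimages, which contain \<open>K\<close>.\<close>

definition Sp :: "bms_basis list set \<Rightarrow> 'a word_space set" where
  "Sp A = pm.span (K \<union> {f. \<exists>w\<in>A. \<exists>v\<in>carrier V. f = pv w v})"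

lemma Sp_subspace [simp]: "pm.subspace (Sp A)"
  by (simp add: Sp_def)

lemma Sp_closed: "0 \<in> Sp A" "f \<in> Sp A \<Longrightarrow> g \<in> Sp A \<Longrightarrow> f + g \<in> Sp A" "f \<in> Sp A \<Longrightarrow> c *\<^sub>c f \<in> Sp A"
    "f \<in> Sp A \<Longrightarrow> g \<in> Sp A \<Longrightarrow> f - g \<in> Sp A" "f \<in> Sp A \<Longrightarrow> - f \<in> Sp A"
  by (simp_all add: Sp_def pm.span_zero pm.span_add pm.span_scale pm.span_diff pm.span_neg)

lemma K_Sp: "f \<in> K \<Longrightarrow> f \<in> Sp A"
  unfolding Sp_def by (rule pm.span_base) simp

lemma K_subset_Sp [simp]: "K \<subseteq> Sp A"
  using K_Sp by blast

lemma pv_Sp: "w \<in> A \<Longrightarrow> v \<in> carrier V \<Longrightarrow> pv w v \<in> Sp A"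
  unfolding Sp_def by (rule pm.span_base) blast

lemma Sp_induct [consumes 1, case_names ker add scale word]:
  assumes "f \<in> Sp A" "\<And>f. f \<in> K \<Longrightarrow> P f" "\<And>f g. f \<in> Sp A \<Longrightarrow> g \<in> Sp A \<Longrightarrow> P f \<Longrightarrow> P g \<Longrightarrow> P (f + g)"
    "\<And>c f. f \<in> Sp A \<Longrightarrow> P f \<Longrightarrow> P (c *\<^sub>c f)" "\<And>w v. w \<in> A \<Longrightarrow> v \<in> carrier V \<Longrightarrow> P (pv w v)"
  shows "P f"
proof -
  have "f \<in> Sp A \<and> P f"
    using assms(1) unfolding Sp_def
  proof (induction rule: pm.span_induct_alt)
    case base
    show ?case using assms(2)[OF K_closed(1)] by (simp add: pm.span_zero)
  next
    case (step c x y)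
    from step(1) have x: "x \<in> Sp A \<and> P x"
    proof
      assume "x \<in> K"
      then show ?thesis using assms(2) K_Sp by simp
    next
      assume "x \<in> {f. \<exists>w\<in>A. \<exists>v\<in>carrier V. f = pv w v}"
      then obtain w v where "w \<in> A" "v \<in> carrier V" "x = pv w v" by blast
      then show ?thesis using assms(5) pv_Sp by simp
    qed
    from step(2) have y: "y \<in> Sp A" "P y" unfolding Sp_def[symmetric] by auto
    have "c *\<^sub>c x + y \<in> Sp A" using x y Sp_closed(2,3) by simp
    moreover have "P (c *\<^sub>c x + y)"
      using x y by (intro assms(3) assms(4) Sp_closed(3)) auto
    ultimately show ?case unfolding Sp_def[symmetric] by simp
  qed
  then show ?thesis by simp
qed

lemma Sp_mono: "f \<in> Sp A \<Longrightarrow> A \<subseteq> A' \<Longrightarrow> f \<in> Sp A'"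
proof (induction rule: Sp_induct)
  case (word w v)
  then show ?case by (intro pv_Sp) auto
qed (auto simp: K_Sp Sp_closed)

lemma Sp_PV: "f \<in> Sp A \<Longrightarrow> f \<in> PV"
  by (induction rule: Sp_induct) (auto simp: K_PV)

lemma Sp_eqv: "f \<doteq> g \<Longrightarrow> g \<in> Sp A \<Longrightarrow> f \<in> Sp A"
  using eqv_mem[of f g "Sp A"] by simp

lemma lmul_Sp: "f \<in> Sp A \<Longrightarrow> (\<And>w. w \<in> A \<Longrightarrow> b # w \<in> A') \<Longrightarrow> lmul b f \<in> Sp A'"
proof (induction rule: Sp_induct)
  case (word w v)
  then show ?case using pv_Sp[of "b # w" A' v] by simp
qed (simp_all add: lmul_simps K_Sp lmul_K Sp_closed)

lemma lmul_Sp_into: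
  assumes "f \<in> Sp A" "pm.subspace S" "K \<subseteq> S"
    and "\<And>w v. w \<in> A \<Longrightarrow> v \<in> carrier V \<Longrightarrow> lmul b (pv w v) \<in> S"
  shows "lmul b f \<in> S"
  using assms(1)
proof (induction rule: Sp_induct)
  case (ker f)
  then show ?case using lmul_K assms(3) by blast
qed (use assms in \<open>auto simp: lmul_simps intro: pm.subspace_add pm.subspace_scale simp del: lmul_single\<close>)

text \<open>An element involves finitely many words, so it already lies in one stage of an
  increasing exhaustion; elements of \<open>K\<close> lie in every stage.\<close>

lemma Sp_chain:
  assumes "f \<in> Sp A" "\<And>w. w \<in> A \<Longrightarrow> \<exists>J :: nat. w \<in> A' J" "\<And>i j. i \<le> j \<Longrightarrow> A' i \<subseteq> A' j"
  shows "\<exists>J. f \<in> Sp (A' J)"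
  using assms(1)
proof (induction rule: Sp_induct)
  case (add f g)
  then obtain i j where "f \<in> Sp (A' i)" "g \<in> Sp (A' j)" by blast
  then have "f \<in> Sp (A' (max i j))" "g \<in> Sp (A' (max i j))"
    using Sp_mono assms(3)[of i "max i j"] assms(3)[of j "max i j"] by auto
  then show ?case using Sp_closed by blast
next
  case (word w v)
  then obtain J where "w \<in> A' J" using assms(2) by blast
  then have "pv w v \<in> Sp (A' J)" using word by (intro pv_Sp)
  then show ?case by blast
next
  case (scale c f)
  then show ?case using Sp_closed(3) by blast
qed (use K_Sp in blast)

end

section \<open>Commutation relations in the induced module of the theorem\<close>

lemma sub_basis_simps [simp]:
  "L_gen i \<in> sub_basis q \<longleftrightarrow> i \<ge> 0" "M_gen i \<in> sub_basis q \<longleftrightarrow> i \<ge> - int q"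
  "Q_gen i \<in> sub_basis q \<longleftrightarrow> i \<ge> 1" "c1_gen \<in> sub_basis q" "c2_gen \<in> sub_basis q"
  by (auto simp: sub_basis_def)

text \<open>The vanishing \<open>Q_kill\<close> is part (i) of the theorem; it is derived from the
  simplicity of \<open>V\<close> in \<open>Q_annihilates\<close>.\<close>

locale bms_setup = ind_mod "sub_basis q" V for q :: nat and V :: "'v bms_module" +
  fixes t :: nat and c1 c2 :: complex
  assumes charge: "has_central_charge c1 c2 V"
    and M_kill: "i > int t \<Longrightarrow> v \<in> carrier V \<Longrightarrow> act V (gen (M_gen i)) v = \<zero>\<^bsub>V\<^esub>"
    and L_kill: "j > int t + int q \<Longrightarrow> v \<in> carrier V \<Longrightarrow> act V (gen (L_gen j)) v = \<zero>\<^bsub>V\<^esub>"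
    and Q_kill: "i > int t \<Longrightarrow> v \<in> carrier V \<Longrightarrow> act V (gen (Q_gen i)) v = \<zero>\<^bsub>V\<^esub>"
begin

notation eqv (infix "\<doteq>" 50)

text \<open>Hypothesis (a) says that the relevant values of \<open>\<kappa>\<close> are good: these are $0$ if $t>0$, and
  $\frac1{24}(n^2-1)c_2$ for $n\neq0$ if $t=0$.\<close>

definition good :: "complex \<Rightarrow> bool" where
  "good \<kappa> \<longleftrightarrow> (\<forall>v\<in>carrier V. act V (gen (M_gen (int t))) v \<oplus>\<^bsub>V\<^esub> \<kappa> \<odot>\<^bsub>V\<^esub> v = \<zero>\<^bsub>V\<^esub> \<longrightarrow> v = \<zero>\<^bsub>V\<^esub>)"

definition Pk :: "complex \<Rightarrow> 'v word_space \<Rightarrow> 'v word_space"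
  where "Pk \<kappa> f = lmul (M_gen (int t)) f + \<kappa> *\<^sub>c f"

lemma eqv_sum: "(\<And>a. a \<in> A \<Longrightarrow> f a \<doteq> g a) \<Longrightarrow> sum f A \<doteq> sum g A"
  by (induction A rule: infinite_finite_induct) (auto intro: eqv_add)

text \<open>A central even letter passes all letters of a word and acts by its scalar on the vector
  at the end.\<close>

lemma central_eqv:
  assumes z: "\<And>b. basis_bracket z b = 0" "parity z = 0" "z \<in> sub_basis q"
    and c: "\<And>v. v \<in> carrier V \<Longrightarrow> act V (gen z) v = c \<odot>\<^bsub>V\<^esub> v" and f: "f \<in> PV"
  shows "lmul z f \<doteq> c *\<^sub>c f"
  using f
proof (induction rule: PV_induct)
  case (single d w v)
  have "lmul z (pv w v) \<doteq> c *\<^sub>c pv w v"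
  proof (induction w)
    case Nil
    have "lmul z (pv [] v) \<doteq> pv [] (c \<odot>\<^bsub>V\<^esub> v)"
      using pv_act[OF z(3) single] c single by simp
    also have "\<dots> \<doteq> c *\<^sub>c pv [] v" using single by (rule pv_smult)
    finally show ?case .
  next
    case (Cons b w)
    have "lmul z (lmul b (pv w v)) \<doteq> lmul b (lmul z (pv w v))"
      using lmul_comm[of "pv w v" z b] z single by simp
    also have "\<dots> \<doteq> lmul b (c *\<^sub>c pv w v)" by (intro eqv_lmul Cons)
    finally show ?case by (simp add: lmul_simps)
  qed
  from eqv_scale[OF this, of d] show ?case
    by (simp add: lmul_simps mult.commute)
next
  case (add x y)
  from eqv_add[OF add(3,4)] show ?case by (simp add: lmul_simps pm_scale_add_right)
qed (simp add: lmul_simps)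

lemma c1_eqv: "f \<in> PV \<Longrightarrow> lmul c1_gen f \<doteq> c1 *\<^sub>c f"
  by (rule central_eqv) (use charge in \<open>auto simp: has_central_charge_def\<close>)

lemma c2_eqv: "f \<in> PV \<Longrightarrow> lmul c2_gen f \<doteq> c2 *\<^sub>c f"
  by (rule central_eqv) (use charge in \<open>auto simp: has_central_charge_def\<close>)

lemma comm_MM: "f \<in> PV \<Longrightarrow> lmul (M_gen i) (lmul (M_gen j) f) \<doteq> lmul (M_gen j) (lmul (M_gen i) f)"
  and comm_MQ: "f \<in> PV \<Longrightarrow> lmul (M_gen i) (lmul (Q_gen j) f) \<doteq> lmul (Q_gen j) (lmul (M_gen i) f)"
  and comm_QM: "f \<in> PV \<Longrightarrow> lmul (Q_gen i) (lmul (M_gen j) f) \<doteq> lmul (M_gen j) (lmul (Q_gen i) f)"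
  and comm_LQ: "f \<in> PV \<Longrightarrow> lmul (L_gen i) (lmul (Q_gen j) f) \<doteq> lmul (Q_gen j) (lmul (L_gen i) f)
      + (of_int i / 2 - (of_int j - 1 / 2)) *\<^sub>c lmul (Q_gen (i + j)) f"
  and comm_QL: "f \<in> PV \<Longrightarrow> lmul (Q_gen j) (lmul (L_gen i) f) \<doteq> lmul (L_gen i) (lmul (Q_gen j) f)
      + ((of_int j - 1 / 2) - of_int i / 2) *\<^sub>c lmul (Q_gen (i + j)) f"
  using lmul_comm[of f "M_gen i" "M_gen j"] lmul_comm[of f "M_gen i" "Q_gen j"]
    lmul_comm[of f "Q_gen i" "M_gen j"] lmul_comm[of f "L_gen i" "Q_gen j"] lmul_comm[of f "Q_gen j" "L_gen i"]
  by simp_all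

lemma eqv_central_part:
  assumes "f \<in> PV" "g \<doteq> h + (k + d *\<^sub>c lmul c2_gen f)"
  shows "g \<doteq> h + (k + (d * c2) *\<^sub>c f)"
proof -
  have "d *\<^sub>c lmul c2_gen f \<doteq> (d * c2) *\<^sub>c f"
    using eqv_scale[OF c2_eqv[OF assms(1)], of d] by simp
  then have "h + (k + d *\<^sub>c lmul c2_gen f) \<doteq> h + (k + (d * c2) *\<^sub>c f)"
    by (intro eqv_add eqv_refl)
  with assms(2) show ?thesis by (rule eqv_trans)
qed

lemma comm_LM: "f \<in> PV \<Longrightarrow> lmul (L_gen m) (lmul (M_gen n) f) \<doteq> lmul (M_gen n) (lmul (L_gen m) f)
    + (of_int (m - n) *\<^sub>c lmul (M_gen (m + n)) f
       + ((if m + n = 0 then of_int (m ^ 3 - m) / 12 else 0) * c2) *\<^sub>c f)"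
  and comm_ML: "f \<in> PV \<Longrightarrow> lmul (M_gen m) (lmul (L_gen n) f) \<doteq> lmul (L_gen n) (lmul (M_gen m) f)
    + (of_int (m - n) *\<^sub>c lmul (M_gen (m + n)) f
       + ((if m + n = 0 then of_int (m ^ 3 - m) / 12 else 0) * c2) *\<^sub>c f)"
  and comm_QQ: "f \<in> PV \<Longrightarrow> lmul (Q_gen m) (lmul (Q_gen n) f) \<doteq> - lmul (Q_gen n) (lmul (Q_gen m) f)
    + (2 *\<^sub>c lmul (M_gen (m + n - 1)) f
       + ((if m + n - 1 = 0 then ((of_int m - 1 / 2) ^ 2 - 1 / 4) / 3 else 0) * c2) *\<^sub>c f)"
  using lmul_comm[of f "L_gen m" "M_gen n"] lmul_comm[of f "M_gen m" "L_gen n"] lmul_comm[of f "Q_gen m" "Q_gen n"]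
  by (intro eqv_central_part; simp add: lin_add pm.scale_minus_left)+

lemma comm_LL: 
  assumes f: "f \<in> PV"
  shows "lmul (L_gen m) (lmul (L_gen n) f) \<doteq> lmul (L_gen n) (lmul (L_gen m) f)
    + (of_int (m - n) *\<^sub>c lmul (L_gen (m + n)) f
       + ((if m + n = 0 then of_int (m ^ 3 - m) / 12 else 0) * c1) *\<^sub>c f)"
proof -
  let ?d = "if m + n = 0 then of_int (m ^ 3 - m) / 12 else (0 :: complex)"
  have "lmul (L_gen m) (lmul (L_gen n) f) \<doteq> lmul (L_gen n) (lmul (L_gen m) f)
    + (of_int (m - n) *\<^sub>c lmul (L_gen (m + n)) f + ?d *\<^sub>c lmul c1_gen f)"
    using lmul_comm[OF f, of "L_gen m" "L_gen n"] by (simp add: lin_add)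
  also have "\<dots> \<doteq> lmul (L_gen n) (lmul (L_gen m) f)
    + (of_int (m - n) *\<^sub>c lmul (L_gen (m + n)) f + ?d *\<^sub>c (c1 *\<^sub>c f))"
    by (intro eqv_add eqv_scale eqv_refl c1_eqv f)
  finally show ?thesis by simp
qed

lemma Pk_simps:
  "Pk \<kappa> (f + g) = Pk \<kappa> f + Pk \<kappa> g" "Pk \<kappa> (c *\<^sub>c f) = c *\<^sub>c Pk \<kappa> f" "Pk \<kappa> 0 = 0"
  "Pk \<kappa> (f - g) = Pk \<kappa> f - Pk \<kappa> g"
  by (simp_all add: Pk_def lmul_simps pm_scale_add_right pm_scale_diff algebra_simps)

lemma Pk_eqv: "f \<doteq> g \<Longrightarrow> Pk \<kappa> f \<doteq> Pk \<kappa> g"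
  unfolding Pk_def by (intro eqv_add eqv_lmul eqv_scale)

lemma Pk_K: "f \<in> K \<Longrightarrow> Pk \<kappa> f \<in> K"
  using Pk_eqv[of f 0] by (simp add: eqv_zero Pk_simps)

text \<open>The noncentral letters that commute with every $M_i$.\<close>

definition MQ_set :: "bms_basis set" where "MQ_set = range M_gen \<union> range Q_gen"

lemma MQ_set_cases: "b \<in> MQ_set \<Longrightarrow> (\<And>j. b = M_gen j \<Longrightarrow> thesis) \<Longrightarrow> (\<And>j. b = Q_gen j \<Longrightarrow> thesis) \<Longrightarrow> thesis"
  by (auto simp: MQ_set_def)

lemma MQ_set_simps [simp]: "M_gen j \<in> MQ_set" "Q_gen j \<in> MQ_set"
  by (auto simp: MQ_set_def)

lemma M_MQ: "f \<in> PV \<Longrightarrow> b \<in> MQ_set \<Longrightarrow> lmul (M_gen i) (lmul b f) \<doteq> lmul b (lmul (M_gen i) f)"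
  using comm_MM comm_MQ by (auto elim!: MQ_set_cases)

lemma M_MQ_word: "f \<in> PV \<Longrightarrow> set w \<subseteq> MQ_set \<Longrightarrow> lmul (M_gen i) (lmulw w f) \<doteq> lmulw w (lmul (M_gen i) f)"
proof (induction w)
  case (Cons b w)
  then have "lmul (M_gen i) (lmul b (lmulw w f)) \<doteq> lmul b (lmul (M_gen i) (lmulw w f))"
    by (intro M_MQ) auto
  also have "\<dots> \<doteq> lmul b (lmulw w (lmul (M_gen i) f))"
    using Cons by (intro eqv_lmul) auto
  finally show ?case by simp
qed simp

lemma Pk_MQ: "f \<in> PV \<Longrightarrow> b \<in> MQ_set \<Longrightarrow> Pk \<kappa> (lmul b f) \<doteq> lmul b (Pk \<kappa> f)"
  unfolding Pk_def by (simp add: lmul_simps) (intro eqv_add M_MQ eqv_refl)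

lemma Pk_MQ_word: "f \<in> PV \<Longrightarrow> set w \<subseteq> MQ_set \<Longrightarrow> Pk \<kappa> (lmulw w f) \<doteq> lmulw w (Pk \<kappa> f)"
  unfolding Pk_def by (simp add: lmulw_lin) (intro eqv_add M_MQ_word eqv_refl)

text \<open>Commuting with all letters $M$ and $Q$, $M_s$ reaches the vector, on which it vanishes
  for \<open>s > int t\<close>.\<close>

lemma M_kills: 
  assumes "s > int t" "f \<in> Sp (lists MQ_set)"
  shows "lmul (M_gen s) f \<in> K"
proof (rule lmul_Sp_into[OF assms(2)])
  fix w v assume w: "w \<in> lists MQ_set" and v: "v \<in> carrier V"
  have "lmul (M_gen s) (lmulw w (pv [] v)) \<doteq> lmulw w (lmul (M_gen s) (pv [] v))"
    using w v by (intro M_MQ_word) auto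
  also have "\<dots> \<doteq> lmulw w (pv [] (act V (gen (M_gen s)) v))"
    using v assms(1) by (intro eqv_lmulw pv_act) auto
  also have "\<dots> \<doteq> 0"
    using lmulw_K[OF pv_zero[of "[]"], of w] M_kill[OF assms(1) v] by (simp add: eqv_zero)
  finally show "lmul (M_gen s) (pv w v) \<in> K" by (simp add: eqv_zero)
qed auto

text \<open>All good \<open>\<kappa>\<close> are treated at once: the scalar varies with the
  commutator used in a lowering step, so an induction hypothesis for a single
  \<open>\<kappa>\<close> would be too weak.\<close>

definition injP where
  "injP S \<longleftrightarrow> (\<forall>\<kappa> f. good \<kappa> \<longrightarrow> f \<in> S \<longrightarrow> Pk \<kappa> f \<in> K \<longrightarrow> f \<in> K)"

lemma injPD: "injP S \<Longrightarrow> good \<kappa> \<Longrightarrow> f \<in> S \<Longrightarrow> f \<notin> K \<Longrightarrow> \<alpha> \<noteq> 0 \<Longrightarrow> \<alpha> *\<^sub>c Pk \<kappa> f \<notin> K"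
  using K_closed(3)[of "\<alpha> *\<^sub>c Pk \<kappa> f" "inverse \<alpha>"] by (auto simp: injP_def)

section \<open>Lowering in the generators $M_j$\<close>

text \<open>The letters of \<open>M_set 0\<close> lie in the subalgebra, so \<open>Y 0\<close> is
  \<open>1 \<otimes> V\<close>; passing from \<open>J\<close> to \<open>Suc J\<close> admits the
  single new letter $M_{-q-J-1}$.\<close>

definition M_set :: "nat \<Rightarrow> bms_basis set" where "M_set J = M_gen ` {- int q - int J..}"

definition Y where "Y J = Sp (lists (M_set J))"

lemma M_set_simps [simp]: "M_gen j \<in> M_set J \<longleftrightarrow> j \<ge> - int q - int J"
  by (auto simp: M_set_def)

lemma M_set_cases: "b \<in> M_set J \<Longrightarrow> (\<And>j. b = M_gen j \<Longrightarrow> j \<ge> - int q - int J \<Longrightarrow> thesis) \<Longrightarrow> thesis"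
  by (auto simp: M_set_def)

lemma M_set_MQ: "M_set J \<subseteq> MQ_set"
  by (auto simp: M_set_def)

lemma M_set_mono: "I \<le> J \<Longrightarrow> M_set I \<subseteq> M_set J"
  by (auto simp: M_set_def)

lemma Y_MQ: "f \<in> Y J \<Longrightarrow> f \<in> Sp (lists MQ_set)"
  unfolding Y_def by (rule Sp_mono[OF _ lists_mono[OF M_set_MQ]])

lemma Y_PV: "f \<in> Y J \<Longrightarrow> f \<in> PV"
  unfolding Y_def by (rule Sp_PV)

lemma lmul_Y: "f \<in> Y J \<Longrightarrow> b \<in> M_set J \<Longrightarrow> lmul b f \<in> Y J"
  unfolding Y_def by (rule lmul_Sp) auto

lemma Pk_Y: "f \<in> Y J \<Longrightarrow> Pk \<kappa> f \<in> Y J"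
  unfolding Pk_def by (intro pm.subspace_add pm.subspace_scale lmul_Y) (auto simp: Y_def)

lemma Y_0:
  assumes "f \<in> Y 0"
  shows "\<exists>v\<in>carrier V. f \<doteq> pv [] v"
  using assms unfolding Y_def
proof (induction rule: Sp_induct)
  case (ker f)
  then show ?case using pv_zero[of "[]"] by (intro bexI[of _ "\<zero>\<^bsub>V\<^esub>"]) (auto simp: eqv_def K_closed)
next
  case (add f g)
  then obtain u v where uv: "u \<in> carrier V" "v \<in> carrier V" "f \<doteq> pv [] u" "g \<doteq> pv [] v" by blast
  have "f + g \<doteq> pv [] u + pv [] v" using uv by (intro eqv_add)
  also have "\<dots> \<doteq> pv [] (u \<oplus>\<^bsub>V\<^esub> v)" using uv by (intro eqv_sym[OF pv_add])
  finally show ?case using uv by blast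
next
  case (scale c f)
  then obtain u where u: "u \<in> carrier V" "f \<doteq> pv [] u" by blast
  have "c *\<^sub>c f \<doteq> c *\<^sub>c pv [] u" using u by (intro eqv_scale)
  also have "\<dots> \<doteq> pv [] (c \<odot>\<^bsub>V\<^esub> u)" using u by (intro eqv_sym[OF pv_smult])
  finally show ?case using u smult_in by blast
next
  case (word w v)
  then have "set w \<subseteq> sub_basis q" by (auto simp: M_set_def)
  then show ?case using pv_wact[of w v] word by (auto intro!: bexI[of _ "wact w v"])
qed

lemma Pk_pv: "v \<in> carrier V \<Longrightarrow> Pk \<kappa> (pv [] v) \<doteq> pv [] (act V (gen (M_gen (int t))) v \<oplus>\<^bsub>V\<^esub> \<kappa> \<odot>\<^bsub>V\<^esub> v)"
proof -
  assume v: "v \<in> carrier V"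
  have "Pk \<kappa> (pv [] v) \<doteq> pv [] (act V (gen (M_gen (int t))) v) + pv [] (\<kappa> \<odot>\<^bsub>V\<^esub> v)"
    unfolding Pk_def using v by (intro eqv_add pv_act eqv_sym[OF pv_smult]) auto
  also have "\<dots> \<doteq> pv [] (act V (gen (M_gen (int t))) v \<oplus>\<^bsub>V\<^esub> \<kappa> \<odot>\<^bsub>V\<^esub> v)"
    using v by (intro eqv_sym[OF pv_add]) auto
  finally show ?thesis .
qed

lemma injP_Y_0: "injP (Y 0)"
  unfolding injP_def
proof (intro allI impI)
  fix \<kappa> f assume good: "good \<kappa>" and f: "f \<in> Y 0" and Pf: "Pk \<kappa> f \<in> K"
  from Y_0[OF f] obtain v where v: "v \<in> carrier V" "f \<doteq> pv [] v" by blast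
  have "Pk \<kappa> f \<doteq> pv [] (act V (gen (M_gen (int t))) v \<oplus>\<^bsub>V\<^esub> \<kappa> \<odot>\<^bsub>V\<^esub> v)"
    using Pk_eqv[OF v(2)] Pk_pv[OF v(1)] by (rule eqv_trans)
  then have "pv [] (act V (gen (M_gen (int t))) v \<oplus>\<^bsub>V\<^esub> \<kappa> \<odot>\<^bsub>V\<^esub> v) \<in> K"
    using Pf eqv_K by blast
  then have "act V (gen (M_gen (int t))) v \<oplus>\<^bsub>V\<^esub> \<kappa> \<odot>\<^bsub>V\<^esub> v = \<zero>\<^bsub>V\<^esub>"
    using v by (intro pv_in_K_D) auto
  then have "v = \<zero>\<^bsub>V\<^esub>" using good v unfolding good_def by blast
  then show "f \<in> K" using v pv_zero eqv_K by blast
qed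

end

section \<open>Values of the lowering commutators, and the descent in the $M_j$\<close>

locale bms_lowering = bms_setup +
  assumes good_pos: "t > 0 \<Longrightarrow> good 0"
    and good_zero: "t = 0 \<Longrightarrow> n \<noteq> 0 \<Longrightarrow> good (1 / 24 * (of_int n ^ 2 - 1) * c2)"
begin

notation eqv (infix "\<doteq>" 50)

text \<open>The expression is $[M_{t+n},L_{-n}]$, equally $[L_{t+n},M_{-n}]$. For $t=0$ it equals
  $2nM_0+(n^3-n)c_2/12 = 2n(M_0+(n^2-1)c_2/24)$, which is where hypothesis (a) comes from; for $t>0$
  the central term is absent and \<open>\<alpha>\<close> is $t+2n$.\<close>

lemma LM_value:
  assumes n: "n \<ge> 1"
  obtains \<kappa> \<alpha> where "good \<kappa>" "\<alpha> \<noteq> 0"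
    "\<And>f. of_int (int t + 2 * n) *\<^sub>c lmul (M_gen (int t)) f
       + ((if t = 0 then of_int (n ^ 3 - n) / 12 else 0) * c2) *\<^sub>c f = \<alpha> *\<^sub>c Pk \<kappa> f"
proof (cases "t = 0")
  case True
  have "2 * of_int n * (1 / 24 * (of_int n ^ 2 - 1) * c2) = of_int (n ^ 3 - n) / 12 * c2"
    by (simp add: power3_eq_cube power2_eq_square algebra_simps)
  moreover have "of_int (int t + 2 * n) = (2 * of_int n :: complex)" using True by simp
  ultimately have e: "of_int (int t + 2 * n) *\<^sub>c lmul (M_gen (int t)) f
       + ((if t = 0 then of_int (n ^ 3 - n) / 12 else 0) * c2) *\<^sub>c f
     = (2 * of_int n) *\<^sub>c Pk (1 / 24 * (of_int n ^ 2 - 1) * c2) f" for f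
    unfolding Pk_def pm_scale_add_right pm_scale_scale if_P[OF True] by (simp only:)
  have "good (1 / 24 * (of_int n ^ 2 - 1) * c2)" "2 * of_int n \<noteq> (0 :: complex)"
    using good_zero[OF True, of n] n by auto
  from this e show thesis by (rule that)
next
  case False
  have "of_int (int t + 2 * n) \<noteq> (0 :: complex)" using n by (subst of_int_eq_0_iff) linarith
  then show thesis
    using that[OF good_pos, of "of_int (int t + 2 * n)"] False by (simp add: Pk_def)
qed

lemma LM_lower:
  assumes n: "n \<ge> 1"
  obtains \<kappa> \<alpha> where "good \<kappa>" "\<alpha> \<noteq> 0"
    "\<And>f. f \<in> PV \<Longrightarrow> lmul (L_gen (int t + n)) (lmul (M_gen (- n)) f)
       \<doteq> lmul (M_gen (- n)) (lmul (L_gen (int t + n)) f) + \<alpha> *\<^sub>c Pk \<kappa> f"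
    "\<And>f. f \<in> PV \<Longrightarrow> lmul (M_gen (int t + n)) (lmul (L_gen (- n)) f)
       \<doteq> lmul (L_gen (- n)) (lmul (M_gen (int t + n)) f) + \<alpha> *\<^sub>c Pk \<kappa> f"
proof -
  obtain \<kappa> \<alpha> where *: "good \<kappa>" "\<alpha> \<noteq> 0"
    "\<And>f. of_int (int t + 2 * n) *\<^sub>c lmul (M_gen (int t)) f
       + ((if t = 0 then of_int (n ^ 3 - n) / 12 else 0) * c2) *\<^sub>c f = \<alpha> *\<^sub>c Pk \<kappa> f"
    by (rule LM_value[OF n]) (rule that)
  have e: "int t + n - - n = int t + 2 * n" "int t + n + - n = int t"
    "(if int t = 0 then of_int ((int t + n) ^ 3 - (int t + n)) / 12 else (0 :: complex))
      = (if t = 0 then of_int (n ^ 3 - n) / 12 else 0)" by simp_all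
  show thesis
  proof (rule that[OF *(1,2)])
    fix f :: "'a word_space" assume f: "f \<in> PV"
    show "lmul (L_gen (int t + n)) (lmul (M_gen (- n)) f)
       \<doteq> lmul (M_gen (- n)) (lmul (L_gen (int t + n)) f) + \<alpha> *\<^sub>c Pk \<kappa> f"
      using comm_LM[OF f, of "int t + n" "-n"] unfolding e *(3) .
    show "lmul (M_gen (int t + n)) (lmul (L_gen (- n)) f)
       \<doteq> lmul (L_gen (- n)) (lmul (M_gen (int t + n)) f) + \<alpha> *\<^sub>c Pk \<kappa> f"
      using comm_ML[OF f, of "int t + n" "-n"] unfolding e *(3) .
  qed
qed

text \<open>Since \<open>Q_gen k\<close> stands for $Q_{k-1/2}$, the indices are $t+n-1/2$ and
  $1/2-n$, with sum $t$. For $t=0$ the central term is twice the shift of hypothesis (a) at the odd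
  integer \<open>2 * n - 1\<close>, which is nonzero for every \<open>n\<close>.\<close>

lemma QQ_lower:
  obtains \<kappa> \<alpha> where "good \<kappa>" "\<alpha> \<noteq> 0"
    "\<And>f. f \<in> PV \<Longrightarrow> lmul (Q_gen (int t + n)) (lmul (Q_gen (1 - n)) f)
       \<doteq> - lmul (Q_gen (1 - n)) (lmul (Q_gen (int t + n)) f) + \<alpha> *\<^sub>c Pk \<kappa> f"
proof -
  have e: "int t + n + (1 - n) - 1 = int t" by simp
  note c = comm_QQ[of _ "int t + n" "1 - n", unfolded e]
  show thesis
  proof (cases "t = 0")
    case True
    have "2 * (1 / 24 * (of_int (2 * n - 1) ^ 2 - 1) * c2)
        = (if int t = 0 then ((of_int (int t + n) - 1 / 2) ^ 2 - 1 / 4) / 3 else 0) * c2"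
      using True by (simp add: power2_eq_square algebra_simps add_divide_distrib diff_divide_distrib)
    then have "2 *\<^sub>c Pk (1 / 24 * (of_int (2 * n - 1) ^ 2 - 1) * c2) f = 2 *\<^sub>c lmul (M_gen (int t)) f
       + ((if int t = 0 then ((of_int (int t + n) - 1 / 2) ^ 2 - 1 / 4) / 3 else 0) * c2) *\<^sub>c f" for f
      unfolding Pk_def pm_scale_add_right pm_scale_scale by (simp only:)
    note c' = c[folded this]
    have "2 * n - 1 \<noteq> 0" by presburger
    from that[OF good_zero[OF True this] _ c'] show thesis by simp
  next
    case False
    then show thesis
      using that[OF good_pos, of 2] c by (simp add: Pk_def)
  qed
qed

text \<open>Commuting $L_s$ past $M_j$ with $j \<ge> -q-J$ produces $M_{s+j}$ with $s+j>t$, which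
  kills by \<open>M_kills\<close>; as $s+j$ is positive there is no central term.\<close>

lemma Y_kill:
  assumes s: "s > int t + int q + int J" and f: "f \<in> Y J"
  shows "lmul (L_gen s) f \<in> K"
  using f unfolding Y_def
proof (rule lmul_Sp_into)
  fix w v assume w: "w \<in> lists (M_set J)" and v: "v \<in> carrier V"
  from w show "lmul (L_gen s) (pv w v) \<in> K"
  proof (induction w)
    case Nil
    have "lmul (L_gen s) (pv [] v) \<doteq> pv [] \<zero>\<^bsub>V\<^esub>"
      using pv_act[of "L_gen s" v] L_kill[of s v] s v by simp
    then show ?case using pv_zero eqv_K by blast
  next
    case (Cons b w)
    then obtain j where j: "b = M_gen j" "j \<ge> - int q - int J" by (auto elim: M_set_cases)
    let ?g = "pv w v"
    have g: "?g \<in> Y J" unfolding Y_def using Cons v by (intro pv_Sp)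
    have IH: "lmul (L_gen s) ?g \<in> K" using Cons by auto
    have "lmul (L_gen s) (lmul (M_gen j) ?g) \<doteq> lmul (M_gen j) (lmul (L_gen s) ?g)
      + of_int (s - j) *\<^sub>c lmul (M_gen (s + j)) ?g"
      using comm_LM[of ?g s j] s j v by simp
    moreover have "lmul (M_gen (s + j)) ?g \<in> K"
      using s j by (intro M_kills Y_MQ[OF g]) linarith
    ultimately have "lmul (L_gen s) (lmul (M_gen j) ?g) \<in> K"
      using lmul_K[OF IH] K_closed(2,3) eqv_K by blast
    then show ?case using j by simp
  qed
qed auto

text \<open>At the boundary index $s=t+q+J$ the commutator with $M_{-q-J}$ contains $M_t$, so $L_s$
  may fail to kill \<open>Y J\<close>, but it preserves it. This is used with \<open>Suc J\<close>
  in place of \<open>J\<close> in \<open>injP_Y\<close>.\<close>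

lemma Y_closed:
  assumes s: "s \<ge> int t + int q + int J" "s > int t + int q" and f: "f \<in> Y J"
  shows "lmul (L_gen s) f \<in> Y J"
  using f unfolding Y_def
proof (rule lmul_Sp_into)
  fix w v assume w: "w \<in> lists (M_set J)" and v: "v \<in> carrier V"
  from w show "lmul (L_gen s) (pv w v) \<in> Sp (lists (M_set J))"
  proof (induction w)
    case Nil
    have "lmul (L_gen s) (pv [] v) \<doteq> pv [] \<zero>\<^bsub>V\<^esub>"
      using pv_act[of "L_gen s" v] L_kill[of s v] s v by simp
    then show ?case using pv_zero eqv_K K_Sp by blast
  next
    case (Cons b w)
    then obtain j where j: "b = M_gen j" "j \<ge> - int q - int J" by (auto elim: M_set_cases)
    let ?g = "pv w v"
    have g: "?g \<in> Y J" unfolding Y_def using Cons v by (intro pv_Sp)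
    have IH: "lmul (L_gen s) ?g \<in> Y J" using Cons by (auto simp: Y_def)
    have "lmul (L_gen s) (lmul (M_gen j) ?g) \<doteq> lmul (M_gen j) (lmul (L_gen s) ?g)
      + (of_int (s - j) *\<^sub>c lmul (M_gen (s + j)) ?g
        + ((if s + j = 0 then of_int (s ^ 3 - s) / 12 else 0) * c2) *\<^sub>c ?g)"
      using comm_LM[of ?g s j] v by simp
    moreover have "lmul (M_gen (s + j)) ?g \<in> Y J"
      using s j by (intro lmul_Y g) auto
    moreover have "lmul (M_gen j) (lmul (L_gen s) ?g) \<in> Y J"
      using j by (intro lmul_Y[OF IH]) simp
    ultimately have "lmul (L_gen s) (lmul (M_gen j) ?g) \<in> Y J"
      using g unfolding Y_def by (elim Sp_eqv) (intro Sp_closed(2,3))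
    then show ?case using j by (simp add: Y_def)
  qed
qed auto

text \<open>The $M$'s commute, so elements of \<open>Y (Suc J)\<close> are polynomials in the one
  new letter with coefficients in \<open>Y J\<close>. Coefficients beyond \<open>d\<close> are
  required to be zero so that expansions of different degrees can be added.\<close>

lemma Y_Suc_decomp:
  assumes "f \<in> Y (Suc J)"
  shows "\<exists>d y. (\<forall>n. y n \<in> Y J) \<and> (\<forall>n>d. y n = 0) \<and>
    f \<doteq> (\<Sum>n\<le>d. lmulw (replicate n (M_gen (- (int q + int (Suc J))))) (y n))"
    (is "?D f")
proof -
  define Xp :: "nat \<Rightarrow> 'a word_space \<Rightarrow> 'a word_space"
    where "Xp n = lmulw (replicate n (M_gen (- (int q + int (Suc J)))))" for n
  have Xp: "Xp n (g + h) = Xp n g + Xp n h" "Xp n (c *\<^sub>c g) = c *\<^sub>c Xp n g" "Xp n 0 = 0" for n g h c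
    by (simp_all add: Xp_def lmulw_lin)
  have ext: "(\<Sum>n\<le>d. Xp n (y n)) = (\<Sum>n\<le>d'. Xp n (y n))" if "\<forall>n>d. y n = 0" "d \<le> d'" for d d' y
    using that Xp(3) by (intro sum.mono_neutral_left) auto
  have D: "?D f \<longleftrightarrow> (\<exists>d y. (\<forall>n. y n \<in> Y J) \<and> (\<forall>n>d. y n = 0) \<and> f \<doteq> (\<Sum>n\<le>d. Xp n (y n)))" for f
    by (simp add: Xp_def)
  have Y0: "0 \<in> Y J" by (simp add: Y_def Sp_closed)
  have eq: "?D f" if "?D g" "f \<doteq> g" for f g
    using that eqv_trans unfolding D by blast
  from assms show ?thesis
    unfolding Y_def[of "Suc J"]
  proof (induction rule: Sp_induct)
    case (ker f)
    then show ?case unfolding D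
      by (intro exI[of _ 0] exI[of _ "\<lambda>_. 0"]) (simp add: Xp eqv_zero Y0)
  next
    case (add f g)
    then obtain d y d' y' where
      f: "\<forall>n. y n \<in> Y J" "\<forall>n>d. y n = 0" "f \<doteq> (\<Sum>n\<le>d. Xp n (y n))" and
      g: "\<forall>n. y' n \<in> Y J" "\<forall>n>d'. y' n = 0" "g \<doteq> (\<Sum>n\<le>d'. Xp n (y' n))"
      unfolding D by blast
    have "f + g \<doteq> (\<Sum>n\<le>max d d'. Xp n (y n)) + (\<Sum>n\<le>max d d'. Xp n (y' n))"
      using f(3) g(3) ext[OF f(2), of "max d d'"] ext[OF g(2), of "max d d'"] by (intro eqv_add) auto
    also have "\<dots> = (\<Sum>n\<le>max d d'. Xp n (y n + y' n))" by (simp add: Xp sum.distrib)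
    finally show ?case using f g unfolding D
      by (intro exI[of _ "max d d'"] exI[of _ "\<lambda>n. y n + y' n"]) (auto simp: Y_def Sp_closed)
  next
    case (scale c f)
    then obtain d y where f: "\<forall>n. y n \<in> Y J" "\<forall>n>d. y n = 0" "f \<doteq> (\<Sum>n\<le>d. Xp n (y n))"
      unfolding D by blast
    have "c *\<^sub>c f \<doteq> (\<Sum>n\<le>d. Xp n (c *\<^sub>c y n))"
      using eqv_scale[OF f(3), of c] by (simp add: Xp pm_scale_sum)
    with f show ?case unfolding D
      by (intro exI[of _ d] exI[of _ "\<lambda>n. c *\<^sub>c y n"]) (auto simp: Y_def Sp_closed)
  next
    case (word w v)
    from word(1) show ?case
    proof (induction w)
      case Nil
      have "pv [] v \<in> Y J" using word by (auto simp: Y_def intro: pv_Sp)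
      then show ?case unfolding D
        by (intro exI[of _ 0] exI[of _ "\<lambda>n. if n = 0 then pv [] v else 0"]) (auto simp: Xp_def Y0)
    next
      case (Cons b w)
      then obtain d y where f: "\<forall>n. y n \<in> Y J" "\<forall>n>d. y n = 0" "pv w v \<doteq> (\<Sum>n\<le>d. Xp n (y n))"
        unfolding D by blast
      have bf: "pv (b # w) v \<doteq> (\<Sum>n\<le>d. lmul b (Xp n (y n)))"
        using eqv_lmul[OF f(3), of b] by (simp add: lmul_simps)
      obtain j where j: "b = M_gen j" "j \<ge> - int q - int (Suc J)"
        using Cons by (auto elim: M_set_cases)
      show ?case
      proof (cases "j = - (int q + int (Suc J))")
        case True
        then have "(\<Sum>n\<le>d. lmul b (Xp n (y n))) = (\<Sum>n\<le>Suc d. Xp n (case n of 0 \<Rightarrow> 0 | Suc m \<Rightarrow> y m))"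
          using j by (subst sum.atMost_Suc_shift) (simp add: Xp, simp add: Xp_def)
        with bf f show ?thesis unfolding D
          by (intro exI[of _ "Suc d"] exI[of _ "\<lambda>n. case n of 0 \<Rightarrow> 0 | Suc m \<Rightarrow> y m"])
             (auto simp: Y0 split: nat.split)
      next
        case False
        then have b: "b \<in> M_set J" using j by auto
        have "(\<Sum>n\<le>d. lmul b (Xp n (y n))) \<doteq> (\<Sum>n\<le>d. Xp n (lmul b (y n)))"
          unfolding Xp_def j(1) using f(1) Y_PV by (intro eqv_sum M_MQ_word) auto
        with bf have "pv (b # w) v \<doteq> (\<Sum>n\<le>d. Xp n (lmul b (y n)))" by (rule eqv_trans)
        with f b show ?thesis unfolding D
          by (intro exI[of _ d] exI[of _ "\<lambda>n. lmul b (y n)"]) (auto simp: lmul_Y lmul_simps)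
      qed
    qed
  qed
qed

text \<open>Let $X=M_{-n}$ with $n=q+J+1$ be the new letter and $D=L_{t+n}$. Then $D$ kills
  \<open>Y J\<close> and $[D,X]=\<alpha>(M_t+\<kappa>)$ commutes with $X$, so $D$ acts like a
  derivative: $DX^{m+1}y=(m+1)\<alpha>X^m(M_t+\<kappa>)y$. The degree drops by one, and the leading
  coefficient stays outside \<open>K\<close> by injectivity on \<open>Y J\<close>.\<close>

lemma Y_descent:
  assumes inj: "injP (Y J)" and N: "pm.subspace N" "K \<subseteq> N"
    and closed: "\<And>f. f \<in> N \<Longrightarrow> lmul (L_gen (int t + (int q + int (Suc J)))) f \<in> N"
    and y: "\<And>n. y n \<in> Y J" "y d \<notin> K"
    and mem: "(\<Sum>n\<le>d. lmulw (replicate n (M_gen (- (int q + int (Suc J))))) (y n)) \<in> N"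
  shows "\<exists>f\<in>Y J. f \<in> N \<and> f \<notin> K"
  using y mem
proof (induction d arbitrary: y)
  case 0
  then show ?case by auto
next
  case (Suc d)
  define n0 where "n0 = int q + int (Suc J)"
  define Xp :: "nat \<Rightarrow> 'a word_space \<Rightarrow> 'a word_space"
    where "Xp n = lmulw (replicate n (M_gen (- n0)))" for n
  obtain \<kappa> \<alpha> where k: "good \<kappa>" "\<alpha> \<noteq> 0"
    "\<And>f. f \<in> PV \<Longrightarrow> lmul (L_gen (int t + n0)) (lmul (M_gen (- n0)) f)
       \<doteq> lmul (M_gen (- n0)) (lmul (L_gen (int t + n0)) f) + \<alpha> *\<^sub>c Pk \<kappa> f"
    by (rule LM_lower[of n0]) (simp add: n0_def, rule that)
  let ?D = "lmul (L_gen (int t + n0))"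
  have kill: "?D g \<in> K" if "g \<in> Y J" for g
    using that by (intro Y_kill) (auto simp: n0_def)
  have XPV: "Xp n g \<in> PV" if "g \<in> Y J" for n g
    unfolding Xp_def using that Y_PV by simp
  have DX: "?D (Xp (Suc n) g) \<doteq> (of_nat (Suc n) * \<alpha>) *\<^sub>c Xp n (Pk \<kappa> g)" if g: "g \<in> Y J" for n g
  proof (induction n)
    case 0
    have "?D (Xp 1 g) \<doteq> lmul (M_gen (- n0)) (?D g) + \<alpha> *\<^sub>c Pk \<kappa> g"
      using k(3)[OF Y_PV[OF g]] by (simp add: Xp_def)
    also have "\<dots> \<doteq> 0 + \<alpha> *\<^sub>c Pk \<kappa> g"
      using kill[OF g] by (intro eqv_add eqv_refl) (simp add: eqv_zero lmul_K)
    finally show ?case by (simp add: Xp_def)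
  next
    case (Suc n)
    have "?D (Xp (Suc (Suc n)) g) \<doteq> lmul (M_gen (- n0)) (?D (Xp (Suc n) g)) + \<alpha> *\<^sub>c Pk \<kappa> (Xp (Suc n) g)"
      using k(3)[OF XPV[OF g, of "Suc n"]] by (simp add: Xp_def)
    also have "\<dots> \<doteq> lmul (M_gen (- n0)) ((of_nat (Suc n) * \<alpha>) *\<^sub>c Xp n (Pk \<kappa> g)) + \<alpha> *\<^sub>c Xp (Suc n) (Pk \<kappa> g)"
      using g unfolding Xp_def
      by (intro eqv_add eqv_lmul eqv_scale Suc[unfolded Xp_def] Pk_MQ_word Y_PV) auto
    also have "\<dots> = (of_nat (Suc n) * \<alpha> + \<alpha>) *\<^sub>c Xp (Suc n) (Pk \<kappa> g)"
      unfolding pm_scale_add_left by (simp add: Xp_def lmul_simps)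
    also have "of_nat (Suc n) * \<alpha> + \<alpha> = of_nat (Suc (Suc n)) * \<alpha>"
      by (simp add: algebra_simps)
    finally show ?case .
  qed
  define y' where "y' n = (of_nat (Suc n) * \<alpha>) *\<^sub>c Pk \<kappa> (y (Suc n))" for n
  have "?D (\<Sum>n\<le>Suc d. Xp n (y n)) = ?D (y 0) + (\<Sum>n\<le>d. ?D (Xp (Suc n) (y (Suc n))))"
    by (subst sum.atMost_Suc_shift) (simp add: lmul_simps Xp_def)
  also have "\<dots> \<doteq> 0 + (\<Sum>n\<le>d. Xp n (y' n))"
  proof (intro eqv_add eqv_sum)
    show "?D (y 0) \<doteq> 0" using kill Suc by (simp add: eqv_zero)
    show "?D (Xp (Suc n) (y (Suc n))) \<doteq> Xp n (y' n)" for n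
      using DX[OF Suc.prems(1), of n "Suc n"] by (simp add: y'_def Xp_def lmulw_lin)
  qed
  finally have "?D (\<Sum>n\<le>Suc d. Xp n (y n)) \<doteq> (\<Sum>n\<le>d. Xp n (y' n))" by simp
  moreover have "?D (\<Sum>n\<le>Suc d. Xp n (y n)) \<in> N"
    using closed Suc.prems(3) by (simp add: Xp_def n0_def)
  ultimately have mem': "(\<Sum>n\<le>d. Xp n (y' n)) \<in> N"
    using eqv_mem N by blast
  have "y' n \<in> Y J" for n
    unfolding y'_def using Suc.prems(1) Pk_Y by (auto simp: Y_def Sp_closed)
  moreover have "y' d \<notin> K"
    unfolding y'_def using k Suc.prems by (intro injPD[OF inj]) (auto simp: of_nat_Suc[symmetric] simp del: of_nat_Suc)
  ultimately show ?case
    using mem' by (intro Suc.IH[of y']) (auto simp: Xp_def n0_def)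
qed

lemma Y_lower:
  assumes inj: "injP (Y J)" and N: "pm.subspace N" "K \<subseteq> N"
    and closed: "\<And>f. f \<in> N \<Longrightarrow> lmul (L_gen (int t + (int q + int (Suc J)))) f \<in> N"
    and f: "f \<in> Y (Suc J)" "f \<in> N" "f \<notin> K"
  shows "\<exists>f\<in>Y J. f \<in> N \<and> f \<notin> K"
proof -
  let ?Xp = "\<lambda>n. lmulw (replicate n (M_gen (- (int q + int (Suc J)))))"
  obtain d y where y: "\<And>n. y n \<in> Y J" "f \<doteq> (\<Sum>n\<le>d. ?Xp n (y n))"
    using Y_Suc_decomp[OF f(1)] by blast
  \<comment> \<open>Terms with \<open>y n \<in> K\<close> are discarded, and the last remaining one is the leading term.\<close>
  define S where "S = {n. n \<le> d \<and> y n \<notin> K}"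
  have "S \<noteq> {}"
  proof
    assume "S = {}"
    then have "(\<Sum>n\<le>d. ?Xp n (y n)) \<in> K"
      by (intro pm.subspace_sum lmulw_K K_subspace) (auto simp: S_def)
    then show False using f(3) y(2) eqv_K by blast
  qed
  moreover have fin: "finite S" by (simp add: S_def)
  ultimately have M: "Max S \<in> S" by simp
  have "f \<doteq> (\<Sum>n\<le>d. ?Xp n (if n \<le> Max S then y n else 0))"
  proof (rule eqv_trans[OF y(2)], rule eqv_sum)
    fix n assume "n \<in> {..d}"
    then have "n \<le> Max S \<or> y n \<in> K" using fin by (auto simp: S_def)
    then show "?Xp n (y n) \<doteq> ?Xp n (if n \<le> Max S then y n else 0)"
      by (auto simp: lmulw_lin eqv_zero lmulw_K)
  qed
  also have "\<dots> = (\<Sum>n\<le>Max S. ?Xp n (y n))"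
    using M by (intro sum.mono_neutral_cong_right) (auto simp: S_def lmulw_lin)
  finally have "(\<Sum>n\<le>Max S. ?Xp n (y n)) \<in> N"
    using f(2) N eqv_mem by blast
  then show ?thesis
    using Y_descent[OF inj N closed, of y "Max S"] y(1) M by (auto simp: S_def)
qed

text \<open>The kernel of $M_t+\<kappa>$ on \<open>Y (Suc J)\<close> is stable under $L_s$ with
  $s=t+q+J+1$, because $[L_s,M_t]$ is a multiple of $M_{s+t}$, which kills. So
  \<open>Y_lower\<close> would carry a nonzero kernel element down to \<open>Y J\<close>.\<close>

lemma injP_Y: "injP (Y J)"
proof (induction J)
  case 0
  show ?case by (rule injP_Y_0)
next
  case (Suc J)
  show ?case
    unfolding injP_def
  proof (intro allI impI, rule ccontr)
    fix \<kappa> f assume k: "good \<kappa>" and f: "f \<in> Y (Suc J)" "Pk \<kappa> f \<in> K" "f \<notin> K"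
    let ?N = "{f \<in> Y (Suc J). Pk \<kappa> f \<in> K}"
    have "\<exists>f\<in>Y J. f \<in> ?N \<and> f \<notin> K"
    proof (rule Y_lower[OF Suc])
      show "pm.subspace ?N"
        by (rule pm.subspaceI) (auto simp: Pk_simps K_closed Y_def Sp_closed)
      show "K \<subseteq> ?N" using Pk_K K_Sp by (auto simp: Y_def)
      let ?s = "int t + (int q + int (Suc J))"
      show "lmul (L_gen ?s) g \<in> ?N" if "g \<in> ?N" for g
      proof -
        have g: "g \<in> Y (Suc J)" "Pk \<kappa> g \<in> K" using that by auto
        have "lmul (L_gen ?s) (lmul (M_gen (int t)) g) \<doteq> lmul (M_gen (int t)) (lmul (L_gen ?s) g)
           + of_int (?s - int t) *\<^sub>c lmul (M_gen (?s + int t)) g"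
          using comm_LM[OF Y_PV[OF g(1)], of ?s "int t"] by simp
        also have "\<dots> \<doteq> lmul (M_gen (int t)) (lmul (L_gen ?s) g) + 0"
          using M_kills[OF _ Y_MQ[OF g(1)], of "?s + int t"]
          by (intro eqv_add eqv_refl) (simp add: eqv_zero K_closed)
        finally have "lmul (L_gen ?s) (Pk \<kappa> g) \<doteq> Pk \<kappa> (lmul (L_gen ?s) g)"
          unfolding Pk_def lmul_simps by (intro eqv_add eqv_refl) simp
        then have "Pk \<kappa> (lmul (L_gen ?s) g) \<in> K" using lmul_K[OF g(2)] eqv_K by blast
        then show ?thesis using Y_closed[OF _ _ g(1), of ?s] by simp
      qed
    qed (use f in auto)
    then show False using Suc k by (auto simp: injP_def)
  qed
qed


definition M_all :: "'a word_space set" where "M_all = Sp (lists (range M_gen))"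

lemma M_all_Y: "f \<in> M_all \<Longrightarrow> \<exists>J. f \<in> Y J"
  unfolding M_all_def Y_def
proof (rule Sp_chain)
  show "\<exists>J. w \<in> lists (M_set J)" if "w \<in> lists (range M_gen)" for w
    using that
  proof (induction w)
    case (Cons b w)
    then obtain J where "w \<in> lists (M_set J)" by auto
    moreover obtain j where "b = M_gen j" using Cons by auto
    ultimately have "b # w \<in> lists (M_set (max J (nat (- j))))"
      using lists_mono[OF M_set_mono[of J "max J (nat (- j))"]] by auto
    then show ?case by blast
  qed auto
  show "lists (M_set i) \<subseteq> lists (M_set j)" if "i \<le> j" for i j
    using that by (intro lists_mono M_set_mono)
qed

section \<open>Lowering in the generators $Q_r$\<close>

text \<open>All letters $M$ are present from the start; the negative $Q$'s are added one at a time,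
  the new letter of \<open>Q_set (Suc J)\<close> being \<open>Q_gen (- int J)\<close>.\<close>

definition Q_set :: "nat \<Rightarrow> bms_basis set" where "Q_set J = range M_gen \<union> Q_gen ` {1 - int J..}"

definition Z where "Z J = Sp (lists (Q_set J))"

lemma Q_set_simps [simp]: "M_gen j \<in> Q_set J" "Q_gen j \<in> Q_set J \<longleftrightarrow> j \<ge> 1 - int J"
  by (auto simp: Q_set_def)

lemma Q_set_cases: "b \<in> Q_set J \<Longrightarrow> (\<And>j. b = M_gen j \<Longrightarrow> thesis) \<Longrightarrow>
    (\<And>j. b = Q_gen j \<Longrightarrow> j \<ge> 1 - int J \<Longrightarrow> thesis) \<Longrightarrow> thesis"
  by (auto simp: Q_set_def)

lemma Q_set_MQ: "Q_set J \<subseteq> MQ_set"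
  by (auto simp: Q_set_def)

lemma Q_set_mono: "I \<le> J \<Longrightarrow> Q_set I \<subseteq> Q_set J"
  by (auto simp: Q_set_def)

lemma Z_MQ: "f \<in> Z J \<Longrightarrow> f \<in> Sp (lists MQ_set)"
  unfolding Z_def by (rule Sp_mono[OF _ lists_mono[OF Q_set_MQ]])

lemma Z_PV: "f \<in> Z J \<Longrightarrow> f \<in> PV"
  unfolding Z_def by (rule Sp_PV)

lemma lmul_Z: "f \<in> Z J \<Longrightarrow> b \<in> Q_set J \<Longrightarrow> lmul b f \<in> Z J"
  unfolding Z_def by (rule lmul_Sp) auto

lemma Z_closed: "0 \<in> Z J" "f \<in> Z J \<Longrightarrow> g \<in> Z J \<Longrightarrow> f + g \<in> Z J" "f \<in> Z J \<Longrightarrow> c *\<^sub>c f \<in> Z J"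
    "f \<in> Z J \<Longrightarrow> - f \<in> Z J" "f \<in> K \<Longrightarrow> f \<in> Z J"
  by (simp_all add: Z_def Sp_closed K_Sp)

lemma Pk_Z: "f \<in> Z J \<Longrightarrow> Pk \<kappa> f \<in> Z J"
  unfolding Pk_def by (intro Z_closed(2,3) lmul_Z) auto

text \<open>The letters \<open>Q_gen j\<close> with \<open>j \<ge> 1\<close> commute with all $M$
  and belong to the subalgebra, so they pass to the end of the word and are absorbed into the
  vector.\<close>

lemma Z_0: 
  assumes "f \<in> Z 0"
  shows "f \<in> M_all"
  using assms unfolding Z_def
proof (induction rule: Sp_induct)
  case (word w v)
  from word(1) show ?case
  proof (induction w)
    case Nil
    show ?case using word by (auto simp: M_all_def intro: pv_Sp)
  next
    case (Cons b w)
    have IH: "pv w v \<in> M_all" using Cons by auto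
    have "lmul b (pv w v) \<in> M_all"
    proof (rule Q_set_cases[of b 0])
      show "b \<in> Q_set 0" using Cons by auto
      show ?thesis if "b = M_gen j" for j
        using IH that unfolding M_all_def by (elim lmul_Sp) auto
      show ?thesis if b: "b = Q_gen j" "j \<ge> 1 - int 0" for j
        using IH unfolding M_all_def
      proof (rule lmul_Sp_into)
        fix u x assume u: "u \<in> lists (range M_gen)" and x: "x \<in> carrier V"
        from u have "lmul (Q_gen j) (pv u x) \<doteq> lmulw u (lmul (Q_gen j) (pv [] x))"
        proof (induction u)
          case (Cons a u)
          then obtain i where i: "a = M_gen i" by auto
          have "lmul (Q_gen j) (lmul (M_gen i) (pv u x)) \<doteq> lmul (M_gen i) (lmul (Q_gen j) (pv u x))"
            using x by (intro comm_QM) simp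
          also have "\<dots> \<doteq> lmul (M_gen i) (lmulw u (lmul (Q_gen j) (pv [] x)))"
            using Cons by (intro eqv_lmul) auto
          finally show ?case using i by simp
        qed simp
        also have "\<dots> \<doteq> lmulw u (pv [] (act V (gen (Q_gen j)) x))"
          using b x by (intro eqv_lmulw pv_act) auto
        finally have "lmul (Q_gen j) (pv u x) \<doteq> pv u (act V (gen (Q_gen j)) x)" by simp
        moreover have "pv u (act V (gen (Q_gen j)) x) \<in> Sp (lists (range M_gen))"
          using u x b by (intro pv_Sp act_closed gen_in_span) auto
        ultimately show "lmul b (pv u x) \<in> Sp (lists (range M_gen))"
          using Sp_eqv b by blast
      qed auto
    qed
    then show ?case by simp
  qed
qed (auto simp: M_all_def K_Sp Sp_closed)

lemma injP_Z_0: "injP (Z 0)"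
  using Z_0 M_all_Y injP_Y unfolding injP_def by blast

text \<open>Anticommuting past \<open>Q_gen j\<close> with \<open>j \<ge> 1 - int J\<close> leaves a
  multiple of \<open>M_gen (s + j - 1)\<close>, whose index exceeds \<open>t\<close>.\<close>

lemma Z_kill:
  assumes s: "s > int t + int J" and f: "f \<in> Z J"
  shows "lmul (Q_gen s) f \<in> K"
  using f unfolding Z_def
proof (rule lmul_Sp_into)
  fix w v assume w: "w \<in> lists (Q_set J)" and v: "v \<in> carrier V"
  from w show "lmul (Q_gen s) (pv w v) \<in> K"
  proof (induction w)
    case Nil
    have "lmul (Q_gen s) (pv [] v) \<doteq> pv [] \<zero>\<^bsub>V\<^esub>"
      using pv_act[of "Q_gen s" v] Q_kill[of s v] s v by simp
    then show ?case using pv_zero eqv_K by blast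
  next
    case (Cons b w)
    let ?g = "pv w v"
    have g: "?g \<in> Z J" unfolding Z_def using Cons v by (intro pv_Sp) auto
    have IH: "lmul (Q_gen s) ?g \<in> K" using Cons by auto
    have "lmul (Q_gen s) (lmul b ?g) \<in> K"
    proof (rule Q_set_cases[of b J])
      show "b \<in> Q_set J" using Cons by auto
      show ?thesis if "b = M_gen j" for j
        using that comm_QM[OF Z_PV[OF g], of s j] lmul_K[OF IH] eqv_K by blast
      show ?thesis if b: "b = Q_gen j" "j \<ge> 1 - int J" for j
      proof -
        have "lmul (Q_gen s) (lmul (Q_gen j) ?g) \<doteq> - lmul (Q_gen j) (lmul (Q_gen s) ?g)
            + 2 *\<^sub>c lmul (M_gen (s + j - 1)) ?g"
          using comm_QQ[of ?g s j] s b v by simp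
        moreover have "lmul (M_gen (s + j - 1)) ?g \<in> K"
          using s b by (intro M_kills Z_MQ[OF g]) linarith
        then have "- lmul (Q_gen j) (lmul (Q_gen s) ?g) + 2 *\<^sub>c lmul (M_gen (s + j - 1)) ?g \<in> K"
          using lmul_K[OF IH] by (intro K_closed(2,3,5))
        ultimately show ?thesis using eqv_K b(1) by blast
      qed
    qed
    then show ?case by simp
  qed
qed auto

text \<open>The new letter $X$ is odd and $X^2=[X,X]/2$ is a single $M$, so degree at most one in
  $X$ suffices. The index $-2J-1$ of this $M$ is nonzero, hence $[X,X]$ has no central term.\<close>

lemma Z_Suc_decomp:
  assumes "f \<in> Z (Suc J)"
  shows "\<exists>y0\<in>Z J. \<exists>y1\<in>Z J. f \<doteq> y0 + lmul (Q_gen (- int J)) y1" (is "?D f")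
  using assms unfolding Z_def[of "Suc J"]
proof (induction rule: Sp_induct)
  case (ker f)
  then show ?case by (intro bexI[of _ 0]) (auto simp: lmul_simps eqv_zero Z_closed)
next
  case (add f g)
  then obtain y0 y1 z0 z1 where y: "y0 \<in> Z J" "y1 \<in> Z J" "z0 \<in> Z J" "z1 \<in> Z J"
    "f \<doteq> y0 + lmul (Q_gen (- int J)) y1" "g \<doteq> z0 + lmul (Q_gen (- int J)) z1" by blast
  from eqv_add[OF y(5,6)] have "f + g \<doteq> (y0 + z0) + lmul (Q_gen (- int J)) (y1 + z1)"
    by (simp add: lmul_simps algebra_simps)
  then show ?case using y Z_closed(2) by blast
next
  case (scale c f)
  then obtain y0 y1 where y: "y0 \<in> Z J" "y1 \<in> Z J" "f \<doteq> y0 + lmul (Q_gen (- int J)) y1" by blast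
  from eqv_scale[OF y(3), of c] have "c *\<^sub>c f \<doteq> c *\<^sub>c y0 + lmul (Q_gen (- int J)) (c *\<^sub>c y1)"
    by (simp add: lmul_simps pm_scale_add_right)
  then show ?case using y Z_closed(3) by blast
next
  case (word w v)
  from word(1) show ?case
  proof (induction w)
    case Nil
    have "pv [] v \<in> Z J" using word by (auto simp: Z_def intro: pv_Sp)
    then show ?case
      by (intro bexI[of _ "pv [] v"] bexI[of _ 0]) (auto simp: lmul_simps Z_closed)
  next
    case (Cons b w)
    let ?X = "lmul (Q_gen (- int J))"
    obtain y0 y1 where y: "y0 \<in> Z J" "y1 \<in> Z J" "pv w v \<doteq> y0 + ?X y1" using Cons by auto
    have bw: "lmul b (pv w v) \<doteq> lmul b y0 + lmul b (?X y1)"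
      using eqv_lmul[OF y(3), of b] by (simp add: lmul_simps)
    have "?D (lmul b (pv w v))"
    proof (rule Q_set_cases[of b "Suc J"])
      show "b \<in> Q_set (Suc J)" using Cons by auto
    next
      fix j assume b: "b = M_gen j"
      have "lmul b y0 + lmul b (?X y1) \<doteq> lmul b y0 + ?X (lmul b y1)"
        unfolding b by (intro eqv_add eqv_refl comm_MQ Z_PV[OF y(2)])
      with bw have "lmul b (pv w v) \<doteq> lmul b y0 + ?X (lmul b y1)" by (rule eqv_trans)
      then show ?thesis using lmul_Z[of _ J b] y b by auto
    next
      fix j assume b: "b = Q_gen j" "j \<ge> 1 - int (Suc J)"
      show ?thesis
      proof (cases "j = - int J")
        case True
        have "?X (?X y1) \<doteq> - ?X (?X y1) + 2 *\<^sub>c lmul (M_gen (- int J + - int J - 1)) y1"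
          using comm_QQ[OF Z_PV[OF y(2)], of "- int J" "- int J"] by simp
        from eqv_add[OF this eqv_refl[of "?X (?X y1)"]]
        have "2 *\<^sub>c ?X (?X y1) \<doteq> 2 *\<^sub>c lmul (M_gen (- int J + - int J - 1)) y1"
          using pm_scale_add_left[of 1 1 "?X (?X y1)"] by simp
        from eqv_scale[OF this, of "1/2"]
        have "?X (?X y1) \<doteq> lmul (M_gen (- int J + - int J - 1)) y1" by simp
        then have "lmul b y0 + lmul b (?X y1) \<doteq> ?X y0 + lmul (M_gen (- int J + - int J - 1)) y1"
          unfolding b True by (intro eqv_add eqv_refl)
        with bw have "lmul b (pv w v) \<doteq> ?X y0 + lmul (M_gen (- int J + - int J - 1)) y1"
          by (rule eqv_trans)
        then have "lmul b (pv w v) \<doteq> lmul (M_gen (- int J + - int J - 1)) y1 + ?X y0"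
          by (simp only: add.commute)
        then show ?thesis using y lmul_Z[OF y(2), of "M_gen (- int J + - int J - 1)"] by auto
      next
        case False
        then have bJ: "b \<in> Q_set J" using b by auto
        define c where "c = (if j + - int J - 1 = 0 then ((of_int j - 1 / 2)\<^sup>2 - 1 / 4) / 3 else 0) * c2"
        let ?y = "2 *\<^sub>c lmul (M_gen (j + - int J - 1)) y1 + c *\<^sub>c y1"
        have "lmul b (?X y1) \<doteq> - ?X (lmul b y1) + ?y"
          using comm_QQ[OF Z_PV[OF y(2)], of j "- int J"] unfolding b c_def .
        then have "lmul b y0 + lmul b (?X y1) \<doteq> lmul b y0 + (- ?X (lmul b y1) + ?y)"
          by (intro eqv_add eqv_refl)
        with bw have "lmul b (pv w v) \<doteq> lmul b y0 + (- ?X (lmul b y1) + ?y)" by (rule eqv_trans)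
        also have "\<dots> = (lmul b y0 + ?y) + ?X (- lmul b y1)" by (simp add: lmul_simps)
        finally have "lmul b (pv w v) \<doteq> (lmul b y0 + ?y) + ?X (- lmul b y1)" .
        moreover have "lmul b y0 + ?y \<in> Z J" "- lmul b y1 \<in> Z J"
          using y bJ by (intro Z_closed(2-4) lmul_Z; simp)+
        ultimately show ?thesis by blast
      qed
    qed
    then show ?case by simp
  qed
qed

text \<open>One application of the partner of the new letter turns \<open>f\<close> into a nonzero
  multiple of $(M_t+\<kappa>)$ applied to \<open>y1\<close>, unless \<open>y1\<close> vanishes in
  the induced module and \<open>f\<close> is already represented in \<open>Z J\<close>.\<close>

lemma Z_lower:
  assumes inj: "injP (Z J)" and N: "pm.subspace N" "K \<subseteq> N"
    and closed: "\<And>f. f \<in> N \<Longrightarrow> lmul (Q_gen (int t + int (Suc J))) f \<in> N"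
    and f: "f \<in> Z (Suc J)" "f \<in> N" "f \<notin> K"
  shows "\<exists>f\<in>Z J. f \<in> N \<and> f \<notin> K"
proof -
  obtain y0 y1 where y: "y0 \<in> Z J" "y1 \<in> Z J" "f \<doteq> y0 + lmul (Q_gen (1 - int (Suc J))) y1"
    using Z_Suc_decomp[OF f(1)] by auto
  obtain \<kappa> \<alpha> where k: "good \<kappa>" "\<alpha> \<noteq> 0"
    "\<And>f. f \<in> PV \<Longrightarrow> lmul (Q_gen (int t + int (Suc J))) (lmul (Q_gen (1 - int (Suc J))) f)
       \<doteq> - lmul (Q_gen (1 - int (Suc J))) (lmul (Q_gen (int t + int (Suc J))) f) + \<alpha> *\<^sub>c Pk \<kappa> f"
    by (rule QQ_lower[of "int (Suc J)"]) (rule that)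
  let ?D = "lmul (Q_gen (int t + int (Suc J)))" and ?X = "lmul (Q_gen (1 - int (Suc J)))"
  have kill: "?D g \<in> K" if "g \<in> Z J" for g
    using that by (intro Z_kill) auto
  show ?thesis
  proof (cases "y1 \<in> K")
    case True
    have "f \<doteq> y0 + 0"
      by (rule eqv_trans[OF y(3)]) (intro eqv_add eqv_refl, simp add: eqv_zero lmul_K True)
    then have "f \<doteq> y0" by simp
    then show ?thesis using y(1) f N eqv_mem eqv_K by blast
  next
    case False
    have "?D f \<doteq> ?D y0 + ?D (?X y1)"
      using eqv_lmul[OF y(3)] by (simp only: lmul_simps)
    also have "\<dots> \<doteq> 0 + (- ?X (?D y1) + \<alpha> *\<^sub>c Pk \<kappa> y1)"
      using kill[OF y(1)] by (intro eqv_add k Z_PV[OF y(2)]) (simp add: eqv_zero)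
    also have "\<dots> \<doteq> 0 + (- 0 + \<alpha> *\<^sub>c Pk \<kappa> y1)"
      using kill[OF y(2)] by (intro eqv_add eqv_refl eqv_uminus) (simp add: eqv_zero lmul_K)
    finally have "?D f \<doteq> \<alpha> *\<^sub>c Pk \<kappa> y1" by simp
    then have "\<alpha> *\<^sub>c Pk \<kappa> y1 \<in> N"
      using closed[OF f(2)] N eqv_mem by blast
    moreover have "\<alpha> *\<^sub>c Pk \<kappa> y1 \<in> Z J" by (intro Z_closed(3) Pk_Z y)
    moreover have "\<alpha> *\<^sub>c Pk \<kappa> y1 \<notin> K" using injPD[OF inj k(1) y(2) False k(2)] .
    ultimately show ?thesis by blast
  qed
qed

text \<open>Here the kernel of $M_t+\<kappa>$ is stable because $M_t$ commutes with every
  $Q$.\<close>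

lemma injP_Z: "injP (Z J)"
proof (induction J)
  case 0
  show ?case by (rule injP_Z_0)
next
  case (Suc J)
  show ?case
    unfolding injP_def
  proof (intro allI impI, rule ccontr)
    fix \<kappa> f assume k: "good \<kappa>" and f: "f \<in> Z (Suc J)" "Pk \<kappa> f \<in> K" "f \<notin> K"
    let ?N = "{f \<in> Z (Suc J). Pk \<kappa> f \<in> K}"
    have "\<exists>f\<in>Z J. f \<in> ?N \<and> f \<notin> K"
    proof (rule Z_lower[OF Suc])
      show "pm.subspace ?N"
        by (rule pm.subspaceI) (auto simp: Pk_simps K_closed Z_closed)
      show "K \<subseteq> ?N" using Pk_K Z_closed by auto
      show "lmul (Q_gen (int t + int (Suc J))) g \<in> ?N" if "g \<in> ?N" for g
        using that lmul_Z[of g "Suc J" "Q_gen (int t + int (Suc J))"] eqv_K lmul_K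
          Pk_MQ[OF Z_PV, of g "Suc J" "Q_gen (int t + int (Suc J))" \<kappa>] by auto
    qed (use f in auto)
    then show False using Suc k by (auto simp: injP_def)
  qed
qed

lemma MQ_Z: "f \<in> Sp (lists MQ_set) \<Longrightarrow> \<exists>J. f \<in> Z J"
  unfolding Z_def
proof (rule Sp_chain)
  show "\<exists>J. w \<in> lists (Q_set J)" if "w \<in> lists MQ_set" for w
    using that
  proof (induction w)
    case (Cons b w)
    then obtain J where J: "w \<in> lists (Q_set J)" by auto
    have "b \<in> MQ_set" using Cons by auto
    then show ?case
    proof (rule MQ_set_cases)
      show ?thesis if "b = M_gen j" for j using J that by auto
      show ?thesis if "b = Q_gen j" for j
      proof -
        have "b # w \<in> lists (Q_set (max J (nat (1 - j))))"
          using J that lists_mono[OF Q_set_mono[of J "max J (nat (1 - j))"]] by auto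
        then show ?thesis by blast
      qed
    qed
  qed auto
  show "lists (Q_set i) \<subseteq> lists (Q_set j)" if "i \<le> j" for i j
    using that by (intro lists_mono Q_set_mono)
qed

lemma injP_MQ: "injP (Sp (lists MQ_set))"
  using MQ_Z injP_Z unfolding injP_def by blast

lemma Z_lower_0:
  assumes N: "pm.subspace N" "K \<subseteq> N" and closed: "\<And>b f. f \<in> N \<Longrightarrow> lmul b f \<in> N"
    and f: "f \<in> Z J" "f \<in> N" "f \<notin> K"
  shows "\<exists>f\<in>Z 0. f \<in> N \<and> f \<notin> K"
  using f
proof (induction J arbitrary: f)
  case (Suc J)
  then show ?case using Z_lower[OF injP_Z N closed] by blast
qed auto

lemma Y_lower_0:
  assumes N: "pm.subspace N" "K \<subseteq> N" and closed: "\<And>b f. f \<in> N \<Longrightarrow> lmul b f \<in> N"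
    and f: "f \<in> Y J" "f \<in> N" "f \<notin> K"
  shows "\<exists>f\<in>Y 0. f \<in> N \<and> f \<notin> K"
  using f
proof (induction J arbitrary: f)
  case (Suc J)
  then show ?case using Y_lower[OF injP_Y N closed] by blast
qed auto


section \<open>Lowering in the generators $L_n$\<close>

text \<open>Central letters and nonnegative $L$'s are left out: they can be absorbed, and words in
  the remaining letters span (\<open>pv_all_letters\<close>).\<close>

definition all_letters :: "bms_basis set" where "all_letters = MQ_set \<union> L_gen ` {..<0}"

definition L_count :: "bms_basis list \<Rightarrow> nat" where "L_count w = length (filter (\<lambda>b. b \<notin> MQ_set) w)"

text \<open>Words with \<^emph>\<open>fewer\<close> than \<open>r\<close> letters \<open>L\<close>, so that \<open>F 0 = K\<close>.\<close>

definition F where "F r = Sp {w \<in> lists all_letters. L_count w < r}"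

lemma L_notin_MQ [simp]: "L_gen i \<notin> MQ_set"
  by (auto simp: MQ_set_def)

lemma L_count_simps [simp]: "L_count [] = 0" "b \<in> MQ_set \<Longrightarrow> L_count (b # w) = L_count w"
    "L_count (L_gen i # w) = Suc (L_count w)"
  by (simp_all add: L_count_def)

lemma all_letters_cases: "b \<in> all_letters \<Longrightarrow> (b \<in> MQ_set \<Longrightarrow> thesis) \<Longrightarrow>
    (\<And>j :: nat. b = L_gen (- int j) \<Longrightarrow> j \<ge> 1 \<Longrightarrow> thesis) \<Longrightarrow> thesis"
  unfolding all_letters_def
proof (elim UnE imageE)
  fix i assume *: "\<And>j :: nat. b = L_gen (- int j) \<Longrightarrow> j \<ge> 1 \<Longrightarrow> thesis" "b = L_gen i" "i \<in> {..<0}"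
  show thesis using *(1)[of "nat (- i)"] *(2,3) by simp
qed

lemma all_letters_simps [simp]: "b \<in> MQ_set \<Longrightarrow> b \<in> all_letters" "L_gen i \<in> all_letters \<longleftrightarrow> i < 0"
  by (auto simp: all_letters_def)

lemma F_closed: "0 \<in> F r" "f \<in> F r \<Longrightarrow> g \<in> F r \<Longrightarrow> f + g \<in> F r" "f \<in> F r \<Longrightarrow> c *\<^sub>c f \<in> F r"
    "f \<in> F r \<Longrightarrow> g \<in> F r \<Longrightarrow> f - g \<in> F r"
  by (simp_all add: F_def Sp_closed)

lemma F_subspace [simp]: "pm.subspace (F r)"
  by (simp add: F_def)

lemma K_F: "f \<in> K \<Longrightarrow> f \<in> F r"
  by (simp add: F_def K_Sp)

lemma F_0: "F 0 = K"
proof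
  show "F 0 \<subseteq> K"
  proof
    fix f assume "f \<in> F 0"
    then show "f \<in> K"
      unfolding F_def by (induction rule: Sp_induct) (auto simp: K_closed)
  qed
qed (use K_F in blast)

lemma F_PV: "f \<in> F r \<Longrightarrow> f \<in> PV"
  unfolding F_def by (rule Sp_PV)

lemma F_mono: "f \<in> F r \<Longrightarrow> r \<le> s \<Longrightarrow> f \<in> F s"
  unfolding F_def by (erule Sp_mono) auto

lemma F_1: "F 1 = Sp (lists MQ_set)"
proof -
  have "{w \<in> lists all_letters. L_count w < 1} = lists MQ_set"
    by (auto simp: L_count_def filter_empty_conv)
  then show ?thesis by (simp add: F_def)
qed

lemma F_eqv: "f \<doteq> g \<Longrightarrow> g \<in> F r \<Longrightarrow> f \<in> F r"
  unfolding F_def by (rule Sp_eqv)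

lemma F_MQ: "f \<in> F r \<Longrightarrow> b \<in> MQ_set \<Longrightarrow> lmul b f \<in> F r"
  unfolding F_def by (erule lmul_Sp) auto

lemma F_L: "f \<in> F r \<Longrightarrow> j \<ge> 1 \<Longrightarrow> lmul (L_gen (- int j)) f \<in> F (Suc r)"
  unfolding F_def by (erule lmul_Sp) auto

lemma F_L_pred: "f \<in> F (r - 1) \<Longrightarrow> j \<ge> 1 \<Longrightarrow> lmul (L_gen (- int j)) f \<in> F r"
  using F_L[of f "r - 1" j] lmul_K by (cases r) (auto simp: F_0)

text \<open>On its way to the vector, where it vanishes, $M_s$ contributes only through commutators
  with letters $L_{-j}$, each of which replaces that $L$ by an $M$ or a scalar.\<close>

lemma F_M_lower:
  assumes s: "s > int t" and f: "f \<in> F (Suc r)"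
  shows "lmul (M_gen s) f \<in> F r"
proof -
  have word: "lmul (M_gen s) (pv w v) \<in> F r"
    if "w \<in> lists all_letters" "L_count w < Suc r" "v \<in> carrier V" "s > int t" for w v r s
    using that
  proof (induction w arbitrary: r s)
    case Nil
    have "pv [] v \<in> Sp (lists MQ_set)" using Nil by (intro pv_Sp) auto
    then show ?case using Nil by (intro K_F M_kills)
  next
    case (Cons b w)
    have v: "v \<in> carrier V" by fact
    have "b \<in> all_letters" using Cons by auto
    then have "lmul (M_gen s) (lmul b (pv w v)) \<in> F r"
    proof (rule all_letters_cases)
      assume b: "b \<in> MQ_set"
      then have "lmul (M_gen s) (pv w v) \<in> F r" using Cons by (intro Cons.IH) auto
      then have "lmul b (lmul (M_gen s) (pv w v)) \<in> F r" by (rule F_MQ) (rule b)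
      then show ?thesis using M_MQ[of "pv w v" b s] v b F_eqv by simp
    next
      fix j :: nat assume b: "b = L_gen (- int j)" "j \<ge> 1"
      with Cons.prems obtain r' where r: "r = Suc r'" "L_count w < Suc r'" by (cases r) auto
      have w: "pv w v \<in> F r" unfolding F_def using Cons r by (intro pv_Sp) auto
      have "lmul (M_gen s) (pv w v) \<in> F r'" using Cons r by (intro Cons.IH) auto
      from F_L[OF this b(2)] have Lw: "lmul (L_gen (- int j)) (lmul (M_gen s) (pv w v)) \<in> F r"
        using r by simp
      show ?thesis
        unfolding b by (intro F_eqv[OF comm_ML] F_closed(2,3) F_MQ[OF w] w Lw) (use v in auto)
    qed
    then show ?case by simp
  qed
  show ?thesis
    using f unfolding F_def[of "Suc r"] by (rule lmul_Sp_into) (use word s K_F in auto)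
qed

text \<open>The bracket of two negative $L$'s is a multiple of one negative $L$, so reordering
  changes an element only by lower terms.\<close>

lemma F_comm_L: "f \<in> F r \<Longrightarrow> i \<ge> 1 \<Longrightarrow> j \<ge> 1 \<Longrightarrow>
    lmul (L_gen (- int i)) (lmul (L_gen (- int j)) f) - lmul (L_gen (- int j)) (lmul (L_gen (- int i)) f) \<in> F (Suc r)"
proof -
  assume f: "f \<in> F r" and ij: "i \<ge> 1" "j \<ge> 1"
  let ?i = "- int i" and ?j = "- int j"
  have "lmul (L_gen ?i) (lmul (L_gen ?j) f) \<doteq> lmul (L_gen ?j) (lmul (L_gen ?i) f)
      + (of_int (?i - ?j) *\<^sub>c lmul (L_gen (- int (i + j))) f)"
    using comm_LL[OF F_PV[OF f], of ?i ?j] ij by (simp add: add.commute)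
  then have "lmul (L_gen ?i) (lmul (L_gen ?j) f) - lmul (L_gen ?j) (lmul (L_gen ?i) f)
      \<doteq> (of_int (?i - ?j) *\<^sub>c lmul (L_gen (- int (i + j))) f)"
    by (simp add: eqv_def algebra_simps)
  moreover have "of_int (?i - ?j) *\<^sub>c lmul (L_gen (- int (i + j))) f \<in> F (Suc r)"
    using f ij by (intro F_closed F_L) auto
  ultimately show ?thesis by (rule F_eqv)
qed

lemma F_comm_MQ:
  assumes f: "f \<in> F r" and b: "b \<in> MQ_set"
  shows "lmul b (lmul (L_gen j) f) - lmul (L_gen j) (lmul b f) \<in> F r"
  using b
proof (rule MQ_set_cases)
  fix i assume i: "b = M_gen i"
  have "lmul b (lmul (L_gen j) f) - lmul (L_gen j) (lmul b f) \<doteq> of_int (i - j) *\<^sub>c lmul (M_gen (i + j)) f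
       + ((if i + j = 0 then of_int (i ^ 3 - i) / 12 else 0) * c2) *\<^sub>c f"
    using comm_ML[OF F_PV[OF f], of i j] unfolding i eqv_def by (simp add: algebra_simps)
  moreover have "of_int (i - j) *\<^sub>c lmul (M_gen (i + j)) f
       + ((if i + j = 0 then of_int (i ^ 3 - i) / 12 else 0) * c2) *\<^sub>c f \<in> F r"
    using f by (intro F_closed F_MQ) auto
  ultimately show ?thesis by (rule F_eqv)
next
  fix i assume i: "b = Q_gen i"
  have "lmul b (lmul (L_gen j) f) - lmul (L_gen j) (lmul b f)
      \<doteq> ((of_int i - 1 / 2) - of_int j / 2) *\<^sub>c lmul (Q_gen (j + i)) f"
    using comm_QL[OF F_PV[OF f], of i j] unfolding i eqv_def by (simp add: algebra_simps)
  moreover have "((of_int i - 1 / 2) - of_int j / 2) *\<^sub>c lmul (Q_gen (j + i)) f \<in> F r"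
    using f by (intro F_closed F_MQ) auto
  ultimately show ?thesis by (rule F_eqv)
qed

section \<open>Ordered monomials in the negative $L$'s\<close>

definition Lw :: "nat list \<Rightarrow> 'a word_space \<Rightarrow> 'a word_space"
  where "Lw l = lmulw (map (\<lambda>i. L_gen (- int i)) l)"

lemma Lw_simps [simp]: "Lw [] f = f" "Lw (i # l) f = lmul (L_gen (- int i)) (Lw l f)"
  by (simp_all add: Lw_def)

lemma Lw_lin: "Lw l (f + g) = Lw l f + Lw l g" "Lw l (c *\<^sub>c f) = c *\<^sub>c Lw l f" "Lw l 0 = 0"
  by (simp_all add: Lw_def lmulw_lin)

text \<open>The largest index comes first, so the head of a list shows the largest letter of the
  monomial.\<close>

definition desc :: "nat list \<Rightarrow> bool" where
  "desc l \<longleftrightarrow> sorted_wrt (\<ge>) l \<and> (\<forall>i\<in>set l. i \<ge> 1)"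

lemma desc_simps [simp]: "desc []" "desc (i # l) \<longleftrightarrow> i \<ge> 1 \<and> (\<forall>j\<in>set l. j \<le> i) \<and> desc l"
  by (auto simp: desc_def)

lemma Lw_F: "f \<in> F r \<Longrightarrow> desc l \<Longrightarrow> Lw l f \<in> F (r + length l)"
  by (induction l) (auto intro: F_L)

lemma Lw_MQ:
  assumes "z \<in> F 1" "desc l" "b \<in> MQ_set"
  shows "lmul b (Lw l z) - Lw l (lmul b z) \<in> F (length l)"
  using assms(2)
proof (induction l)
  case (Cons j l)
  have "lmul b (lmul (L_gen (- int j)) (Lw l z)) - lmul (L_gen (- int j)) (lmul b (Lw l z)) \<in> F (Suc (length l))"
    using Lw_F[OF assms(1), of l] Cons by (intro F_comm_MQ assms) simp
  moreover have "lmul (L_gen (- int j)) (lmul b (Lw l z) - Lw l (lmul b z)) \<in> F (Suc (length l))"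
    using Cons by (intro F_L) auto
  ultimately show ?case
    using F_closed(2) by (fastforce simp: lmul_simps)
qed (simp add: F_closed)

lemma Lw_Pk:
  assumes "z \<in> F 1" "desc l"
  shows "Pk \<kappa> (Lw l z) - Lw l (Pk \<kappa> z) \<in> F (length l)"
  using Lw_MQ[OF assms, of "M_gen (int t)"] by (simp add: Pk_def Lw_lin)

text \<open>Commuting $M_{t+i}$ past $L_{-j}$ with $j<i$ yields $M_{t+i-j}$, whose index is still
  above $t$ and which therefore lowers once more. Two letters $L$ are lost, from
  \<open>F (length l + 1)\<close> to \<open>F (length l - 1)\<close>; for the empty list truncated
  subtraction correctly gives \<open>F 0 = K\<close>.\<close>

lemma lower_smaller:
  assumes z: "z \<in> F 1" and i: "i \<ge> 1" and l: "desc l" "\<forall>j\<in>set l. j < i"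
  shows "lmul (M_gen (int t + int i)) (Lw l z) \<in> F (length l - 1)"
  using l
proof (induction l)
  case Nil
  then show ?case using F_M_lower[of "int t + int i" z 0] i z by simp
next
  case (Cons j l)
  let ?g = "Lw l z" and ?i = "int t + int i"
  have g: "?g \<in> F (Suc (length l))" using Lw_F[OF z, of l] Cons by simp
  have eq: "lmul (M_gen ?i) (lmul (L_gen (- int j)) ?g) \<doteq> lmul (L_gen (- int j)) (lmul (M_gen ?i) ?g)
      + of_int (?i - - int j) *\<^sub>c lmul (M_gen (?i + - int j)) ?g"
    using comm_ML[OF F_PV[OF g], of ?i "- int j"] Cons by simp
  have "lmul (L_gen (- int j)) (lmul (M_gen ?i) ?g) \<in> F (length l)"
    using Cons by (intro F_L_pred Cons.IH) auto
  moreover have "lmul (M_gen (?i + - int j)) ?g \<in> F (length l)"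
    using Cons by (intro F_M_lower g) auto
  ultimately have "lmul (L_gen (- int j)) (lmul (M_gen ?i) ?g)
      + of_int (?i - - int j) *\<^sub>c lmul (M_gen (?i + - int j)) ?g \<in> F (length l)"
    by (intro F_closed(2,3))
  from F_eqv[OF eq this] show ?case by simp
qed

text \<open>\<open>Suc m\<close> is the multiplicity of \<open>i\<close> in \<open>i # l\<close>:
  each factor $L_{-i}$ contributes one commutator, a multiple of $M_t+\<kappa>$, which moves to the
  coefficient \<open>z\<close> modulo lower terms. Later steps use only that this multiplicity is
  nonzero.\<close>

lemma lower_equal:
  assumes z: "z \<in> F 1" and i: "i \<ge> 1" and l: "desc (i # l)"
    and k: "\<And>f. f \<in> PV \<Longrightarrow> lmul (M_gen (int t + int i)) (lmul (L_gen (- int i)) f)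
       \<doteq> lmul (L_gen (- int i)) (lmul (M_gen (int t + int i)) f) + \<alpha> *\<^sub>c Pk \<kappa> f"
  shows "\<exists>m. lmul (M_gen (int t + int i)) (Lw (i # l) z)
      - Lw l ((of_nat (Suc m) * \<alpha>) *\<^sub>c Pk \<kappa> z) \<in> F (length l)"
  using l
proof (induction l)
  case Nil
  have "lmul (M_gen (int t + int i)) z \<in> K"
    using F_M_lower[of "int t + int i" z 0] i z by (simp add: F_0)
  then have "lmul (L_gen (- int i)) (lmul (M_gen (int t + int i)) z) + \<alpha> *\<^sub>c Pk \<kappa> z \<doteq> 0 + \<alpha> *\<^sub>c Pk \<kappa> z"
    by (intro eqv_add eqv_refl) (simp add: eqv_zero lmul_K)
  from eqv_trans[OF k[OF F_PV[OF z]] this] show ?case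
    by (intro exI[of _ 0]) (simp add: F_0 eqv_def)
next
  case (Cons j l)
  let ?g = "Lw (j # l) z" and ?D = "lmul (M_gen (int t + int i))" and ?X = "lmul (L_gen (- int i))"
  have g: "?g \<in> F (Suc (Suc (length l)))" using Lw_F[OF z, of "j # l"] Cons by simp
  \<comment> \<open>Now \<open>m\<close> counts the occurrences of \<open>i\<close> in
    \<open>j # l\<close>. If \<open>j\<close> differs from \<open>i\<close>, all indices of the list
    are smaller, the whole term is of lower filtration, and \<open>m\<close> is
    \<open>0\<close>.\<close>
  have "\<exists>m. ?X (?D ?g) - Lw (j # l) ((of_nat m * \<alpha>) *\<^sub>c Pk \<kappa> z) \<in> F (Suc (length l))"
  proof (cases "j = i")
    case True
    then obtain m where m: "?D ?g - Lw l ((of_nat (Suc m) * \<alpha>) *\<^sub>c Pk \<kappa> z) \<in> F (length l)"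
      using Cons by auto
    from F_L[OF m i] show ?thesis
      using True by (intro exI[of _ "Suc m"]) (simp add: lmul_simps)
  next
    case False
    have "?D ?g \<in> F (length (j # l) - 1)"
      using Cons False by (intro lower_smaller z i) auto
    from F_L[of _ "length l" i] this i have "?X (?D ?g) \<in> F (Suc (length l))" by simp
    then show ?thesis by (intro exI[of _ 0]) (simp add: lmul_simps Lw_lin)
  qed
  then obtain m where m: "?X (?D ?g) - Lw (j # l) ((of_nat m * \<alpha>) *\<^sub>c Pk \<kappa> z) \<in> F (Suc (length l))" by blast
  have p: "\<alpha> *\<^sub>c (Pk \<kappa> ?g - Lw (j # l) (Pk \<kappa> z)) \<in> F (Suc (length l))"
    using Lw_Pk[OF z, of "j # l" \<kappa>] Cons by (intro F_closed(3)) auto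
  have "?D (?X ?g) - (?X (?D ?g) + \<alpha> *\<^sub>c Pk \<kappa> ?g) \<in> F (Suc (length l))"
    using k[OF F_PV[OF g]] by (intro K_F) (simp add: eqv_def)
  from F_closed(2)[OF F_closed(2)[OF this m] p]
  have "?D (?X ?g) - Lw (j # l) ((of_nat (Suc m) * \<alpha>) *\<^sub>c Pk \<kappa> z) \<in> F (Suc (length l))"
    by (simp only: Lw_lin pm_scale_diff of_nat_Suc distrib_right pm_scale_add_left mult_1_left) (simp add: algebra_simps)
  then show ?case by (intro exI[of _ m]) simp
qed

primrec insert_desc :: "nat \<Rightarrow> nat list \<Rightarrow> nat list" where
  "insert_desc i [] = [i]"
| "insert_desc i (j # l) = (if j \<le> i then i # j # l else j # insert_desc i l)"

lemma set_insert_desc [simp]: "set (insert_desc i l) = insert i (set l)"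
  by (induction l) auto

lemma length_insert_desc [simp]: "length (insert_desc i l) = Suc (length l)"
  by (induction l) auto

lemma desc_insert_desc: "desc l \<Longrightarrow> i \<ge> 1 \<Longrightarrow> desc (insert_desc i l)"
  by (induction l) (auto intro: order_trans)

lemma Lw_insert_desc:
  assumes "z \<in> F 1" "i \<ge> 1" "desc l"
  shows "Lw (i # l) z - Lw (insert_desc i l) z \<in> F (Suc (length l))"
  using assms(3)
proof (induction l)
  case (Cons j l)
  show ?case
  proof (cases "j \<le> i")
    case False
    have "lmul (L_gen (- int i)) (lmul (L_gen (- int j)) (Lw l z))
        - lmul (L_gen (- int j)) (lmul (L_gen (- int i)) (Lw l z)) \<in> F (Suc (Suc (length l)))"
      using Lw_F[OF assms(1), of l] Cons assms by (intro F_comm_L) auto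
    moreover have "lmul (L_gen (- int j)) (Lw (i # l) z - Lw (insert_desc i l) z) \<in> F (Suc (Suc (length l)))"
      using Cons by (intro F_L) auto
    ultimately show ?thesis
      using False F_closed(2) by (fastforce simp: lmul_simps)
  qed (simp add: F_closed)
qed (simp add: F_closed)

text \<open>Meant as a description of \<open>F (Suc r)\<close> by leading terms: ordered monomials
  of length exactly \<open>r\<close> with coefficients free of $L$, modulo \<open>F r\<close>. The
  inclusion that is used is \<open>F_Suc_G\<close>.\<close>

definition G where "G r = pm.span (F r \<union> {Lw l z | l z. desc l \<and> length l = r \<and> z \<in> F 1})"

lemma F_in_G: "f \<in> F r \<Longrightarrow> f \<in> G r"
  unfolding G_def by (intro pm.span_base) simp

lemma Lw_in_G: "desc l \<Longrightarrow> z \<in> F 1 \<Longrightarrow> Lw l z \<in> G (length l)"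
  unfolding G_def by (intro pm.span_base) blast

lemma G_closed: "f \<in> G r \<Longrightarrow> g \<in> G r \<Longrightarrow> f + g \<in> G r" "f \<in> G r \<Longrightarrow> c *\<^sub>c f \<in> G r"
  by (simp_all add: G_def pm.span_add pm.span_scale)

lemma G_induct [consumes 1, case_names base word add]:
  assumes "f \<in> G r" "\<And>f. f \<in> F r \<Longrightarrow> P f" "\<And>l z. desc l \<Longrightarrow> length l = r \<Longrightarrow> z \<in> F 1 \<Longrightarrow> P (Lw l z)"
    "\<And>c f g. P f \<Longrightarrow> P g \<Longrightarrow> P (c *\<^sub>c f + g)"
  shows "P f"
  using assms(1) unfolding G_def
proof (induction rule: pm.span_induct_alt)
  case base
  then show ?case using assms(2)[of 0] F_closed by blast
next
  case (step c x y)
  from step(1) have "P x" using assms(2,3) by blast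
  then show ?case using step assms(4) by blast
qed

lemma G_MQ: "f \<in> G r \<Longrightarrow> b \<in> MQ_set \<Longrightarrow> lmul b f \<in> G r"
proof (induction rule: G_induct)
  case (base f)
  then show ?case by (intro F_in_G F_MQ)
next
  case (word l z)
  from F_in_G[OF Lw_MQ[OF word(3,1,4)]] Lw_in_G[OF word(1) F_MQ[OF word(3,4)]]
  have "(lmul b (Lw l z) - Lw l (lmul b z)) + Lw l (lmul b z) \<in> G (length l)" by (rule G_closed)
  then show ?case using word by simp
next
  case (add c f g)
  then show ?case by (simp add: lmul_simps G_closed)
qed

lemma G_L: "f \<in> G r \<Longrightarrow> i \<ge> 1 \<Longrightarrow> lmul (L_gen (- int i)) f \<in> G (Suc r)"
proof (induction rule: G_induct)
  case (base f)
  then show ?case by (intro F_in_G F_L)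
next
  case (word l z)
  from F_in_G[OF Lw_insert_desc[OF word(3,4,1)]]
    Lw_in_G[OF desc_insert_desc[OF word(1,4)] word(3)]
  have "(Lw (i # l) z - Lw (insert_desc i l) z) + Lw (insert_desc i l) z \<in> G (Suc (length l))"
    unfolding length_insert_desc by (rule G_closed)
  then show ?case using word by simp
next
  case (add c f g)
  then show ?case by (simp add: lmul_simps G_closed)
qed

text \<open>A word is built up from the right, and \<open>G\<close> absorbs each new letter: an $M$
  or $Q$ is commuted into the coefficient, an $L$ is inserted at its place in the monomial.\<close>

lemma F_Suc_G: 
  assumes "f \<in> F (Suc r)"
  shows "f \<in> G r"
proof -
  have word: "pv w v \<in> G r" if "w \<in> lists all_letters" "L_count w < Suc r" "v \<in> carrier V" for w v r
    using that
  proof (induction w arbitrary: r)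
    case Nil
    have "pv [] v \<in> F 1" unfolding F_def using Nil by (intro pv_Sp) auto
    then show ?case
      using Lw_in_G[of "[]" "pv [] v"] F_in_G[OF F_mono[of "pv [] v" 1 r]] by (cases "r = 0") auto
  next
    case (Cons b w)
    have "b \<in> all_letters" using Cons by auto
    then have "lmul b (pv w v) \<in> G r"
    proof (rule all_letters_cases)
      assume "b \<in> MQ_set"
      then show ?thesis using Cons by (intro G_MQ Cons.IH) auto
    next
      fix j :: nat assume b: "b = L_gen (- int j)" "j \<ge> 1"
      with Cons.prems obtain r' where r: "r = Suc r'" "L_count w < Suc r'" by (cases r) auto
      show ?thesis unfolding b r using Cons b r by (intro G_L Cons.IH) auto
    qed
    then show ?case by simp
  qed
  from assms show ?thesis
    unfolding F_def
    by (induction rule: Sp_induct) (auto intro: word G_closed F_in_G K_F simp del: One_nat_def)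
qed

text \<open>The span is collected into one coefficient per index list. Different terms then have
  different lists, and they remain different after a common leading factor $L_{-i}$ is
  removed.\<close>

lemma G_family:
  assumes "f \<in> G r"
  shows "\<exists>S u. finite S \<and> (\<forall>l\<in>S. desc l \<and> length l = r \<and> u l \<in> F 1) \<and> f - (\<Sum>l\<in>S. Lw l (u l)) \<in> F r"
  using assms
proof (induction rule: G_induct)
  case (base f)
  then show ?case by (intro exI[of _ "{}"]) simp
next
  case (word l z)
  then show ?case by (intro exI[of _ "{l}"] exI[of _ "\<lambda>_. z"]) (simp add: F_closed)
next
  case (add c f g)
  then obtain S u S' u' where
    f: "finite S" "\<forall>l\<in>S. desc l \<and> length l = r \<and> u l \<in> F 1" "f - (\<Sum>l\<in>S. Lw l (u l)) \<in> F r" and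
    g: "finite S'" "\<forall>l\<in>S'. desc l \<and> length l = r \<and> u' l \<in> F 1" "g - (\<Sum>l\<in>S'. Lw l (u' l)) \<in> F r" by blast
  define w where "w l = (if l \<in> S then c *\<^sub>c u l else 0) + (if l \<in> S' then u' l else 0)" for l
  have "(\<Sum>l\<in>S \<union> S'. Lw l (w l)) = (\<Sum>l\<in>S \<union> S'. Lw l (if l \<in> S then c *\<^sub>c u l else 0))
      + (\<Sum>l\<in>S \<union> S'. Lw l (if l \<in> S' then u' l else 0))"
    by (simp add: w_def Lw_lin sum.distrib)
  also have "(\<Sum>l\<in>S \<union> S'. Lw l (if l \<in> S then c *\<^sub>c u l else 0)) = c *\<^sub>c (\<Sum>l\<in>S. Lw l (u l))"
    unfolding pm_scale_sum Lw_lin(2)[symmetric]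
    using f(1) g(1) by (intro sum.mono_neutral_cong_right) (auto simp: Lw_lin(3))
  also have "(\<Sum>l\<in>S \<union> S'. Lw l (if l \<in> S' then u' l else 0)) = (\<Sum>l\<in>S'. Lw l (u' l))"
    using f(1) g(1) by (intro sum.mono_neutral_cong_right) (auto simp: Lw_lin(3))
  finally have "c *\<^sub>c f + g - (\<Sum>l\<in>S \<union> S'. Lw l (w l))
      = c *\<^sub>c (f - (\<Sum>l\<in>S. Lw l (u l))) + (g - (\<Sum>l\<in>S'. Lw l (u' l)))"
    by (simp add: pm_scale_diff)
  also have "\<dots> \<in> F r" using f g by (intro F_closed(2,3))
  finally have "c *\<^sub>c f + g - (\<Sum>l\<in>S \<union> S'. Lw l (w l)) \<in> F r" .
  moreover have "\<forall>l\<in>S \<union> S'. desc l \<and> length l = r \<and> w l \<in> F 1"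
    unfolding w_def using f(2) g(2) F_closed by auto
  ultimately show ?case using f(1) g(1) by (intro exI[of _ "S \<union> S'"] exI[of _ w]) auto
qed

text \<open>For the largest letter $L_{-i}$ occurring in the leading part, $M_{t+i}$ removes exactly one
  factor $L_{-i}$ from each leading term that contains it, and lowers all the other terms.\<close>

lemma L_descent:
  assumes N: "pm.subspace N" "K \<subseteq> N" and closed: "\<And>i f. i \<ge> 1 \<Longrightarrow> f \<in> N \<Longrightarrow> lmul (M_gen (int t + int i)) f \<in> N"
    and "finite S" "S \<noteq> {}" "\<And>l. l \<in> S \<Longrightarrow> desc l \<and> length l = r \<and> u l \<in> F 1 \<and> u l \<notin> K"
    and "f \<in> F r" "(\<Sum>l\<in>S. Lw l (u l)) + f \<in> N"
  shows "\<exists>z\<in>F 1. z \<in> N \<and> z \<notin> K"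
  using assms(4-)
proof (induction r arbitrary: S u f)
  case 0
  then have "S = {[]}" by auto
  then have "u [] + f \<in> N" "f \<in> N" using 0 N by (auto simp: F_0)
  then have "u [] \<in> N" using pm.subspace_diff[OF N(1), of "u [] + f" f] by simp
  then show ?case using 0(3)[of "[]"] \<open>S = {[]}\<close> by auto
next
  case (Suc r)
  \<comment> \<open>The lists are descending, so the maximum of the heads is the largest index in
    the whole leading part.\<close>
  define i where "i = Max (hd ` S)"
  have fin: "finite (hd ` S)" "hd ` S \<noteq> {}" using Suc by auto
  have "i \<in> hd ` S" unfolding i_def using fin by (rule Max_in)
  then obtain l0 where l0: "l0 \<in> S" "hd l0 = i" by auto
  then obtain l0' where l0': "l0 = i # l0'" using Suc.prems(3)[of l0] by (cases l0) auto
  have i: "i \<ge> 1" using Suc.prems(3)[OF l0(1)] l0' by simp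
  have hd_le: "hd l \<le> i" if "l \<in> S" for l unfolding i_def using fin that by simp
  obtain \<kappa> \<alpha> where k: "good \<kappa>" "\<alpha> \<noteq> 0"
    "\<And>f. f \<in> PV \<Longrightarrow> lmul (M_gen (int t + int i)) (lmul (L_gen (- int i)) f)
       \<doteq> lmul (L_gen (- int i)) (lmul (M_gen (int t + int i)) f) + \<alpha> *\<^sub>c Pk \<kappa> f"
    by (rule LM_lower[of "int i"]) (use i in simp, rule that)
  let ?D = "lmul (M_gen (int t + int i))"
  define S' where "S' = {l. i # l \<in> S}"
  have S': "finite S'" unfolding S'_def using Suc.prems(1) by (rule finite_vimageI[of S "(#) i", unfolded vimage_def]) simp
  have "\<forall>l\<in>S'. \<exists>m. ?D (Lw (i # l) (u (i # l))) - Lw l ((of_nat (Suc m) * \<alpha>) *\<^sub>c Pk \<kappa> (u (i # l))) \<in> F r"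
  proof
    fix l assume "l \<in> S'"
    then have *: "desc (i # l) \<and> length l = r \<and> u (i # l) \<in> F 1"
      using Suc.prems(3)[of "i # l"] by (simp add: S'_def)
    then show "\<exists>m. ?D (Lw (i # l) (u (i # l))) - Lw l ((of_nat (Suc m) * \<alpha>) *\<^sub>c Pk \<kappa> (u (i # l))) \<in> F r"
      using lower_equal[OF _ i _ k(3), of "u (i # l)" l] by blast
  qed
  then obtain m where m: "\<And>l. l \<in> S' \<Longrightarrow>
      ?D (Lw (i # l) (u (i # l))) - Lw l ((of_nat (Suc (m l)) * \<alpha>) *\<^sub>c Pk \<kappa> (u (i # l))) \<in> F r"
    by metis
  define u' where "u' l = (of_nat (Suc (m l)) * \<alpha>) *\<^sub>c Pk \<kappa> (u (i # l))" for l
  have im: "(#) i ` S' \<subseteq> S" by (auto simp: S'_def)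
  have rest: "?D (Lw l (u l)) \<in> F r" if l: "l \<in> S - (#) i ` S'" for l
  proof -
    obtain j l' where l': "l = j # l'" "length l' = r" using Suc.prems(3)[of l] l by (cases l) auto
    have "j \<noteq> i" using l l' by (auto simp: S'_def)
    then have "j < i" using hd_le[of l] l l' by auto
    then show ?thesis
      using lower_smaller[of "u l" i l] Suc.prems(3)[of l] l l' i by fastforce
  qed
  have "?D ((\<Sum>l\<in>S. Lw l (u l)) + f) - (\<Sum>l\<in>S'. Lw l (u' l)) \<in> F r"
  proof -
    have "(\<Sum>l\<in>S. ?D (Lw l (u l))) = (\<Sum>l\<in>S - (#) i ` S'. ?D (Lw l (u l))) + (\<Sum>l\<in>(#) i ` S'. ?D (Lw l (u l)))"
      using Suc.prems(1) im by (rule sum.subset_diff[rotated])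
    also have "(\<Sum>l\<in>(#) i ` S'. ?D (Lw l (u l))) = (\<Sum>l\<in>S'. ?D (Lw (i # l) (u (i # l))))"
      by (subst sum.reindex) (auto simp: inj_on_def)
    finally have "?D ((\<Sum>l\<in>S. Lw l (u l)) + f) - (\<Sum>l\<in>S'. Lw l (u' l))
      = (\<Sum>l\<in>S - (#) i ` S'. ?D (Lw l (u l))) + (\<Sum>l\<in>S'. ?D (Lw (i # l) (u (i # l))) - Lw l (u' l)) + ?D f"
      by (simp only: lmul_simps sum_subtractf) (simp add: algebra_simps)
    also have "\<dots> \<in> F r"
    proof (intro F_closed(2) pm.subspace_sum F_subspace rest)
      show "?D (Lw (i # l) (u (i # l))) - Lw l (u' l) \<in> F r" if "l \<in> S'" for l
        using m[OF that] by (simp add: u'_def)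
      show "?D f \<in> F r" using Suc.prems(4) i by (intro F_M_lower) auto
    qed
    finally show ?thesis .
  qed
  moreover have "(\<Sum>l\<in>S'. Lw l (u' l)) + (?D ((\<Sum>l\<in>S. Lw l (u l)) + f) - (\<Sum>l\<in>S'. Lw l (u' l))) \<in> N"
    using closed[OF i Suc.prems(5)] by simp
  moreover have "S' \<noteq> {}" using l0 l0' by (auto simp: S'_def)
  moreover have "desc l \<and> length l = r \<and> u' l \<in> F 1 \<and> u' l \<notin> K" if "l \<in> S'" for l
  proof -
    have *: "desc (i # l)" "length l = r" "u (i # l) \<in> F 1" "u (i # l) \<notin> K"
      using Suc.prems(3)[of "i # l"] that by (auto simp: S'_def)
    have "u' l \<notin> K" unfolding u'_def using k * injP_MQ
      by (intro injPD) (auto simp: F_1[symmetric] of_nat_Suc[symmetric] simp del: of_nat_Suc)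
    moreover have "u' l \<in> F 1" unfolding u'_def Pk_def using * by (intro F_closed F_MQ) auto
    ultimately show ?thesis using * by simp
  qed
  ultimately show ?case using S' by (intro Suc.IH[of S' u'])
qed

text \<open>At the least filtration level containing \<open>f\<close>, some coefficient of its
  ordered expansion is outside \<open>K\<close>, since otherwise \<open>f\<close> would lie one
  level lower. Terms with coefficient in \<open>K\<close> are moved to the remainder.\<close>

lemma L_lower:
  assumes N: "pm.subspace N" "K \<subseteq> N" and closed: "\<And>i f. i \<ge> 1 \<Longrightarrow> f \<in> N \<Longrightarrow> lmul (M_gen (int t + int i)) f \<in> N"
    and f: "f \<in> F r" "f \<in> N" "f \<notin> K"
  shows "\<exists>z\<in>F 1. z \<in> N \<and> z \<notin> K"
proof -
  define r0 where "r0 = (LEAST r. f \<in> F r)"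
  have r0: "f \<in> F r0" unfolding r0_def using f(1) by (rule LeastI)
  have "r0 \<noteq> 0" using r0 f(3) F_0 by metis
  then obtain s where s: "r0 = Suc s" by (cases r0) auto
  have "f \<notin> F s" using not_less_Least[of s "\<lambda>r. f \<in> F r"] s by (simp add: r0_def)
  obtain S u where S: "finite S" "\<forall>l\<in>S. desc l \<and> length l = s \<and> u l \<in> F 1" "f - (\<Sum>l\<in>S. Lw l (u l)) \<in> F s"
    using G_family[OF F_Suc_G[of f s]] r0 s by auto
  define S' where "S' = {l \<in> S. u l \<notin> K}"
  have "(\<Sum>l\<in>S. Lw l (u l)) = (\<Sum>l\<in>S - S'. Lw l (u l)) + (\<Sum>l\<in>S'. Lw l (u l))"
    using S(1) by (intro sum.subset_diff) (auto simp: S'_def)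
  moreover have "(\<Sum>l\<in>S - S'. Lw l (u l)) \<in> F s"
    by (intro pm.subspace_sum F_subspace K_F) (auto simp: S'_def Lw_def lmulw_K)
  ultimately have *: "f - (\<Sum>l\<in>S'. Lw l (u l)) \<in> F s"
    using F_closed(2)[OF S(3), of "\<Sum>l\<in>S - S'. Lw l (u l)"] by (simp add: algebra_simps)
  have "S' \<noteq> {}" using * \<open>f \<notin> F s\<close> by auto
  then show ?thesis
    using S * f(2) by (intro L_descent[OF N closed, of S' s u "f - (\<Sum>l\<in>S'. Lw l (u l))"]) (auto simp: S'_def)
qed

text \<open>A nonnegative $L_i$ is carried to the vector. Its commutator with $L_{-j}$ contains
  $L_{i-j}$, which is covered by the induction hypothesis if the index is nonnegative and is a
  letter of the alphabet otherwise.\<close>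

lemma L_pos_word:
  assumes "w \<in> lists all_letters" "v \<in> carrier V" "i \<ge> 0"
  shows "lmul (L_gen i) (pv w v) \<in> Sp (lists all_letters)"
  using assms
proof (induction w arbitrary: i)
  case Nil
  have "lmul (L_gen i) (pv [] v) \<doteq> pv [] (act V (gen (L_gen i)) v)"
    using Nil by (intro pv_act) auto
  moreover have "pv [] (act V (gen (L_gen i)) v) \<in> Sp (lists all_letters)"
    using Nil by (intro pv_Sp act_closed gen_in_span) auto
  ultimately show ?case by (rule Sp_eqv)
next
  case (Cons b w)
  let ?S = "Sp (lists all_letters)" and ?g = "pv w v"
  have g: "?g \<in> ?S" using Cons by (intro pv_Sp) auto
  have b: "b \<in> all_letters" using Cons by auto
  have bS: "lmul b f \<in> ?S" if "f \<in> ?S" "b \<in> all_letters" for f b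
    using that by (elim lmul_Sp) auto
  have IH: "lmul (L_gen i) ?g \<in> ?S" if "i \<ge> 0" for i using Cons that by auto
  have L: "lmul (L_gen i) ?g \<in> ?S" for i
    using IH[of i] bS[OF g, of "L_gen i"] by (cases "i \<ge> 0") auto
  have v: "?g \<in> PV" using Cons by simp
  from b have "lmul (L_gen i) (lmul b ?g) \<in> ?S"
  proof (rule all_letters_cases)
    assume "b \<in> MQ_set"
    then show ?thesis
    proof (rule MQ_set_cases)
      fix j assume b: "b = M_gen j"
      show ?thesis unfolding b
        by (rule Sp_eqv[OF comm_LM[OF v]], intro Sp_closed(2,3) bS g L) simp_all
    next
      fix j assume b: "b = Q_gen j"
      show ?thesis unfolding b
        by (rule Sp_eqv[OF comm_LQ[OF v]], intro Sp_closed(2,3) bS g L) simp_all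
    qed
  next
    fix j :: nat assume bj: "b = L_gen (- int j)" "j \<ge> 1"
    show ?thesis unfolding bj
      by (rule Sp_eqv[OF comm_LL[OF v]], intro Sp_closed(2,3) bS[of _ "L_gen (- int j)"] g L) (use bj in simp_all)
  qed
  then show ?case by simp
qed

lemma pv_all_letters: "v \<in> carrier V \<Longrightarrow> pv w v \<in> Sp (lists all_letters)"
proof (induction w)
  case Nil
  then show ?case by (intro pv_Sp) auto
next
  case (Cons b w)
  let ?S = "Sp (lists all_letters)"
  have g: "pv w v \<in> ?S" "pv w v \<in> PV" using Cons by auto
  have bS: "lmul b f \<in> ?S" if "f \<in> ?S" "b \<in> all_letters" for f b
    using that by (elim lmul_Sp) auto
  have "lmul b (pv w v) \<in> ?S"
  proof (cases b)
    case (L_gen i)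
    show ?thesis
    proof (cases "i < 0")
      case False
      show ?thesis unfolding L_gen
        using g(1) by (rule lmul_Sp_into) (use False L_pos_word in auto)
    qed (use L_gen bS[OF g(1), of "L_gen i"] in simp)
  next
    case c1_gen
    then show ?thesis using c1_eqv[OF g(2)] Sp_eqv g Sp_closed(3) by blast
  next
    case c2_gen
    then show ?thesis using c2_eqv[OF g(2)] Sp_eqv g Sp_closed(3) by blast
  qed (use bS[OF g(1), of b] in simp_all)
  then show ?case by simp
qed

lemma PV_F: 
  assumes "f \<in> PV"
  shows "\<exists>r. f \<in> F r"
proof -
  have "f \<in> Sp (lists all_letters)"
    using assms
  proof (induction rule: PV_induct)
    case (single c w v)
    then show ?case by (intro Sp_closed pv_all_letters)
  qed (auto simp: Sp_closed)
  then show ?thesis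
    unfolding F_def by (rule Sp_chain) auto
qed

lemma lower_to_V:
  assumes N: "pm.subspace N" "K \<subseteq> N" and closed: "\<And>b f. f \<in> N \<Longrightarrow> lmul b f \<in> N"
    and f: "f \<in> PV" "f \<in> N" "f \<notin> K"
  shows "\<exists>v\<in>carrier V. v \<noteq> \<zero>\<^bsub>V\<^esub> \<and> pv [] v \<in> N"
proof -
  obtain r where "f \<in> F r" using PV_F[OF f(1)] by blast
  then obtain z where z: "z \<in> Sp (lists MQ_set)" "z \<in> N" "z \<notin> K"
    using L_lower[OF N closed, of f r] f unfolding F_1 by blast
  then obtain J where "z \<in> Z J" using MQ_Z by blast
  then obtain y where y: "y \<in> Z 0" "y \<in> N" "y \<notin> K"
    using Z_lower_0[OF N closed] z by blast
  then obtain J' where "y \<in> Y J'" using M_all_Y[OF Z_0] by blast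
  then obtain x where x: "x \<in> Y 0" "x \<in> N" "x \<notin> K"
    using Y_lower_0[OF N closed] y by blast
  obtain v where v: "v \<in> carrier V" "x \<doteq> pv [] v" using Y_0[OF x(1)] by blast
  then have "pv [] v \<in> N" "pv [] v \<notin> K" using x eqv_mem[OF _ N] eqv_K by blast+
  then have "v \<noteq> \<zero>\<^bsub>V\<^esub>" using pv_zero[of "[]"] by auto
  with \<open>pv [] v \<in> N\<close> v(1) show ?thesis by blast
qed

end

section \<open>The induced module is the quotient by the relations\<close>

lemma pm_induct [case_names zero add single]:
  fixes z :: "'k \<Rightarrow>\<^sub>0 complex"
  assumes "P 0" "\<And>x y. P x \<Longrightarrow> P y \<Longrightarrow> P (x + y)" "\<And>c k. P (Poly_Mapping.single k c)"
  shows "P z"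
  using subset_UNIV by (induction rule: keys_induct) (use assms in auto)

lemma tensor_ring_ring: "ring tensor_ring"
proof -
  have "\<exists>y. x + y = 0" for x :: tensor_alg
    using add.right_inverse by blast
  then show ?thesis
    unfolding ring_of_type_algebra_def using add.right_inverse
    by unfold_locales (auto simp: algebra_simps Units_def)
qed

lemma complex_ring_cring: "cring complex_ring"
  by (rule cring_from_type_algebra)

lemma env_ideal_ideal: "ideal env_ideal tensor_ring"
  unfolding env_ideal_def by (rule ring.genideal_ideal[OF tensor_ring_ring]) simp

lemma env_ideal_closed: "0 \<in> env_ideal" "a \<in> env_ideal \<Longrightarrow> b \<in> env_ideal \<Longrightarrow> a + b \<in> env_ideal"
    "a \<in> env_ideal \<Longrightarrow> x * a \<in> env_ideal" "a \<in> env_ideal \<Longrightarrow> a * x \<in> env_ideal"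
  using additive_subgroup.zero_closed[OF ideal.axioms(1)[OF env_ideal_ideal]]
    additive_subgroup.a_closed[OF ideal.axioms(1)[OF env_ideal_ideal], of a b]
    ideal.I_l_closed[OF env_ideal_ideal, of a x] ideal.I_r_closed[OF env_ideal_ideal, of a x]
  by simp_all

lemma env_ideal_uminus: "a \<in> env_ideal \<Longrightarrow> - a \<in> env_ideal"
  using env_ideal_closed(3)[of a "-1"] by simp

lemma env_class_mem: "x \<in> env_class a \<longleftrightarrow> x - a \<in> env_ideal"
proof -
  have "x \<in> env_class a \<longleftrightarrow> (\<exists>h\<in>env_ideal. x = h + a)"
    by (auto simp: env_class_def a_r_coset_def')
  also have "\<dots> \<longleftrightarrow> x - a \<in> env_ideal"
    by (metis add_diff_cancel diff_add_cancel)
  finally show ?thesis .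
qed

lemma env_class_eq: "env_class a = env_class b \<longleftrightarrow> a - b \<in> env_ideal"
proof
  assume "env_class a = env_class b"
  then have "a \<in> env_class b" using env_class_mem[of a a] env_ideal_closed(1) by simp
  then show "a - b \<in> env_ideal" by (simp add: env_class_mem)
next
  assume *: "a - b \<in> env_ideal"
  have "x - a \<in> env_ideal \<longleftrightarrow> x - b \<in> env_ideal" for x
    using env_ideal_closed(2)[OF _ *, of "x - a"] env_ideal_closed(2)[OF _ env_ideal_uminus[OF *], of "x - b"]
    by auto
  then show "env_class a = env_class b" by (auto simp: env_class_mem)
qed

lemma env_ops: "env_class a \<oplus>\<^bsub>env\<^esub> env_class b = env_class (a + b)"
    "env_class a \<otimes>\<^bsub>env\<^esub> env_class b = env_class (a * b)"
  using ideal.rcos_ring_hom[OF env_ideal_ideal] unfolding env_def env_class_def ring_hom_def by simp_all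

lemma env_carrier: "carrier env = range env_class"
  by (auto simp: env_def FactRing_def A_RCOSETS_def' env_class_def)

lemma env_carrier_closed [simp]: "env_class a \<in> carrier env"
  by (simp add: env_carrier)

lemma pm_scale_mult_left: "(c *\<^sub>c a) * (b :: tensor_alg) = c *\<^sub>c (a * b)"
  unfolding pm_scale_def mult_map_scale_conv_mult by (rule mult.assoc)

lemma tensor_const_mult: "tensor_const c * a = c *\<^sub>c a"
  unfolding pm_scale_def mult_map_scale_conv_mult tensor_const_def zero_list_def ..

lemma mult_words: "Poly_Mapping.single w c * Poly_Mapping.single w' d = (Poly_Mapping.single (w @ w') (c * d) :: tensor_alg)"
  by (simp add: mult_single plus_list_def)

lemma pm_scale_mult_right: "(a :: tensor_alg) * (c *\<^sub>c b) = c *\<^sub>c (a * b)"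
proof -
  have "a * tensor_const c = c *\<^sub>c a"
    by (induction a rule: pm_induct)
       (auto simp: distrib_right pm_scale_add_right tensor_const_def mult_words mult.commute)
  then show ?thesis
    by (metis mult.assoc tensor_const_mult pm_scale_mult_left)
qed

definition tens :: "tensor_alg \<Rightarrow> 'v \<Rightarrow> 'v word_space" where
  "tens a v = lin (\<lambda>w. pv w v) a"

lemma tens_simps: "tens (a + b) v = tens a v + tens b v" "tens (c *\<^sub>c a) v = c *\<^sub>c tens a v"
    "tens 0 v = 0" "tens (a - b) v = tens a v - tens b v" "tens (lin h z) v = lin (\<lambda>k. tens (h k) v) z"
  by (simp_all add: tens_def lin_add lin_scale lin_diff lin_lin)

lemma tens_uminus: "tens (- a) v = - tens a v"
  by (simp add: tens_def lin_uminus)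

lemma tens_single [simp]: "tens (Poly_Mapping.single w c) v = Poly_Mapping.single (w, v) c"
  by (simp add: tens_def)

lemma tens_mult: "tens (a * b) v = lin (\<lambda>w. lmulw w (tens b v)) a"
proof (induction a rule: pm_induct)
  case (single c w)
  show ?case
  proof (induction b rule: pm_induct)
    case (single d w')
    then show ?case by (simp add: mult_words mult.commute)
  qed (simp_all add: distrib_left tens_simps lmulw_lin pm_scale_add_right)
qed (simp_all add: distrib_right tens_simps lin_add)

lemma tensor_emb_lin: "tensor_emb x = lin (\<lambda>b. Poly_Mapping.single [b] 1) x"
  by (simp add: tensor_emb_def lin_def)

definition lmulx :: "bms \<Rightarrow> 'v word_space \<Rightarrow> 'v word_space" where
  "lmulx x f = lin (\<lambda>b. lmul b f) x"

lemma tens_emb_mult: "tens (tensor_emb x * a) v = lmulx x (tens a v)"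
  by (simp add: tens_mult tensor_emb_lin lmulx_def lin_lin)

lemma lmulx_simps:
  "lmulx x (f + g) = lmulx x f + lmulx x g" "lmulx x (c *\<^sub>c f) = c *\<^sub>c lmulx x f" "lmulx x 0 = 0"
  "lmulx x (f - g) = lmulx x f - lmulx x g" "lmulx (x + y) f = lmulx x f + lmulx y f"
  "lmulx (c *\<^sub>c x) f = c *\<^sub>c lmulx x f" "lmulx (gen b) f = lmul b f" "lmulx 0 f = 0"
  by (simp_all add: lmulx_def lmul_simps lin_fun_add lin_fun_scale lin_fun_diff lin_add lin_scale)
     (simp add: lin_def)

lemma free_space_module: "module complex_ring (free_space S)"
proof (rule moduleI)
  show "abelian_group (free_space S)"
  proof (rule abelian_groupI)
    fix x assume "x \<in> carrier (free_space S)"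
    then show "\<exists>y\<in>carrier (free_space S). y \<oplus>\<^bsub>free_space S\<^esub> x = \<zero>\<^bsub>free_space S\<^esub>"
      by (intro bexI[of _ "- x"]) (auto simp: free_space_def in_keys_iff)
  qed (auto simp: free_space_def algebra_simps dest!: subsetD[OF keys_add])
qed (auto simp: free_space_def complex_ring_cring pm_scale_add_left pm_scale_add_right
     dest!: subsetD[OF keys_pm_scale])

lemma free_space_submodule:
  "submodule H complex_ring (free_space S) \<longleftrightarrow> pm.subspace H \<and> H \<subseteq> carrier (free_space S)"
proof
  interpret module complex_ring "free_space S" by (rule free_space_module)
  {
    assume H: "submodule H complex_ring (free_space S)"
    interpret H: submodule H complex_ring "free_space S" by (rule H)
    show "pm.subspace H \<and> H \<subseteq> carrier (free_space S)"
      using H.one_closed H.m_closed H.smult_closed H.subset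
      by (auto intro!: pm.subspaceI simp: free_space_def)
  }
  assume H: "pm.subspace H \<and> H \<subseteq> carrier (free_space S)"
  have inv: "\<ominus>\<^bsub>free_space S\<^esub> a = - a" if "a \<in> carrier (free_space S)" for a
    using that by (intro minus_equality) (auto simp: free_space_def in_keys_iff)
  show "submodule H complex_ring (free_space S)"
  proof (rule submoduleI)
    fix a assume "a \<in> H"
    then show "\<ominus>\<^bsub>free_space S\<^esub> a \<in> H" using H inv[of a] pm.subspace_neg[of H a] by auto
  qed (use H pm.subspace_0 pm.subspace_add pm.subspace_scale in \<open>auto simp: free_space_def\<close>)
qed

section \<open>Comparison of the tensor product with words modulo relations\<close>

context ind_mod
begin

lemma tens_PV [simp]: "v \<in> carrier V \<Longrightarrow> tens a v \<in> PV"
  unfolding tens_def by (rule lin_in_subspace[OF PV_subspace]) simp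

text \<open>The ideal is generated by relations for arbitrary homogeneous elements, whereas
  \<open>K\<close> has them for basis vectors inside a word; expanding \<open>a\<close>,
  \<open>x\<close>, \<open>y\<close> and \<open>c\<close> linearly reduces the former to the
  latter.\<close>

lemma tens_gens:
  assumes v: "v \<in> carrier V" and xy: "bms_homogeneous p x" "bms_homogeneous r y"
  shows "tens (a * (tensor_emb x * tensor_emb y - ksign p r *\<^sub>c (tensor_emb y * tensor_emb x)
        - tensor_emb (bms_bracket x y)) * c) v \<in> K"
proof -
  define E where "E x y = tensor_emb x * tensor_emb y - ksign p r *\<^sub>c (tensor_emb y * tensor_emb x)
        - tensor_emb (bms_bracket x y)" for x y
  have E_add: "E (x + x') y = E x y + E x' y" "E x (y + y') = E x y + E x y'" for x x' y y'
    by (simp_all add: E_def tensor_emb_lin lin_add bms_bracket_add_left bms_bracket_add_right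
        distrib_left distrib_right pm_scale_add_right)
  have E_zero: "E 0 y = 0" "E x 0 = 0" for x y
    by (simp_all add: E_def tensor_emb_lin)
  have keys: "Poly_Mapping.keys x \<subseteq> {b. parity b = p}" "Poly_Mapping.keys y \<subseteq> {b. parity b = r}"
    using xy by (auto simp: bms_homogeneous_def)
  have w: "tens (Poly_Mapping.single w 1 * E x y * Poly_Mapping.single w' 1) v \<in> K" for w w'
    using keys(1)
  proof (induction rule: keys_induct)
    case b: (single d b)
    show ?case
      using keys(2)
    proof (induction rule: keys_induct)
      case (single d' b')
      let ?r = "pv (w @ b # b' # w') v - ksign p r *\<^sub>c pv (w @ b' # b # w') v
         - lin (\<lambda>e. pv (w @ e # w') v) (basis_bracket b b')"
      have "tens (Poly_Mapping.single w 1 * tensor_emb z * Poly_Mapping.single w' 1) v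
          = lin (\<lambda>e. pv (w @ e # w') v) z" for z
        by (induction z rule: pm_induct)
           (simp_all add: tensor_emb_lin lin_add distrib_left distrib_right tens_simps mult_words)
      then have "tens (Poly_Mapping.single w 1 * E (Poly_Mapping.single b d) (Poly_Mapping.single b' d')
         * Poly_Mapping.single w' 1) v = (d * d') *\<^sub>c ?r"
        by (simp add: E_def right_diff_distrib left_diff_distrib tens_simps pm_scale_diff
            tensor_emb_lin lin_scale mult_words pm_scale_mult_left pm_scale_mult_right mult_ac)
      moreover have "?r \<in> K" using K_rels(3)[OF v, of w b b' w'] b single by simp
      ultimately show ?case using K_closed(3) by simp
    qed (simp_all add: E_add E_zero distrib_left distrib_right tens_simps K_closed)
  qed (simp_all add: E_add E_zero distrib_left distrib_right tens_simps K_closed)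
  have w2: "tens (Poly_Mapping.single w 1 * E x y * c) v \<in> K" for w
  proof (induction c rule: pm_induct)
    case (single d w')
    then show ?case
      using K_closed(3)[OF w[of w w'], of d] pm_scale_mult_right[of "Poly_Mapping.single w 1 * E x y" d "Poly_Mapping.single w' 1"]
      by (simp add: tens_simps)
  qed (simp_all add: distrib_left tens_simps K_closed)
  have "tens (a * E x y * c) v \<in> K"
  proof (induction a rule: pm_induct)
    case (single d w)
    then show ?case
      using K_closed(3)[OF w2[of w], of d] pm_scale_mult_left[of d "Poly_Mapping.single w 1"]
      by (simp add: tens_simps mult.assoc pm_scale_mult_left)
  qed (simp_all add: distrib_right tens_simps K_closed)
  then show ?thesis by (simp add: E_def)
qed

text \<open>The elements all of whose two-sided multiples map into \<open>K\<close> form an ideal;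
  it contains the generators by \<open>tens_gens\<close>, hence the whole of
  \<open>env_ideal\<close>.\<close>

lemma tens_env_ideal:
  assumes "x \<in> env_ideal" "v \<in> carrier V"
  shows "tens x v \<in> K"
proof -
  interpret R: ring tensor_ring by (rule tensor_ring_ring)
  let ?J = "{x. \<forall>a c. \<forall>v\<in>carrier V. tens (a * x * c) v \<in> K}"
  have "ideal ?J tensor_ring"
  proof (rule idealI[OF tensor_ring_ring])
    have inv: "\<ominus>\<^bsub>tensor_ring\<^esub> x = - x" for x by (rule R.minus_equality) simp_all
    have J: "0 \<in> ?J" "x \<in> ?J \<Longrightarrow> y \<in> ?J \<Longrightarrow> x + y \<in> ?J" "x \<in> ?J \<Longrightarrow> - x \<in> ?J" for x y
      using tens_simps(2)[of "-1"] K_closed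
      by (auto simp: distrib_left distrib_right tens_simps tens_uminus)
    show "subgroup ?J (add_monoid tensor_ring)"
    proof (rule R.add.subgroupI)
      show "?J \<noteq> {}" using J(1) by blast
      show "\<ominus>\<^bsub>tensor_ring\<^esub> x \<in> ?J" if "x \<in> ?J" for x
        using J(3)[OF that] unfolding inv .
    qed (use J in auto)
    show "y \<otimes>\<^bsub>tensor_ring\<^esub> x \<in> ?J" if "x \<in> ?J" "y \<in> carrier tensor_ring" for x y
    proof -
      have "tens (a * y * x * c) v \<in> K" if "v \<in> carrier V" for a c v
        using \<open>x \<in> ?J\<close> that by blast
      then show ?thesis by (simp add: mult.assoc)
    qed
    show "x \<otimes>\<^bsub>tensor_ring\<^esub> y \<in> ?J" if "x \<in> ?J" "y \<in> carrier tensor_ring" for x y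
    proof -
      have "tens (a * x * (y * c)) v \<in> K" if "v \<in> carrier V" for a c v
        using \<open>x \<in> ?J\<close> that by blast
      then show ?thesis by (simp add: mult.assoc)
    qed
  qed
  then have "env_ideal \<subseteq> ?J"
    unfolding env_ideal_def using tens_gens by (intro R.genideal_minimal) auto
  then have "tens (1 * x * 1) v \<in> K" using assms by blast
  then show ?thesis by simp
qed

lemma tens_cong: "env_class a = env_class b \<Longrightarrow> v \<in> carrier V \<Longrightarrow> tens a v \<doteq> tens b v"
  using tens_env_ideal[of "a - b" v] by (simp add: env_class_eq eqv_def tens_simps)

definition pre_space :: "('a pre_tensor) set" where
  "pre_space = {f. Poly_Mapping.keys f \<subseteq> carrier env \<times> carrier V}"

lemma pre_space_carrier: "carrier (pre_tensor_space V) = pre_space"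
  by (simp add: pre_tensor_space_def free_space_def pre_space_def)

lemma pre_space_subspace: "pm.subspace pre_space"
  by (rule pm.subspaceI)
     (auto simp: pre_space_def dest!: subsetD[OF keys_add] subsetD[OF keys_pm_scale])

lemma pre_space_single: "u \<in> carrier env \<Longrightarrow> v \<in> carrier V \<Longrightarrow> Poly_Mapping.single (u, v) c \<in> pre_space"
  by (auto simp: pre_space_def)

lemma pre_space_induct [consumes 1, case_names zero add pure]:
  assumes "f \<in> pre_space" "P 0" "\<And>f g. f \<in> pre_space \<Longrightarrow> g \<in> pre_space \<Longrightarrow> P f \<Longrightarrow> P g \<Longrightarrow> P (f + g)"
    "\<And>c a v. v \<in> carrier V \<Longrightarrow> P (c *\<^sub>c pure (env_class a) v)"
  shows "P f"
proof -
  from assms(1) have "Poly_Mapping.keys f \<subseteq> carrier env \<times> carrier V" by (simp add: pre_space_def)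
  then show ?thesis
    by (induction rule: keys_induct) (use assms(2-) in \<open>auto simp: pre_space_def env_carrier\<close>)
qed

lemma wact_lists: "w \<in> lists B \<Longrightarrow> v \<in> carrier V \<Longrightarrow> wact w v \<in> carrier V"
  by (rule wact_closed) auto

lemma tensor_act_closed: "b \<in> sub_tensor B \<Longrightarrow> v \<in> carrier V \<Longrightarrow> tensor_act V b v \<in> carrier V"
  unfolding tensor_act_def sub_tensor_def wact_def[symmetric]
  by (intro V.M.finsum_closed funcsetI smult_in wact_lists) auto

abbreviation (input) TR where "TR \<equiv> tensor_relations B V"

lemma tensor_relations_pre_space: "TR \<subseteq> pre_space"
proof -
  note closed = pm.subspace_diff[OF pre_space_subspace] pm.subspace_scale[OF pre_space_subspace] pre_space_single
  show ?thesis
    unfolding tensor_relations_def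
    by (intro Un_least subsetI; elim CollectE exE conjE; hypsubst; intro closed;
        auto simp: env_carrier env_ops tensor_act_closed)
qed

lemma tensor_kernel_span: "tensor_kernel B V = pm.span TR"
proof -
  have "submodule H complex_ring (pre_tensor_space V) \<longleftrightarrow> pm.subspace H \<and> H \<subseteq> pre_space" for H
    unfolding pre_tensor_space_def free_space_submodule
    by (simp add: free_space_def pre_space_def)
  moreover have "pm.span TR \<subseteq> pre_space"
    using tensor_relations_pre_space pre_space_subspace by (rule pm.span_minimal)
  ultimately show ?thesis
    unfolding tensor_kernel_def
    by (auto intro: pm.span_base dest: pm.span_minimal[THEN subsetD, rotated 2])
qed

abbreviation (input) TK where "TK \<equiv> tensor_kernel B V"

lemma TK_closed: "0 \<in> TK" "x \<in> TK \<Longrightarrow> y \<in> TK \<Longrightarrow> x + y \<in> TK" "x \<in> TK \<Longrightarrow> c *\<^sub>c x \<in> TK"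
    "x \<in> TK \<Longrightarrow> y \<in> TK \<Longrightarrow> x - y \<in> TK" "x \<in> TK \<Longrightarrow> - x \<in> TK"
  by (simp_all add: tensor_kernel_span pm.span_zero pm.span_add pm.span_scale pm.span_diff pm.span_neg)

lemma TK_pre_space: "TK \<subseteq> pre_space"
  unfolding tensor_kernel_span using tensor_relations_pre_space pre_space_subspace by (rule pm.span_minimal)

lemma TK_rels:
  "v \<in> carrier V \<Longrightarrow> pure (env_class (a + b)) v - pure (env_class a) v - pure (env_class b) v \<in> TK"
  "v \<in> carrier V \<Longrightarrow> v' \<in> carrier V \<Longrightarrow>
     pure (env_class a) (v \<oplus>\<^bsub>V\<^esub> v') - pure (env_class a) v - pure (env_class a) v' \<in> TK"
  "v \<in> carrier V \<Longrightarrow> pure (env_class (c *\<^sub>c a)) v - c *\<^sub>c pure (env_class a) v \<in> TK"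
  "v \<in> carrier V \<Longrightarrow> pure (env_class a) (c \<odot>\<^bsub>V\<^esub> v) - c *\<^sub>c pure (env_class a) v \<in> TK"
  "v \<in> carrier V \<Longrightarrow> b \<in> sub_tensor B \<Longrightarrow>
     pure (env_class (a * b)) v - pure (env_class a) (tensor_act V b v) \<in> TK"
proof -
  assume v: "v \<in> carrier V"
  note base = pm.span_base[of _ TR, folded tensor_kernel_span]
  have ec: "env_class x \<in> carrier env" for x by simp
  show "pure (env_class (a + b)) v - pure (env_class a) v - pure (env_class b) v \<in> TK"
    unfolding env_ops[symmetric] by (rule base) (use v ec in \<open>unfold tensor_relations_def, blast\<close>)
  show "pure (env_class (c *\<^sub>c a)) v - c *\<^sub>c pure (env_class a) v \<in> TK"
    unfolding tensor_const_mult[symmetric] env_ops[symmetric]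
    by (rule base) (use v ec in \<open>unfold tensor_relations_def, blast\<close>)
  show "pure (env_class a) (c \<odot>\<^bsub>V\<^esub> v) - c *\<^sub>c pure (env_class a) v \<in> TK"
    by (rule base) (use v ec in \<open>unfold tensor_relations_def, blast\<close>)
  show "pure (env_class (a * b)) v - pure (env_class a) (tensor_act V b v) \<in> TK" if "b \<in> sub_tensor B"
    unfolding env_ops[symmetric] by (rule base) (use v ec that in \<open>unfold tensor_relations_def, blast\<close>)
  show "pure (env_class a) (v \<oplus>\<^bsub>V\<^esub> v') - pure (env_class a) v - pure (env_class a) v' \<in> TK" if "v' \<in> carrier V"
    by (rule base) (use v ec that in \<open>unfold tensor_relations_def, blast\<close>)
qed

lemma TK_induct [consumes 1, case_names zero add scale rel1 rel2 rel3 rel4 rel5]: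
  assumes f: "f \<in> TK" and P: "P 0" "\<And>f g. P f \<Longrightarrow> P g \<Longrightarrow> P (f + g)" "\<And>c f. P f \<Longrightarrow> P (c *\<^sub>c f)"
    and rel: "\<And>a b v. v \<in> carrier V \<Longrightarrow> P (pure (env_class (a + b)) v - pure (env_class a) v - pure (env_class b) v)"
    "\<And>a v v'. v \<in> carrier V \<Longrightarrow> v' \<in> carrier V \<Longrightarrow>
       P (pure (env_class a) (v \<oplus>\<^bsub>V\<^esub> v') - pure (env_class a) v - pure (env_class a) v')"
    "\<And>a c v. v \<in> carrier V \<Longrightarrow> P (pure (env_class (c *\<^sub>c a)) v - c *\<^sub>c pure (env_class a) v)"
    "\<And>a c v. v \<in> carrier V \<Longrightarrow> P (pure (env_class a) (c \<odot>\<^bsub>V\<^esub> v) - c *\<^sub>c pure (env_class a) v)"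
    "\<And>a b v. v \<in> carrier V \<Longrightarrow> b \<in> sub_tensor B \<Longrightarrow>
       P (pure (env_class (a * b)) v - pure (env_class a) (tensor_act V b v))"
  shows "P f"
  using f unfolding tensor_kernel_span
proof (induction rule: pm.span_induct_alt)
  case base
  show ?case by (rule P)
next
  case (step c x y)
  have "P x"
    using step(1) unfolding tensor_relations_def
  proof (elim UnE CollectE exE conjE)
    fix u u' v
    assume *: "x = pure (u \<oplus>\<^bsub>env\<^esub> u') v - pure u v - pure u' v"
      "u \<in> carrier env" "u' \<in> carrier env" "v \<in> carrier V"
    then obtain a a' where "u = env_class a" "u' = env_class a'" by (auto simp: env_carrier)
    with * show ?thesis using rel(1) by (simp add: env_ops)
  next
    fix u v v'
    assume *: "x = pure u (v \<oplus>\<^bsub>V\<^esub> v') - pure u v - pure u v'"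
      "u \<in> carrier env" "v \<in> carrier V" "v' \<in> carrier V"
    then obtain a where "u = env_class a" by (auto simp: env_carrier)
    with * show ?thesis using rel(2) by simp
  next
    fix c u v
    assume *: "x = pure (env_class (tensor_const c) \<otimes>\<^bsub>env\<^esub> u) v - c *\<^sub>c pure u v"
      "u \<in> carrier env" "v \<in> carrier V"
    then obtain a where "u = env_class a" by (auto simp: env_carrier)
    with * show ?thesis using rel(3)[of v c a] by (simp add: env_ops tensor_const_mult)
  next
    fix c u v
    assume *: "x = pure u (c \<odot>\<^bsub>V\<^esub> v) - c *\<^sub>c pure u v" "u \<in> carrier env" "v \<in> carrier V"
    then obtain a where "u = env_class a" by (auto simp: env_carrier)
    with * show ?thesis using rel(4)[of v a c] by simp
  next
    fix u a v
    assume *: "x = pure (u \<otimes>\<^bsub>env\<^esub> env_class a) v - pure u (tensor_act V a v)"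
      "u \<in> carrier env" "a \<in> sub_tensor B" "v \<in> carrier V"
    then obtain a' where "u = env_class a'" by (auto simp: env_carrier)
    with * show ?thesis using rel(5) by (simp add: env_ops)
  qed
  then show ?case using step by (intro P)
qed

text \<open>The choice of a representative makes \<open>T\<close> well defined only modulo \<open>K\<close>.\<close>

definition T :: "'a pre_tensor \<Rightarrow> 'a word_space" where
  "T = lin (\<lambda>(u, v). tens (SOME a. env_class a = u) v)"

text \<open>Inverse to \<open>T\<close> up to \<open>K\<close> and \<open>TK\<close>
  (\<open>T_jm\<close>, \<open>jm_T\<close>). The two maps identify the coset space of the
  definition with words modulo \<open>K\<close>, where multiplication from the left is
  concatenation.\<close>

definition jm :: "'a word_space \<Rightarrow> 'a pre_tensor" where
  "jm = lin (\<lambda>(w, v). pure (env_class (Poly_Mapping.single w 1)) v)"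

lemma T_simps: "T (f + g) = T f + T g" "T (c *\<^sub>c f) = c *\<^sub>c T f" "T 0 = 0" "T (f - g) = T f - T g"
  by (simp_all add: T_def lin_add lin_scale lin_diff)

lemma jm_simps: "jm (f + g) = jm f + jm g" "jm (c *\<^sub>c f) = c *\<^sub>c jm f" "jm 0 = 0" "jm (f - g) = jm f - jm g"
    "jm (Poly_Mapping.single (w, v) c) = Poly_Mapping.single (env_class (Poly_Mapping.single w 1), v) c"
  by (simp_all add: jm_def lin_add lin_scale lin_diff)

lemma T_pure:
  assumes "v \<in> carrier V"
  shows "T (pure (env_class a) v) \<doteq> tens a v"
proof -
  have "env_class (SOME b. env_class b = env_class a) = env_class a"
    by (rule someI[of _ a]) simp
  from tens_cong[OF this assms] show ?thesis by (simp add: T_def)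
qed

lemma jm_pre_space: "f \<in> PV \<Longrightarrow> jm f \<in> pre_space"
  by (induction rule: PV_induct)
     (auto simp: jm_simps pre_space_single pm.subspace_add[OF pre_space_subspace] pm.subspace_0[OF pre_space_subspace])

lemma T_PV: "f \<in> pre_space \<Longrightarrow> T f \<in> PV"
proof (induction rule: pre_space_induct)
  case (pure c a v)
  then have "tens (SOME b. env_class b = env_class a) v \<in> PV" by simp
  then show ?case by (simp add: T_def)
qed (simp_all add: T_simps)

lemma pure_tens:
  assumes v: "v \<in> carrier V"
  shows "pure (env_class a) v - jm (tens a v) \<in> TK"
proof (induction a rule: pm_induct)
  case zero
  show ?case using TK_rels(3)[OF v, of 0 0] by (simp add: tens_simps jm_simps)
next
  case (add x y)
  from TK_closed(2)[OF TK_rels(1)[OF v, of x y] TK_closed(2)[OF add]] show ?case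
    by (simp add: tens_simps jm_simps algebra_simps)
next
  case (single c w)
  show ?case using TK_rels(3)[OF v, of c "Poly_Mapping.single w 1"] by (simp add: jm_simps)
qed

lemma tens_lin_right:
  assumes "v \<in> carrier V" "v' \<in> carrier V"
  shows "tens a (v \<oplus>\<^bsub>V\<^esub> v') \<doteq> tens a v + tens a v'" "tens a (c \<odot>\<^bsub>V\<^esub> v) \<doteq> c *\<^sub>c tens a v"
proof -
  have "tens a (v \<oplus>\<^bsub>V\<^esub> v') - tens a v - tens a v' \<in> K"
    unfolding tens_def lin_fun_diff[symmetric] by (rule lin_in_subspace[OF K_subspace]) (rule K_rels(1)[OF assms])
  then show "tens a (v \<oplus>\<^bsub>V\<^esub> v') \<doteq> tens a v + tens a v'" by (simp add: eqv_def algebra_simps)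
  have "tens a (c \<odot>\<^bsub>V\<^esub> v) - c *\<^sub>c tens a v \<in> K"
    unfolding tens_def lin_fun_diff[symmetric] lin_fun_scale[symmetric]
    by (rule lin_in_subspace[OF K_subspace]) (rule K_rels(2)[OF assms(1)])
  then show "tens a (c \<odot>\<^bsub>V\<^esub> v) \<doteq> c *\<^sub>c tens a v" by (simp add: eqv_def)
qed

text \<open>Balancedness on the side of words: the letters of \<open>B\<close> cross to the vector
  one by one, by the last family in \<open>rels\<close>.\<close>

lemma tens_sub_tensor:
  assumes b: "b \<in> sub_tensor B" and v: "v \<in> carrier V"
  shows "tens b v \<doteq> pv [] (tensor_act V b v)"
proof -
  have "(\<Sum>w\<in>A. Poly_Mapping.lookup b w *\<^sub>c pv w v) \<doteq>
      pv [] (\<Oplus>\<^bsub>V\<^esub>w\<in>A. Poly_Mapping.lookup b w \<odot>\<^bsub>V\<^esub> wact w v)"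
    if "finite A" "A \<subseteq> lists B" for A
    using that
  proof (induction A)
    case empty
    show ?case using pv_zero[of "[]"] by (simp add: eqv_def K_closed(5))
  next
    case (insert w A)
    have w: "wact w v \<in> carrier V" using insert v by (intro wact_closed) auto
    have s: "(\<Oplus>\<^bsub>V\<^esub>w\<in>A. Poly_Mapping.lookup b w \<odot>\<^bsub>V\<^esub> wact w v) \<in> carrier V"
      using insert v by (intro V.M.finsum_closed funcsetI smult_in wact_lists) auto
    let ?c = "Poly_Mapping.lookup b w"
    have "?c *\<^sub>c pv w v \<doteq> ?c *\<^sub>c pv [] (wact w v)"
      using insert v by (intro eqv_scale pv_wact) auto
    also have "\<dots> \<doteq> pv [] (?c \<odot>\<^bsub>V\<^esub> wact w v)"
      using w by (intro eqv_sym[OF pv_smult])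
    finally have "?c *\<^sub>c pv w v + (\<Sum>w\<in>A. Poly_Mapping.lookup b w *\<^sub>c pv w v)
       \<doteq> pv [] (?c \<odot>\<^bsub>V\<^esub> wact w v) + pv [] (\<Oplus>\<^bsub>V\<^esub>w\<in>A. Poly_Mapping.lookup b w \<odot>\<^bsub>V\<^esub> wact w v)"
      using insert by (intro eqv_add) auto
    also have "\<dots> \<doteq> pv [] (?c \<odot>\<^bsub>V\<^esub> wact w v \<oplus>\<^bsub>V\<^esub> (\<Oplus>\<^bsub>V\<^esub>w\<in>A. Poly_Mapping.lookup b w \<odot>\<^bsub>V\<^esub> wact w v))"
      using w s by (intro eqv_sym[OF pv_add]) auto
    also have "?c \<odot>\<^bsub>V\<^esub> wact w v \<oplus>\<^bsub>V\<^esub> (\<Oplus>\<^bsub>V\<^esub>w\<in>A. Poly_Mapping.lookup b w \<odot>\<^bsub>V\<^esub> wact w v)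
        = (\<Oplus>\<^bsub>V\<^esub>w\<in>insert w A. Poly_Mapping.lookup b w \<odot>\<^bsub>V\<^esub> wact w v)"
      using insert w v by (subst V.M.finsum_insert) (auto intro!: smult_in wact_lists)
    finally show ?case using insert by simp
  qed
  from this[of "Poly_Mapping.keys b"] b show ?thesis
    by (simp add: tens_def lin_def tensor_act_def sub_tensor_def wact_def)
qed

lemma T_TK: "f \<in> TK \<Longrightarrow> T f \<in> K"
proof (induction rule: TK_induct)
  case (rel1 a b v)
  have "T (pure (env_class (a + b)) v - pure (env_class a) v - pure (env_class b) v)
     \<doteq> tens (a + b) v - tens a v - tens b v"
    unfolding T_simps by (intro eqv_diff T_pure rel1)
  then show ?case by (simp add: tens_simps eqv_zero)
next
  case (rel2 a v v')
  have "T (pure (env_class a) (v \<oplus>\<^bsub>V\<^esub> v') - pure (env_class a) v - pure (env_class a) v')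
     \<doteq> tens a (v \<oplus>\<^bsub>V\<^esub> v') - tens a v - tens a v'"
    unfolding T_simps using rel2 by (intro eqv_diff T_pure V.M.a_closed)
  also have "\<dots> \<doteq> (tens a v + tens a v') - tens a v - tens a v'"
    using rel2 by (intro eqv_diff eqv_refl tens_lin_right)
  finally show ?case by (simp add: eqv_zero)
next
  case (rel3 a c v)
  have "T (pure (env_class (c *\<^sub>c a)) v - c *\<^sub>c pure (env_class a) v) \<doteq> tens (c *\<^sub>c a) v - c *\<^sub>c tens a v"
    unfolding T_simps by (intro eqv_diff eqv_scale T_pure rel3)
  then show ?case by (simp add: tens_simps eqv_zero)
next
  case (rel4 a c v)
  have "T (pure (env_class a) (c \<odot>\<^bsub>V\<^esub> v) - c *\<^sub>c pure (env_class a) v) \<doteq> tens a (c \<odot>\<^bsub>V\<^esub> v) - c *\<^sub>c tens a v"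
    unfolding T_simps using rel4 by (intro eqv_diff eqv_scale T_pure smult_in)
  also have "\<dots> \<doteq> c *\<^sub>c tens a v - c *\<^sub>c tens a v"
    using rel4 by (intro eqv_diff eqv_refl tens_lin_right)
  finally show ?case by (simp add: eqv_zero)
next
  case (rel5 a b v)
  have "T (pure (env_class (a * b)) v - pure (env_class a) (tensor_act V b v))
     \<doteq> tens (a * b) v - tens a (tensor_act V b v)"
    unfolding T_simps using rel5 by (intro eqv_diff T_pure tensor_act_closed)
  moreover have "tens (a * b) v - tens a (tensor_act V b v) \<in> K"
    unfolding tens_mult tens_def[of a] lin_fun_diff[symmetric]
  proof (rule lin_in_subspace[OF K_subspace])
    fix w
    show "lmulw w (tens b v) - pv w (tensor_act V b v) \<in> K"
      using eqv_lmulw[OF tens_sub_tensor[OF rel5(2,1)], of w] by (simp add: eqv_def)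
  qed
  ultimately show ?case using eqv_K by blast
qed (simp_all add: T_simps K_closed)

lemma jm_K: "f \<in> K \<Longrightarrow> jm f \<in> TK"
proof (induction rule: K_induct)
  case (r_add w v v')
  then show ?case using TK_rels(2)[of v v' "Poly_Mapping.single w 1"] by (simp add: jm_simps)
next
  case (r_smult w c v)
  then show ?case using TK_rels(4)[of v "Poly_Mapping.single w 1" c] by (simp add: jm_simps)
next
  case (r_act a x v)
  have "Poly_Mapping.single [x] 1 \<in> sub_tensor B" using r_act by (simp add: sub_tensor_def)
  moreover have "tensor_act V (Poly_Mapping.single [x] 1) v = act V (gen x) v"
    using r_act by (simp add: tensor_act_def)
  ultimately show ?case
    using TK_rels(5)[of v "Poly_Mapping.single [x] 1" "Poly_Mapping.single a 1"] r_act
    by (simp add: jm_simps mult_words)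
next
  case (r_comm a x y b v)
  \<comment> \<open>The commutation relation is a two-sided multiple of a generator of
    \<open>env_ideal\<close>, so its class is that of \<open>0\<close> and the pure tensor formed
    with it lies in \<open>TK\<close>.\<close>
  define e where "e = Poly_Mapping.single (a @ x # y # b) 1
    - ksign (parity x) (parity y) *\<^sub>c Poly_Mapping.single (a @ y # x # b) 1
    - lin (\<lambda>c. Poly_Mapping.single (a @ c # b) 1) (basis_bracket x y)"
  have lin1: "lin (\<lambda>c. Poly_Mapping.single (a @ c # b) 1) z = Poly_Mapping.single a 1 * tensor_emb z * Poly_Mapping.single b 1"
    for z
    by (induction z rule: pm_induct) (simp_all add: lin_add tensor_emb_lin distrib_left distrib_right mult_words)
  have "e = Poly_Mapping.single a 1 * (tensor_emb (gen x) * tensor_emb (gen y)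
     - ksign (parity x) (parity y) *\<^sub>c (tensor_emb (gen y) * tensor_emb (gen x))
     - tensor_emb (bms_bracket (gen x) (gen y))) * Poly_Mapping.single b 1"
    by (simp add: e_def lin1 left_diff_distrib right_diff_distrib mult_words tensor_emb_lin
        pm_scale_mult_left pm_scale_mult_right del: pm_scale_single)
  also have "\<dots> \<in> env_ideal"
  proof (rule env_ideal_closed(4), rule env_ideal_closed(3))
    have "bms_homogeneous (parity z) (gen z)" for z by (simp add: bms_homogeneous_def)
    then show "tensor_emb (gen x) * tensor_emb (gen y)
     - ksign (parity x) (parity y) *\<^sub>c (tensor_emb (gen y) * tensor_emb (gen x))
     - tensor_emb (bms_bracket (gen x) (gen y)) \<in> env_ideal"
      unfolding env_ideal_def by (intro ring.genideal_self[OF tensor_ring_ring, THEN subsetD]) (simp, blast)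
  qed
  finally have "env_class e = env_class 0" by (simp add: env_class_eq)
  then have "pure (env_class e) v \<in> TK"
    using TK_rels(3)[OF r_comm, of 0 0] by simp
  from TK_closed(4)[OF this pure_tens[OF r_comm, of e]] have "jm (tens e v) \<in> TK" by simp
  then show ?case by (simp add: e_def tens_simps)
qed (simp_all add: jm_simps TK_closed)

lemma T_jm: "f \<in> PV \<Longrightarrow> T (jm f) \<doteq> f"
proof (induction rule: PV_induct)
  case (add x y)
  then show ?case by (simp only: jm_simps T_simps) (intro eqv_add)
next
  case (single c w v)
  have "c *\<^sub>c T (pure (env_class (Poly_Mapping.single w 1)) v) \<doteq> c *\<^sub>c tens (Poly_Mapping.single w 1) v"
    using single by (intro eqv_scale T_pure)
  then show ?case by (simp add: jm_simps T_simps[symmetric])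
qed (simp add: jm_simps T_simps)

lemma jm_TK_iff: "f \<in> PV \<Longrightarrow> jm f \<in> TK \<longleftrightarrow> f \<in> K"
  using jm_K T_TK eqv_K[OF T_jm] by blast

lemma jm_T: "f \<in> pre_space \<Longrightarrow> f - jm (T f) \<in> TK"
proof (induction rule: pre_space_induct)
  case zero
  show ?case by (simp add: T_simps jm_simps TK_closed)
next
  case (add f g)
  from TK_closed(2)[OF add(3,4)] show ?case by (simp add: T_simps jm_simps algebra_simps)
next
  case (pure c a v)
  let ?b = "SOME b. env_class b = env_class a"
  have "env_class ?b = env_class a" by (rule someI[of _ a]) simp
  then have "c *\<^sub>c (pure (env_class a) v - jm (tens ?b v)) \<in> TK"
    using pure_tens[OF pure, of ?b] by (intro TK_closed(3)) simp
  then show ?case by (simp add: T_def jm_simps pm_scale_diff)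
qed

end

lemma bit_shift: "(r :: bit) + s = p \<longleftrightarrow> s = p + r" "r + (r + s) = (s :: bit)" "s + 1 \<noteq> (s :: bit)"
  by (cases r; cases s; cases p; simp)+

declare add_bit_eq_xor [simp del]

lemma lmult_lin: "pre_tensor_lmult u f = lin (\<lambda>(u', v). pure (u \<otimes>\<^bsub>env\<^esub> u') v) f"
  by (simp add: pre_tensor_lmult_def lin_def split_def)

section \<open>The module structure on cosets\<close>

context ind_mod
begin

abbreviation W where "W \<equiv> induced_module B V"

lemma tensor_class_mem: "x \<in> tensor_class B V f \<longleftrightarrow> x - f \<in> TK"
proof -
  have "x \<in> tensor_class B V f \<longleftrightarrow> (\<exists>h\<in>TK. x = h + f)"
    by (auto simp: tensor_class_def a_r_coset_def' pre_tensor_space_def free_space_def)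
  also have "\<dots> \<longleftrightarrow> x - f \<in> TK"
    by (metis add_diff_cancel diff_add_cancel)
  finally show ?thesis .
qed

lemma tensor_class_eq: "tensor_class B V f = tensor_class B V g \<longleftrightarrow> f - g \<in> TK"
proof
  assume "tensor_class B V f = tensor_class B V g"
  then have "f \<in> tensor_class B V g" using tensor_class_mem[of f f] TK_closed(1) by simp
  then show "f - g \<in> TK" by (simp add: tensor_class_mem)
next
  assume *: "f - g \<in> TK"
  have "x - f \<in> TK \<longleftrightarrow> x - g \<in> TK" for x
    using TK_closed(2)[OF _ *, of "x - f"] TK_closed(4)[OF _ *, of "x - g"] by auto
  then show "tensor_class B V f = tensor_class B V g" by (auto simp: tensor_class_mem)
qed

text \<open>Every element of the induced module has the form \<open>cl g\<close> with
  \<open>g \<in> PV\<close>, and equality becomes \<open>\<doteq>\<close>. The operations on cosets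
  turn into plain operations on \<open>g\<close>.\<close>

definition cl :: "'a word_space \<Rightarrow> 'a pre_tensor set" where
  "cl g = tensor_class B V (jm g)"

lemma cl_eq: "f \<in> PV \<Longrightarrow> g \<in> PV \<Longrightarrow> cl f = cl g \<longleftrightarrow> f \<doteq> g"
  using jm_TK_iff[of "f - g"] by (simp add: cl_def tensor_class_eq eqv_def jm_simps)

lemma tensor_class_cl: "f \<in> pre_space \<Longrightarrow> tensor_class B V f = cl (T f)"
  using jm_T by (simp add: cl_def tensor_class_eq)

lemma W_carrier: "carrier W = cl ` PV"
proof -
  have "carrier W = tensor_class B V ` pre_space"
    by (auto simp: induced_module_def A_RCOSETS_def' pre_space_carrier tensor_class_def)
  also have "\<dots> = cl ` PV"
  proof safe
    fix f assume "f \<in> pre_space"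
    then show "tensor_class B V f \<in> cl ` PV" using tensor_class_cl T_PV by auto
  next
    fix g assume "g \<in> PV"
    then show "cl g \<in> tensor_class B V ` pre_space" using jm_pre_space by (auto simp: cl_def)
  qed
  finally show ?thesis .
qed

lemma W_zero: "\<zero>\<^bsub>W\<^esub> = cl 0"
proof -
  have "\<zero>\<^bsub>W\<^esub> = TK" by (simp add: induced_module_def)
  also have "\<dots> = cl 0" by (auto simp: cl_def tensor_class_mem jm_simps)
  finally show ?thesis .
qed

lemma W_add: "cl f \<oplus>\<^bsub>W\<^esub> cl g = cl (f + g)"
proof -
  have "cl f \<oplus>\<^bsub>W\<^esub> cl g = {x + y | x y. x \<in> cl f \<and> y \<in> cl g}"
    by (auto simp: induced_module_def set_add_def' pre_tensor_space_def free_space_def)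
  also have "\<dots> = cl (f + g)"
  proof (intro equalityI subsetI)
    fix z assume "z \<in> cl (f + g)"
    then have "jm f \<in> cl f" "z - jm f \<in> cl g"
      by (auto simp: cl_def tensor_class_mem jm_simps TK_closed algebra_simps)
    then show "z \<in> {x + y | x y. x \<in> cl f \<and> y \<in> cl g}"
      by (intro CollectI exI[of _ "jm f"] exI[of _ "z - jm f"]) simp
  next
    fix z assume "z \<in> {x + y | x y. x \<in> cl f \<and> y \<in> cl g}"
    then obtain x y where *: "z = x + y" "x - jm f \<in> TK" "y - jm g \<in> TK"
      by (auto simp: cl_def tensor_class_mem)
    from TK_closed(2)[OF *(2,3)] show "z \<in> cl (f + g)"
      by (simp add: cl_def tensor_class_mem jm_simps * algebra_simps)
  qed
  finally show ?thesis .
qed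

text \<open>The unions over representatives in \<open>induced_module\<close> run over equal
  cosets.\<close>

lemma UN_tensor_class:
  assumes "\<And>f. f - jm g \<in> TK \<Longrightarrow> h f - h' \<in> TK"
  shows "(\<Union>f\<in>cl g. tensor_class B V (h f)) = tensor_class B V h'"
proof -
  have "tensor_class B V (h f) = tensor_class B V h'" if "f \<in> cl g" for f
    using assms that by (simp add: cl_def tensor_class_mem tensor_class_eq)
  moreover have "jm g \<in> cl g" by (simp add: cl_def tensor_class_mem TK_closed)
  ultimately show ?thesis by blast
qed

lemma W_smult: "c \<odot>\<^bsub>W\<^esub> cl g = cl (c *\<^sub>c g)"
proof -
  have "c \<odot>\<^bsub>W\<^esub> cl g = (\<Union>f\<in>cl g. tensor_class B V (c *\<^sub>c f))"
    by (simp add: induced_module_def)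
  also have "\<dots> = tensor_class B V (jm (c *\<^sub>c g))"
  proof (rule UN_tensor_class)
    fix f assume "f - jm g \<in> TK"
    from TK_closed(3)[OF this, of c] show "c *\<^sub>c f - jm (c *\<^sub>c g) \<in> TK"
      by (simp add: jm_simps pm_scale_diff)
  qed
  finally show ?thesis by (simp add: cl_def)
qed

lemma lmulx_K: "f \<in> K \<Longrightarrow> lmulx x f \<in> K"
  unfolding lmulx_def by (rule lin_in_subspace[OF K_subspace]) (rule lmul_K)

lemma lmulx_PV [simp]: "f \<in> PV \<Longrightarrow> lmulx x f \<in> PV"
  unfolding lmulx_def by (rule lin_in_subspace[OF PV_subspace]) (rule lmul_PV)

lemma lmulx_eqv: "f \<doteq> g \<Longrightarrow> lmulx x f \<doteq> lmulx x g"
  using lmulx_K[of "f - g" x] by (simp add: eqv_def lmulx_simps)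

lemma lmult_jm:
  assumes "f \<in> pre_space"
  shows "pre_tensor_lmult (env_class (tensor_emb x)) f - jm (lmulx x (T f)) \<in> TK"
  using assms
proof (induction rule: pre_space_induct)
  case zero
  show ?case by (simp add: lmult_lin T_simps lmulx_simps jm_simps TK_closed)
next
  case (add f g)
  from TK_closed(2)[OF add(3,4)] show ?case
    by (simp add: lmult_lin lin_add T_simps lmulx_simps jm_simps algebra_simps)
next
  case (pure c a v)
  let ?b = "SOME b. env_class b = env_class a"
  have b: "env_class ?b = env_class a" by (rule someI[of _ a]) simp
  then have "env_class (tensor_emb x * a) = env_class (tensor_emb x * ?b)"
    by (simp add: env_ops(2)[symmetric])
  then have "c *\<^sub>c (pure (env_class (tensor_emb x * a)) v - jm (lmulx x (tens ?b v))) \<in> TK"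
    using pure_tens[OF pure, of "tensor_emb x * ?b"] by (intro TK_closed(3)) (simp add: tens_emb_mult)
  then show ?case
    by (simp add: lmult_lin T_def lmulx_simps jm_simps env_ops lin_scale pm_scale_diff)
qed

lemma W_act:
  assumes g: "g \<in> PV"
  shows "act W x (cl g) = cl (lmulx x g)"
proof -
  have "act W x (cl g) = (\<Union>f\<in>cl g. tensor_class B V (pre_tensor_lmult (env_class (tensor_emb x)) f))"
    by (simp add: induced_module_def)
  also have "\<dots> = tensor_class B V (jm (lmulx x g))"
  proof (rule UN_tensor_class)
    fix f assume f: "f - jm g \<in> TK"
    have "(f - jm g) + jm g \<in> pre_space"
      using f TK_pre_space jm_pre_space[OF g] by (intro pm.subspace_add[OF pre_space_subspace]) auto
    then have fp: "f \<in> pre_space" by simp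
    have "T f - T (jm g) \<in> K" using T_TK[OF f] by (simp add: T_simps)
    then have "T f \<doteq> g" using eqv_trans[OF _ T_jm[OF g]] by (simp add: eqv_def)
    from jm_K[OF lmulx_eqv[OF this, of x, unfolded eqv_def]]
    have "jm (lmulx x (T f)) - jm (lmulx x g) \<in> TK" by (simp add: jm_simps)
    from TK_closed(2)[OF lmult_jm[OF fp, of x] this]
    show "pre_tensor_lmult (env_class (tensor_emb x)) f - jm (lmulx x g) \<in> TK" by simp
  qed
  finally show ?thesis by (simp add: cl_def)
qed

lemma cl_in [simp]: "g \<in> PV \<Longrightarrow> cl g \<in> carrier W"
  by (simp add: W_carrier)

lemma W_cases: "w \<in> carrier W \<Longrightarrow> (\<And>g. g \<in> PV \<Longrightarrow> w = cl g \<Longrightarrow> thesis) \<Longrightarrow> thesis"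
  by (auto simp: W_carrier)

lemma W_module: "module complex_ring W"
proof (rule moduleI[OF complex_ring_cring])
  show "abelian_group W"
  proof (rule abelian_groupI)
    fix x assume "x \<in> carrier W"
    then obtain g where g: "g \<in> PV" "x = cl g" by (auto simp: W_carrier)
    have "cl ((-1) *\<^sub>c g) \<oplus>\<^bsub>W\<^esub> x = \<zero>\<^bsub>W\<^esub>"
      using g by (simp add: W_add W_zero pm.scale_minus_left)
    then show "\<exists>y\<in>carrier W. y \<oplus>\<^bsub>W\<^esub> x = \<zero>\<^bsub>W\<^esub>"
      using g by (intro bexI[of _ "cl ((-1) *\<^sub>c g)"]) simp_all
  qed (auto elim!: W_cases simp: W_add W_zero add_ac)
qed (auto elim!: W_cases simp: W_smult W_add pm_scale_add_left pm_scale_add_right)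

sublocale W: module complex_ring W
  by (rule W_module)

lemma W_uminus: "g \<in> PV \<Longrightarrow> \<ominus>\<^bsub>W\<^esub> cl g = cl (- g)"
proof -
  assume g: "g \<in> PV"
  have "cl ((-1) *\<^sub>c g) \<oplus>\<^bsub>W\<^esub> cl g = \<zero>\<^bsub>W\<^esub>"
    by (simp add: W_add W_zero pm.scale_minus_left)
  then have "\<ominus>\<^bsub>W\<^esub> cl g = cl ((-1) *\<^sub>c g)" using g by (intro W.minus_equality) simp_all
  then show ?thesis by (simp add: pm.scale_minus_left)
qed

lemma W_minus: "f \<in> PV \<Longrightarrow> g \<in> PV \<Longrightarrow> cl f \<ominus>\<^bsub>W\<^esub> cl g = cl (f - g)"
  by (simp add: W.minus_eq W_uminus W_add)

subsection \<open>The grading\<close>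

definition wpar :: "bms_basis list \<Rightarrow> bit" where "wpar w = sum_list (map parity w)"

lemma wpar_simps [simp]: "wpar [] = 0" "wpar (b # w) = parity b + wpar w" "wpar (w @ w') = wpar w + wpar w'"
  by (simp_all add: wpar_def)

text \<open>\<open>p + wpar w\<close> is the parity that the vector needs for total parity
  \<open>p\<close>, since addition and subtraction coincide modulo 2.\<close>

definition PVg :: "bit \<Rightarrow> 'a word_space set" where
  "PVg p = {g. Poly_Mapping.keys g \<subseteq> {(w, v). v \<in> grade V (p + wpar w)}}"

lemma PVg_subspace: "pm.subspace (PVg p)"
  by (rule pm.subspaceI)
     (auto simp: PVg_def dest!: subsetD[OF keys_add] subsetD[OF keys_pm_scale])

lemma grade_closed:
  "v \<in> grade V p \<Longrightarrow> v \<in> carrier V" "\<zero>\<^bsub>V\<^esub> \<in> grade V p"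
  "v \<in> grade V p \<Longrightarrow> u \<in> grade V p \<Longrightarrow> v \<oplus>\<^bsub>V\<^esub> u \<in> grade V p"
  "v \<in> grade V p \<Longrightarrow> c \<odot>\<^bsub>V\<^esub> v \<in> grade V p" "v \<in> grade V p \<Longrightarrow> \<ominus>\<^bsub>V\<^esub> v \<in> grade V p"
proof -
  note s = V.submoduleE[OF grade_submodule[of p]]
  show 1: "v \<in> grade V p \<Longrightarrow> v \<in> carrier V" for v using s(1) by auto
  show 2: "v \<in> grade V p \<Longrightarrow> c \<odot>\<^bsub>V\<^esub> v \<in> grade V p" for c v using s(4) by simp
  show "\<zero>\<^bsub>V\<^esub> \<in> grade V p" using s(2) 1 2[of _ 0] smult_zero_left by (metis all_not_in_conv)
  show "v \<in> grade V p \<Longrightarrow> u \<in> grade V p \<Longrightarrow> v \<oplus>\<^bsub>V\<^esub> u \<in> grade V p" using s(5) .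
  show "v \<in> grade V p \<Longrightarrow> \<ominus>\<^bsub>V\<^esub> v \<in> grade V p" using s(3) .
qed

lemma PVg_PV: "g \<in> PVg p \<Longrightarrow> g \<in> PV"
  using grade_closed(1) by (auto simp: PVg_def PV_def)

lemma grade_inter: "v \<in> grade V s \<Longrightarrow> v \<in> grade V (s + 1) \<Longrightarrow> v = \<zero>\<^bsub>V\<^esub>"
  using grade_int by (cases s) auto

definition parity_part :: "bit \<Rightarrow> 'a \<Rightarrow> 'a" where
  "parity_part s v = (THE u. u \<in> grade V s \<and> (\<exists>u'\<in>grade V (s + 1). v = u \<oplus>\<^bsub>V\<^esub> u'))"

lemma parity_part_eqI:
  assumes u: "u \<in> grade V s" "u' \<in> grade V (s + 1)" "v = u \<oplus>\<^bsub>V\<^esub> u'"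
  shows "parity_part s v = u"
  unfolding parity_part_def
proof (rule the_equality)
  show "u \<in> grade V s \<and> (\<exists>u'\<in>grade V (s + 1). v = u \<oplus>\<^bsub>V\<^esub> u')" using u by blast
next
  fix w assume "w \<in> grade V s \<and> (\<exists>u'\<in>grade V (s + 1). v = w \<oplus>\<^bsub>V\<^esub> u')"
  then obtain w' where w: "w \<in> grade V s" "w' \<in> grade V (s + 1)" "v = w \<oplus>\<^bsub>V\<^esub> w'" by blast
  note c = u(1,2)[THEN grade_closed(1)] w(1,2)[THEN grade_closed(1)]
  have eq: "w \<oplus>\<^bsub>V\<^esub> \<ominus>\<^bsub>V\<^esub> u = u' \<oplus>\<^bsub>V\<^esub> \<ominus>\<^bsub>V\<^esub> w'"
  proof -
    have "w \<oplus>\<^bsub>V\<^esub> \<ominus>\<^bsub>V\<^esub> u = (w \<oplus>\<^bsub>V\<^esub> w') \<oplus>\<^bsub>V\<^esub> (\<ominus>\<^bsub>V\<^esub> w' \<oplus>\<^bsub>V\<^esub> \<ominus>\<^bsub>V\<^esub> u)"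
      using c by (simp add: V.M.a_assoc V.M.r_neg2)
    also have "w \<oplus>\<^bsub>V\<^esub> w' = u \<oplus>\<^bsub>V\<^esub> u'" using u(3) w(3) by simp
    also have "u \<oplus>\<^bsub>V\<^esub> u' = u' \<oplus>\<^bsub>V\<^esub> u" using c by (intro V.M.a_comm)
    also have "\<ominus>\<^bsub>V\<^esub> w' \<oplus>\<^bsub>V\<^esub> \<ominus>\<^bsub>V\<^esub> u = \<ominus>\<^bsub>V\<^esub> u \<oplus>\<^bsub>V\<^esub> \<ominus>\<^bsub>V\<^esub> w'" using c by (intro V.M.a_comm) auto
    also have "(u' \<oplus>\<^bsub>V\<^esub> u) \<oplus>\<^bsub>V\<^esub> (\<ominus>\<^bsub>V\<^esub> u \<oplus>\<^bsub>V\<^esub> \<ominus>\<^bsub>V\<^esub> w') = u' \<oplus>\<^bsub>V\<^esub> \<ominus>\<^bsub>V\<^esub> w'"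
      using c by (simp add: V.M.a_assoc V.M.r_neg2)
    finally show ?thesis .
  qed
  have "w \<oplus>\<^bsub>V\<^esub> \<ominus>\<^bsub>V\<^esub> u = \<zero>\<^bsub>V\<^esub>"
  proof (rule grade_inter)
    show "w \<oplus>\<^bsub>V\<^esub> \<ominus>\<^bsub>V\<^esub> u \<in> grade V s" by (intro grade_closed u w)
    show "w \<oplus>\<^bsub>V\<^esub> \<ominus>\<^bsub>V\<^esub> u \<in> grade V (s + 1)" unfolding eq by (intro grade_closed u w)
  qed
  then show "w = u" using c V.M.minus_equality[of w "\<ominus>\<^bsub>V\<^esub> u"] by simp
qed

lemma parity_part_ex:
  assumes "v \<in> carrier V"
  shows "\<exists>u\<in>grade V s. \<exists>u'\<in>grade V (s + 1). v = u \<oplus>\<^bsub>V\<^esub> u'"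
proof -
  from assms grade_sum obtain a b where ab: "a \<in> grade V 0" "b \<in> grade V 1" "v = a \<oplus>\<^bsub>V\<^esub> b"
    unfolding set_add_def' by blast
  then have ba: "v = b \<oplus>\<^bsub>V\<^esub> a" using grade_closed(1) V.M.a_comm by auto
  show ?thesis
  proof (cases s)
    case zero
    then show ?thesis using ab by auto
  next
    case one
    then have "b \<in> grade V s" "a \<in> grade V (s + 1)" using ab by simp_all
    then show ?thesis using ba by blast
  qed
qed

lemma parity_part_grade: "v \<in> carrier V \<Longrightarrow> parity_part s v \<in> grade V s"
  using parity_part_ex[of v s] parity_part_eqI by metis

lemma parity_part_sum:
  assumes "v \<in> carrier V"
  shows "parity_part s v \<oplus>\<^bsub>V\<^esub> parity_part (s + 1) v = v"
proof -
  obtain u u' where u: "u \<in> grade V s" "u' \<in> grade V (s + 1)" "v = u \<oplus>\<^bsub>V\<^esub> u'"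
    using parity_part_ex[OF assms] by blast
  have "parity_part s v = u" by (rule parity_part_eqI[OF u])
  moreover have "s + 1 + 1 = s" by (cases s) simp_all
  then have "parity_part (s + 1) v = u'"
    using u grade_closed(1) V.M.a_comm by (intro parity_part_eqI[of u' _ u]) auto
  ultimately show ?thesis using u by simp
qed

lemma parity_part_carrier [simp]: "v \<in> carrier V \<Longrightarrow> parity_part s v \<in> carrier V"
  using parity_part_grade grade_closed(1) by blast

lemma parity_part_add:
  assumes "v \<in> carrier V" "u \<in> carrier V"
  shows "parity_part s (v \<oplus>\<^bsub>V\<^esub> u) = parity_part s v \<oplus>\<^bsub>V\<^esub> parity_part s u"
proof (rule parity_part_eqI)
  show "v \<oplus>\<^bsub>V\<^esub> u = (parity_part s v \<oplus>\<^bsub>V\<^esub> parity_part s u) \<oplus>\<^bsub>V\<^esub> (parity_part (s + 1) v \<oplus>\<^bsub>V\<^esub> parity_part (s + 1) u)"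
    using parity_part_sum[OF assms(1), of s] parity_part_sum[OF assms(2), of s] assms
    by (metis V.M.a_closed V.M.a_assoc V.M.a_lcomm parity_part_carrier)
qed (use assms in \<open>auto intro!: grade_closed parity_part_grade\<close>)

lemma parity_part_smult:
  assumes "v \<in> carrier V"
  shows "parity_part s (c \<odot>\<^bsub>V\<^esub> v) = c \<odot>\<^bsub>V\<^esub> parity_part s v"
proof (rule parity_part_eqI)
  show "c \<odot>\<^bsub>V\<^esub> v = c \<odot>\<^bsub>V\<^esub> parity_part s v \<oplus>\<^bsub>V\<^esub> c \<odot>\<^bsub>V\<^esub> parity_part (s + 1) v"
    using parity_part_sum[OF assms, of s] V.smult_r_distr[of c "parity_part s v" "parity_part (s + 1) v"] assms by simp
qed (use assms in \<open>auto intro!: grade_closed parity_part_grade\<close>)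

lemma parity_part_act:
  assumes v: "v \<in> carrier V" and b: "b \<in> B"
  shows "parity_part s (act V (gen b) v) = act V (gen b) (parity_part (s + parity b) v)"
proof (rule parity_part_eqI)
  have hom: "bms_homogeneous (parity b) (gen b)" by (simp add: bms_homogeneous_def)
  have e: "parity b + (s + parity b) = s" "parity b + (s + parity b + 1) = s + 1"
    by (cases "parity b"; cases s; simp)+
  show "act V (gen b) (parity_part (s + parity b) v) \<in> grade V s"
    using act_grade[OF gen_in_span[OF b] hom parity_part_grade[OF v, of "s + parity b"]] e by simp
  show "act V (gen b) (parity_part (s + parity b + 1) v) \<in> grade V (s + 1)"
    using act_grade[OF gen_in_span[OF b] hom parity_part_grade[OF v, of "s + parity b + 1"]] e by simp
  show "act V (gen b) v = act V (gen b) (parity_part (s + parity b) v) \<oplus>\<^bsub>V\<^esub> act V (gen b) (parity_part (s + parity b + 1) v)"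
    using v b parity_part_sum[OF v, of "s + parity b"]
      act_add[OF gen_in_span[OF b], of "parity_part (s + parity b) v" "parity_part (s + parity b + 1) v"] by simp
qed

lemma parity_part_id: "v \<in> grade V s \<Longrightarrow> parity_part s v = v"
  using grade_closed by (intro parity_part_eqI[of v s "\<zero>\<^bsub>V\<^esub>"]) auto

lemma parity_part_other: "v \<in> grade V (s + 1) \<Longrightarrow> parity_part s v = \<zero>\<^bsub>V\<^esub>"
  using grade_closed by (intro parity_part_eqI[of "\<zero>\<^bsub>V\<^esub>" s v]) auto

definition proj :: "bit \<Rightarrow> 'a word_space \<Rightarrow> 'a word_space" where
  "proj p = lin (\<lambda>(w, v). pv w (parity_part (p + wpar w) v))"

lemma proj_simps: "proj p (f + g) = proj p f + proj p g" "proj p (c *\<^sub>c f) = c *\<^sub>c proj p f" "proj p 0 = 0"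
    "proj p (f - g) = proj p f - proj p g" "proj p (lin h z) = lin (\<lambda>k. proj p (h k)) z"
  by (simp_all add: proj_def lin_add lin_scale lin_diff lin_lin)

lemma proj_single: "proj p (Poly_Mapping.single (w, v) c) = Poly_Mapping.single (w, parity_part (p + wpar w) v) c"
  by (simp add: proj_def)

text \<open>Brackets and the action respect parity, so each relation has a well-defined word parity
  and is carried to a relation of the same kind for the parity component; the grading of words thus
  descends to the quotient.\<close>

lemma proj_K: "f \<in> K \<Longrightarrow> proj p f \<in> K"
proof (induction rule: K_induct)
  case (r_add w v v')
  then show ?case
    using K_rels(1)[of "parity_part (p + wpar w) v" "parity_part (p + wpar w) v'" w]
    by (simp add: proj_simps proj_single parity_part_add)
next
  case (r_smult w c v)
  then show ?case
    using K_rels(2)[of "parity_part (p + wpar w) v" w c]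
    by (simp add: proj_simps proj_single parity_part_smult)
next
  case (r_comm a x y b v)
  let ?s = "p + (wpar a + (parity x + parity y) + wpar b)"
  have "lin (\<lambda>c. proj p (pv (a @ c # b) v)) (basis_bracket x y)
      = lin (\<lambda>c. pv (a @ c # b) (parity_part ?s v)) (basis_bracket x y)"
    by (intro lin_cong refl) (simp add: proj_single basis_bracket_keys_parity add_ac)
  moreover have "proj p (pv (a @ x # y # b) v) = pv (a @ x # y # b) (parity_part ?s v)"
    "proj p (pv (a @ y # x # b) v) = pv (a @ y # x # b) (parity_part ?s v)"
    by (simp_all add: proj_single add_ac)
  ultimately show ?case
    using K_rels(3)[of "parity_part ?s v" a x y b] r_comm
    by (simp only: proj_simps parity_part_carrier)
next
  case (r_act a x v)
  then show ?case
    using K_rels(4)[of x "parity_part (p + wpar a + parity x) v" a] 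
    by (simp add: proj_simps proj_single parity_part_act add_ac)
qed (simp_all add: proj_simps K_closed)

lemma proj_eqv: "f \<doteq> g \<Longrightarrow> proj p f \<doteq> proj p g"
  using proj_K[of "f - g" p] by (simp add: eqv_def proj_simps)

lemma proj_PVg: "f \<in> PV \<Longrightarrow> proj p f \<in> PVg p"
proof (induction rule: PV_induct)
  case (single c w v)
  then show ?case by (auto simp: proj_single PVg_def parity_part_grade)
qed (auto simp: proj_simps intro: pm.subspace_add[OF PVg_subspace] pm.subspace_0[OF PVg_subspace])

lemma proj_id: "g \<in> PVg p \<Longrightarrow> proj p g = g"
proof -
  assume g: "g \<in> PVg p"
  have "proj p g = lin (\<lambda>k. Poly_Mapping.single k 1) g"
    unfolding proj_def using g by (intro lin_cong refl) (auto simp: PVg_def parity_part_id)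
  then show ?thesis by (simp add: lin_ident)
qed

lemma proj_other: "g \<in> PVg (p + 1) \<Longrightarrow> proj p g \<in> K"
  unfolding proj_def
proof (rule lin_in_subspace[OF K_subspace])
  fix k assume g: "g \<in> PVg (p + 1)" and "k \<in> Poly_Mapping.keys g"
  then obtain w v where k: "k = (w, v)" "v \<in> grade V (p + 1 + wpar w)" by (auto simp: PVg_def)
  then have "parity_part (p + wpar w) v = \<zero>\<^bsub>V\<^esub>" by (intro parity_part_other) (simp add: add_ac)
  then show "(case k of (w, v) \<Rightarrow> pv w (parity_part (p + wpar w) v)) \<in> K" using k pv_zero by simp
qed

lemma proj_sum: "f \<in> PV \<Longrightarrow> f \<doteq> proj 0 f + proj 1 f"
proof (induction rule: PV_induct)
  case (add x y)
  from eqv_add[OF add(3,4)] show ?case by (simp add: proj_simps algebra_simps)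
next
  case (single c w v)
  have "pv w v \<doteq> pv w (parity_part (wpar w) v) + pv w (parity_part (wpar w + 1) v)"
    using pv_add[of "parity_part (wpar w) v" "parity_part (wpar w + 1) v" w] single parity_part_sum by simp
  from eqv_scale[OF this, of c] show ?case
    by (simp add: proj_single pm_scale_add_right add_ac)
qed (simp add: proj_simps)

text \<open>The definition distributes the parity over both tensor factors; expanding a homogeneous
  element of the tensor algebra into words brings this to the form \<open>PVg\<close>.\<close>

lemma W_grade: "grade W p = cl ` PVg p"
proof -
  have gr: "grade W p = {tensor_class B V f | f.
         \<forall>(u, v)\<in>Poly_Mapping.keys f. \<exists>r s. r + s = p \<and> u \<in> env_grade r \<and> v \<in> grade V s}"
    by (simp add: induced_module_def)
  show ?thesis
  proof (intro equalityI subsetI)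
    fix w assume "w \<in> grade W p"
    then obtain f where f: "w = tensor_class B V f"
      "Poly_Mapping.keys f \<subseteq> {(u, v). \<exists>r s. r + s = p \<and> u \<in> env_grade r \<and> v \<in> grade V s}"
      unfolding gr by fast
    from f(2) have "\<exists>g\<in>PVg p. f - jm g \<in> TK"
    proof (induction rule: keys_induct)
      case zero
      show ?case using pm.subspace_0[OF PVg_subspace] by (intro bexI[of _ 0]) (simp_all add: jm_simps TK_closed)
    next
      case (add x y)
      then obtain g h where g: "g \<in> PVg p" "x - jm g \<in> TK" "h \<in> PVg p" "y - jm h \<in> TK" by blast
      have "(x + y) - jm (g + h) \<in> TK"
        using TK_closed(2)[OF g(2,4)] by (simp add: jm_simps algebra_simps)
      then show ?case using pm.subspace_add[OF PVg_subspace g(1,3)] by blast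
    next
      case (single c k)
      then obtain r s a v where k: "k = (env_class a, v)" "r + s = p" "v \<in> grade V s"
        "\<forall>w\<in>Poly_Mapping.keys a. sum_list (map parity w) = r"
        by (auto simp: env_grade_def)
      have "tens a v \<in> PVg p"
        unfolding tens_def
      proof (rule lin_in_subspace[OF PVg_subspace])
        fix w assume "w \<in> Poly_Mapping.keys a"
        then have "s = p + wpar w" using k by (simp add: wpar_def bit_shift(1)[symmetric])
        then show "pv w v \<in> PVg p" using k by (simp add: PVg_def)
      qed
      then have "c *\<^sub>c tens a v \<in> PVg p" by (rule pm.subspace_scale[OF PVg_subspace])
      moreover have "Poly_Mapping.single k c - jm (c *\<^sub>c tens a v) \<in> TK"
        using TK_closed(3)[OF pure_tens[OF grade_closed(1)[OF k(3)], of a], of c]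
        by (simp add: k jm_simps pm_scale_diff)
      ultimately show ?case by blast
    qed
    then show "w \<in> cl ` PVg p" using f by (auto simp: cl_def tensor_class_eq)
  next
    fix w assume "w \<in> cl ` PVg p"
    then obtain g where g: "w = tensor_class B V (jm g)" "g \<in> PVg p" by (auto simp: cl_def)
    let ?S = "{f. Poly_Mapping.keys f \<subseteq> {(u, v). \<exists>r s. r + s = p \<and> u \<in> env_grade r \<and> v \<in> grade V s}}"
    have sub: "pm.subspace ?S"
      by (rule pm.subspaceI) (auto dest!: subsetD[OF keys_add] subsetD[OF keys_pm_scale])
    have "jm g \<in> ?S"
      unfolding jm_def
    proof (rule lin_in_subspace[OF sub])
      fix k assume "k \<in> Poly_Mapping.keys g"
      then obtain w v where k: "k = (w, v)" "v \<in> grade V (p + wpar w)" using g by (auto simp: PVg_def)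
      have "env_class (Poly_Mapping.single w 1) \<in> env_grade (wpar w)"
        unfolding env_grade_def by (rule CollectI, rule exI[of _ "Poly_Mapping.single w 1"]) (simp add: wpar_def)
      moreover have "wpar w + (p + wpar w) = p" by (cases p; cases "wpar w"; simp)
      ultimately have "\<exists>r s. r + s = p \<and> env_class (Poly_Mapping.single w 1) \<in> env_grade r \<and> v \<in> grade V s"
        using k(2) by blast
      then show "(case k of (w, v) \<Rightarrow> pure (env_class (Poly_Mapping.single w 1)) v) \<in> ?S"
        using k(1) by simp
    qed
    then show "w \<in> grade W p" unfolding gr using g by auto
  qed
qed

lemma lmulx_bracket:
  assumes f: "f \<in> PV" and xy: "bms_homogeneous p x" "bms_homogeneous r y"
  shows "lmulx (bms_bracket x y) f \<doteq> lmulx x (lmulx y f) - ksign p r *\<^sub>c lmulx y (lmulx x f)"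
proof -
  have keys: "Poly_Mapping.keys x \<subseteq> {b. parity b = p}" "Poly_Mapping.keys y \<subseteq> {b. parity b = r}"
    using xy by (auto simp: bms_homogeneous_def)
  from keys(1) show ?thesis
  proof (induction rule: keys_induct)
    case (add x x')
    from eqv_add[OF add(3,4)] show ?case
      by (simp add: lmulx_simps bms_bracket_add_left pm_scale_add_right algebra_simps)
  next
    case b: (single d b)
    from keys(2) show ?case
    proof (induction rule: keys_induct)
      case (add y y')
      from eqv_add[OF add(3,4)] show ?case
        by (simp add: lmulx_simps bms_bracket_add_right pm_scale_add_right algebra_simps)
    next
      case (single d' b')
      have eq: "lmulx (Poly_Mapping.single z c) g = c *\<^sub>c lmul z g" for z c g
        using lmulx_simps(6)[of c "gen z" g] by (simp add: lmulx_simps(7))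
      have "lmulx (basis_bracket b b') f \<doteq> lmul b (lmul b' f) - ksign p r *\<^sub>c lmul b' (lmul b f)"
        using eqv_sym[OF lmul_comm[OF f, of b b']] b single
        by (simp add: eqv_def lmulx_def algebra_simps)
      from eqv_scale[OF this, of "d * d'"] show ?case
        by (simp add: eq lmulx_simps lmul_simps pm_scale_diff mult_ac)
    qed (simp add: lmulx_simps)
  qed (simp add: lmulx_simps)
qed

lemma lmulx_PVg:
  assumes x: "bms_homogeneous p x" and f: "f \<in> PVg r"
  shows "lmulx x f \<in> PVg (p + r)"
  unfolding lmulx_def
proof (rule lin_in_subspace[OF PVg_subspace])
  fix b assume "b \<in> Poly_Mapping.keys x"
  then have b: "parity b = p" using x by (simp add: bms_homogeneous_def)
  show "lmul b f \<in> PVg (p + r)"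
    unfolding lmul_def
  proof (rule lin_in_subspace[OF PVg_subspace])
    fix k assume "k \<in> Poly_Mapping.keys f"
    then obtain w v where k: "k = (w, v)" "v \<in> grade V (r + wpar w)" using f by (auto simp: PVg_def)
    have "p + r + (p + wpar w) = r + wpar w" by (cases p; cases r; cases "wpar w"; simp)
    then show "(case k of (w, v) \<Rightarrow> pv (b # w) v) \<in> PVg (p + r)"
      using k b by (simp add: PVg_def)
  qed
qed

lemma W_is_module: "is_bms_module UNIV W"
  unfolding is_bms_module_def
proof (intro conjI allI ballI impI)
  show "module complex_ring W" by (rule W_module)
  show "submodule (grade W p) complex_ring W" for p
  proof (rule W.submoduleI)
    show "grade W p \<subseteq> carrier W" using PVg_PV by (auto simp: W_grade)
    show "\<zero>\<^bsub>W\<^esub> \<in> grade W p" using pm.subspace_0[OF PVg_subspace] by (simp add: W_grade W_zero)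
    show "\<ominus>\<^bsub>W\<^esub> a \<in> grade W p" if "a \<in> grade W p" for a
      using that PVg_PV pm.subspace_neg[OF PVg_subspace] by (auto simp: W_grade W_uminus)
    show "a \<oplus>\<^bsub>W\<^esub> b \<in> grade W p" if "a \<in> grade W p" "b \<in> grade W p" for a b
      using that pm.subspace_add[OF PVg_subspace] by (auto simp: W_grade W_add)
    show "c \<odot>\<^bsub>W\<^esub> a \<in> grade W p" if "a \<in> grade W p" for c a
      using that pm.subspace_scale[OF PVg_subspace] by (auto simp: W_grade W_smult)
  qed
  show "grade W 0 <+>\<^bsub>W\<^esub> grade W 1 = carrier W"
  proof
    show "grade W 0 <+>\<^bsub>W\<^esub> grade W 1 \<subseteq> carrier W"
      using PVg_PV by (auto simp: set_add_def' W_grade W_add)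
    show "carrier W \<subseteq> grade W 0 <+>\<^bsub>W\<^esub> grade W 1"
    proof
      fix w assume "w \<in> carrier W"
      then obtain g where g: "g \<in> PV" "w = cl g" by (auto simp: W_carrier)
      have "w = cl (proj 0 g + proj 1 g)"
        using proj_sum[OF g(1)] g PVg_PV[OF proj_PVg[OF g(1)]] by (subst g(2), subst cl_eq) auto
      then have "w = cl (proj 0 g) \<oplus>\<^bsub>W\<^esub> cl (proj 1 g)" by (simp add: W_add)
      then show "w \<in> grade W 0 <+>\<^bsub>W\<^esub> grade W 1"
        using proj_PVg[OF g(1)] by (auto simp: set_add_def' W_grade)
    qed
  qed
  show "grade W 0 \<inter> grade W 1 = {\<zero>\<^bsub>W\<^esub>}"
  proof
    show "grade W 0 \<inter> grade W 1 \<subseteq> {\<zero>\<^bsub>W\<^esub>}"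
    proof
      fix w assume "w \<in> grade W 0 \<inter> grade W 1"
      then obtain g h where gh: "g \<in> PVg 0" "w = cl g" "h \<in> PVg 1" "w = cl h" by (auto simp: W_grade)
      then have "g \<doteq> h" using cl_eq[of g h] PVg_PV by auto
      \<comment> \<open>Projecting the equality of an even and an odd representative to the even
        part keeps \<open>g\<close> and makes \<open>h\<close> vanish.\<close>
      from proj_eqv[OF this, of 0] have "g \<doteq> proj 0 h" using proj_id gh by simp
      moreover have "proj 0 h \<in> K" using proj_other[of h 0] gh by simp
      ultimately have "g \<in> K" using eqv_K by blast
      then show "w \<in> {\<zero>\<^bsub>W\<^esub>}" using gh PVg_PV cl_eq[of g 0] by (simp add: W_zero eqv_zero)
    qed
    show "{\<zero>\<^bsub>W\<^esub>} \<subseteq> grade W 0 \<inter> grade W 1"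
      using pm.subspace_0[OF PVg_subspace] by (simp add: W_grade W_zero)
  qed
next
  fix x y v w c
  assume v: "v \<in> carrier W"
  then obtain g where g: "g \<in> PV" "v = cl g" by (auto simp: W_carrier)
  show "act W x v \<in> carrier W" using g by (simp add: W_act)
  show "act W x (c \<odot>\<^bsub>W\<^esub> v) = c \<odot>\<^bsub>W\<^esub> act W x v"
    using g by (simp add: W_act W_smult lmulx_simps)
  show "act W (x + y) v = act W x v \<oplus>\<^bsub>W\<^esub> act W y v"
    using g by (simp add: W_act W_add lmulx_simps)
  show "act W (c *\<^sub>c x) v = c \<odot>\<^bsub>W\<^esub> act W x v"
    using g by (simp add: W_act W_smult lmulx_simps)
  show "act W x (v \<oplus>\<^bsub>W\<^esub> w) = act W x v \<oplus>\<^bsub>W\<^esub> act W x w" if "w \<in> carrier W"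
    using that g by (auto simp: W_carrier W_act W_add lmulx_simps)
next
  fix p r x y v
  assume v: "v \<in> carrier W" and xy: "bms_homogeneous p x" "bms_homogeneous r y"
  then obtain g where g: "g \<in> PV" "v = cl g" by (auto simp: W_carrier)
  have "cl (lmulx (bms_bracket x y) g) = cl (lmulx x (lmulx y g) - ksign p r *\<^sub>c lmulx y (lmulx x g))"
    using g lmulx_bracket[OF g(1) xy] by (subst cl_eq) auto
  then show "act W (bms_bracket x y) v = act W x (act W y v) \<ominus>\<^bsub>W\<^esub> ksign p r \<odot>\<^bsub>W\<^esub> act W y (act W x v)"
    using g by (simp add: W_act W_smult W_minus)
next
  fix p r x v
  assume "v \<in> grade W r" "bms_homogeneous p x"
  then show "act W x v \<in> grade W (p + r)"
    using lmulx_PVg PVg_PV by (auto simp: W_grade W_act)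
qed

text \<open>Submodules of cosets are traded for subspaces of \<open>PV\<close> containing
  \<open>K\<close>, to which the lowering lemmas apply; gradedness of \<open>N\<close> becomes
  stability under \<open>proj\<close>.\<close>

lemma submodule_pullback:
  assumes N: "is_bms_submodule UNIV N W"
  defines "N' \<equiv> {g \<in> PV. cl g \<in> N}"
  shows "pm.subspace N'" "K \<subseteq> N'" "f \<in> N' \<Longrightarrow> lmulx x f \<in> N'" "f \<in> N' \<Longrightarrow> proj p f \<in> N'" "N = cl ` N'"
proof -
  have sub: "submodule N complex_ring W" and gr: "N = (N \<inter> grade W 0) <+>\<^bsub>W\<^esub> (N \<inter> grade W 1)"
    and act: "\<And>x v. v \<in> N \<Longrightarrow> act W x v \<in> N"
    using N by (auto simp: is_bms_submodule_def bms_span_def)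
  note s = W.submoduleE[OF sub]
  have z: "\<zero>\<^bsub>W\<^esub> \<in> N"
  proof -
    obtain n where n: "n \<in> N" using s(2) by blast
    then obtain g where "g \<in> PV" "n = cl g" using s(1) by (auto simp: W_carrier)
    then show ?thesis using s(4)[of 0 n] n by (simp add: W_smult W_zero)
  qed
  show sub': "pm.subspace N'"
  proof (rule pm.subspaceI)
    show "0 \<in> N'" using z by (simp add: N'_def W_zero)
    show "x + y \<in> N'" if "x \<in> N'" "y \<in> N'" for x y
      using that s(5)[of "cl x" "cl y"] by (simp add: N'_def W_add)
    show "c *\<^sub>c x \<in> N'" if "x \<in> N'" for c x
      using that s(4)[of c "cl x"] by (simp add: N'_def W_smult)
  qed
  show KN: "K \<subseteq> N'"
  proof
    fix f assume f: "f \<in> K"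
    then have "cl f = cl 0" using K_PV cl_eq[of f 0] by (simp add: eqv_zero)
    then show "f \<in> N'" using f K_PV z by (simp add: N'_def W_zero)
  qed
  show "lmulx x f \<in> N'" if "f \<in> N'"
    using that act[of "cl f" x] by (simp add: N'_def W_act)
  show "N = cl ` N'" using s(1) by (auto simp: N'_def W_carrier)
  show "proj p f \<in> N'" if f: "f \<in> N'"
  proof -
    have "cl f \<in> (N \<inter> grade W 0) <+>\<^bsub>W\<^esub> (N \<inter> grade W 1)" using f gr by (simp add: N'_def)
    then obtain n0 n1 where n: "n0 \<in> N" "n0 \<in> grade W 0" "n1 \<in> N" "n1 \<in> grade W 1" "cl f = n0 \<oplus>\<^bsub>W\<^esub> n1"
      by (auto simp: set_add_def')
    then obtain g0 g1 where g: "g0 \<in> PVg 0" "n0 = cl g0" "g1 \<in> PVg 1" "n1 = cl g1" by (auto simp: W_grade)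
    have "g0 \<in> N'" "g1 \<in> N'" using g n PVg_PV by (auto simp: N'_def)
    moreover have "f \<doteq> g0 + g1"
      using n(5) f g PVg_PV by (subst cl_eq[symmetric]) (auto simp: N'_def W_add)
    from proj_eqv[OF this, of p] have "proj p f \<doteq> proj p g0 + proj p g1" by (simp add: proj_simps)
    moreover have "proj p g0 \<in> N'" "proj p g1 \<in> N'"
      using proj_id[of g0 0] proj_id[of g1 1] proj_other[of g0 1] proj_other[of g1 0] g KN
        \<open>g0 \<in> N'\<close> \<open>g1 \<in> N'\<close> by (cases p; auto)+
    ultimately show ?thesis
      using eqv_mem[OF _ sub' KN] pm.subspace_add[OF sub'] by blast
  qed
qed

end

section \<open>The odd generators annihilating the module\<close>

lemma ind_modI:
  assumes "is_bms_module (sub_basis q) V"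
  shows "ind_mod (sub_basis q) V"
  using assms basis_bracket_sub_basis by unfold_locales

text \<open>The vectors killed by all these $Q$'s form a graded submodule: the bracket of such a $Q$
  with $L_m$, $m \<ge> 0$, is a multiple of another one, and with a $Q$ of the subalgebra it is an
  $M$ that vanishes on \<open>V\<close>. By simplicity it remains to find one nonzero vector of this
  kind.\<close>

lemma Q_annihilates:
  fixes V :: "'v bms_module" and q t :: nat
  assumes simple: "simple_bms_module (sub_basis q) V"
    and b_M: "\<And>i v. i > int t \<Longrightarrow> v \<in> carrier V \<Longrightarrow> act V (gen (M_gen i)) v = \<zero>\<^bsub>V\<^esub>"
    and b_L: "\<And>j v. j > int t + int q \<Longrightarrow> v \<in> carrier V \<Longrightarrow> act V (gen (L_gen j)) v = \<zero>\<^bsub>V\<^esub>"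
    and i: "i > int t" and v: "v \<in> carrier V"
  shows "act V (gen (Q_gen i)) v = \<zero>\<^bsub>V\<^esub>"
proof -
  interpret ind_mod "sub_basis q" V
    using simple by (intro ind_modI) (simp add: simple_bms_module_def)
  note closed = act_closed[OF gen_in_span]
  have act_single_zero: "act V (Poly_Mapping.single b c) v = \<zero>\<^bsub>V\<^esub>"
    if "act V (gen b) v = \<zero>\<^bsub>V\<^esub>" "b \<in> sub_basis q" "v \<in> carrier V" for b c v
    using that act_single[of b v c] by simp
  have comm: "act V (gen a) (act V (gen b) v) \<ominus>\<^bsub>V\<^esub> ksign (parity a) (parity b) \<odot>\<^bsub>V\<^esub> act V (gen b) (act V (gen a) v)
      = act V (basis_bracket a b) v"
    if "a \<in> sub_basis q" "b \<in> sub_basis q" "v \<in> carrier V" for a b v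
    using act_bracket[of "gen a" "gen b" v "parity a" "parity b"] that by (simp add: bms_homogeneous_def)
  have swap: "act V (gen b) (act V (gen a) v) = \<zero>\<^bsub>V\<^esub>"
    if "a \<in> sub_basis q" "b \<in> sub_basis q" "v \<in> carrier V"
      "act V (gen b) v = \<zero>\<^bsub>V\<^esub>" "act V (basis_bracket a b) v = \<zero>\<^bsub>V\<^esub>" for a b v
  proof -
    let ?k = "ksign (parity a) (parity b)" and ?w = "act V (gen b) (act V (gen a) v)"
    have w: "?w \<in> carrier V" using that by (intro closed)
    have "(- ?k) \<odot>\<^bsub>V\<^esub> ?w = \<zero>\<^bsub>V\<^esub>"
      using comm[OF that(1-3)] that w by (simp add: minus_eq_smult)
    then have "(- ?k) \<odot>\<^bsub>V\<^esub> ((- ?k) \<odot>\<^bsub>V\<^esub> ?w) = \<zero>\<^bsub>V\<^esub>"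
      using V.smult_r_null[of "- ?k"] by simp
    then show ?thesis using w by simp
  qed
  have QQ_zero: "act V (basis_bracket (Q_gen k) (Q_gen l)) v = \<zero>\<^bsub>V\<^esub>"
    if "k \<ge> 1" "l > int t" "v \<in> carrier V" for k l v
    using that b_M[of "k + l - 1" v] act_single_zero[of "M_gen (k + l - 1)" v 2] by simp
  define U where "U = {v \<in> carrier V. \<forall>i > int t. act V (gen (Q_gen i)) v = \<zero>\<^bsub>V\<^esub>}"
  have U_gen: "act V (gen b) v \<in> U" if b: "b \<in> sub_basis q" and v: "v \<in> U" for b v
  proof -
    have "act V (gen (Q_gen i)) (act V (gen b) v) = \<zero>\<^bsub>V\<^esub>" if i: "i > int t" for i
    proof (rule swap)
      show "act V (basis_bracket b (Q_gen i)) v = \<zero>\<^bsub>V\<^esub>"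
      proof (cases b)
        case (L_gen m)
        then show ?thesis
          using v i b act_single_zero[of "Q_gen (m + i)" v] by (simp add: U_def)
      next
        case (Q_gen k)
        then show ?thesis using v i b QQ_zero[of k i v] by (simp add: U_def)
      qed (use v in \<open>simp_all add: U_def\<close>)
    qed (use b v i in \<open>simp_all add: U_def\<close>)
    then show ?thesis using b v closed by (simp add: U_def)
  qed
  have "is_bms_submodule (sub_basis q) U V"
    unfolding is_bms_submodule_def
  proof (intro conjI ballI)
    show sub: "submodule U complex_ring V"
    proof (rule V.submoduleI)
      show "\<ominus>\<^bsub>V\<^esub> a \<in> U" if "a \<in> U" for a
        using that act_smult[of "gen (Q_gen i)" a "-1" for i] V.smult_r_null[of "-1"]
        by (auto simp: U_def smult_minus_one[symmetric])
      show "a \<oplus>\<^bsub>V\<^esub> b \<in> U" if "a \<in> U" "b \<in> U" for a b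
        using that by (auto simp: U_def act_add)
      show "c \<odot>\<^bsub>V\<^esub> a \<in> U" if "a \<in> U" for c a
        using that V.smult_r_null[of c] by (auto simp: U_def act_smult)
    qed (auto simp: U_def)
    note s = V.submoduleE[OF sub]
    show "U = U \<inter> grade V 0 <+>\<^bsub>V\<^esub> U \<inter> grade V 1"
    proof
      show "U \<inter> grade V 0 <+>\<^bsub>V\<^esub> U \<inter> grade V 1 \<subseteq> U"
        using s(5) unfolding set_add_def' by blast
      show "U \<subseteq> U \<inter> grade V 0 <+>\<^bsub>V\<^esub> U \<inter> grade V 1"
      proof
        fix v assume v: "v \<in> U"
        then have vc: "v \<in> carrier V" by (simp add: U_def)
        have "parity_part s v \<in> U" for s
        proof -
          have "act V (gen (Q_gen i)) (parity_part s v) = \<zero>\<^bsub>V\<^esub>" if "i > int t" for i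
          proof -
            have "act V (gen (Q_gen i)) (parity_part (s + 1 + 1) v) = parity_part (s + 1) (act V (gen (Q_gen i)) v)"
              using parity_part_act[OF vc, of "Q_gen i" "s + 1"] that by simp
            also have "\<dots> = \<zero>\<^bsub>V\<^esub>"
              using v that parity_part_id[OF grade_closed(2)] by (simp add: U_def)
            finally show ?thesis by (simp add: add.assoc)
          qed
          then show ?thesis using vc by (simp add: U_def)
        qed
        moreover have "v = parity_part 0 v \<oplus>\<^bsub>V\<^esub> parity_part 1 v" using parity_part_sum[OF vc, of 0] by simp
        ultimately show "v \<in> U \<inter> grade V 0 <+>\<^bsub>V\<^esub> U \<inter> grade V 1"
          using parity_part_grade[OF vc] unfolding set_add_def' by blast
      qed
    qed
    show "act V x v \<in> U" if "x \<in> bms_span (sub_basis q)" "v \<in> U" for x v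
      using that(1)
    proof (induction rule: bms_span_induct)
      case zero
      show ?case using that(2) by (auto simp: U_def)
    next
      case (add x y)
      then show ?case using that(2) s(5) by (simp add: act_add_left U_def)
    next
      case (single c b)
      then show ?case
        using U_gen[OF single that(2)] s(4)[of c] that(2) act_single[of b v c] by (simp add: U_def)
    qed
  qed
  then have "U = {\<zero>\<^bsub>V\<^esub>} \<or> U = carrier V"
    using simple by (simp add: simple_bms_module_def)
  moreover have "U \<noteq> {\<zero>\<^bsub>V\<^esub>}"
  proof -
    \<comment> \<open>If \<open>Q_gen j\<close> does not kill the vector found so far, its image of
      that vector serves instead: the operators in question anticommute and square to zero on
      \<open>V\<close>, their brackets being $M$'s of index above \<open>t\<close>.\<close>
    have ex: "\<exists>v\<in>carrier V. v \<noteq> \<zero>\<^bsub>V\<^esub> \<and> (\<forall>i. int t < i \<and> i \<le> int t + int n \<longrightarrow> act V (gen (Q_gen i)) v = \<zero>\<^bsub>V\<^esub>)"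
      for n
    proof (induction n)
      case 0
      show ?case using simple V.M.zero_closed by (auto simp: simple_bms_module_def)
    next
      case (Suc n)
      then obtain v where v: "v \<in> carrier V" "v \<noteq> \<zero>\<^bsub>V\<^esub>"
        "\<And>i. int t < i \<Longrightarrow> i \<le> int t + int n \<Longrightarrow> act V (gen (Q_gen i)) v = \<zero>\<^bsub>V\<^esub>" by blast
      define j where "j = int t + int (Suc n)"
      have j: "j > int t" "Q_gen j \<in> sub_basis q" by (simp_all add: j_def)
      have less: "i \<le> int t + int n" if "i \<le> j" "i \<noteq> j" for i using that by (simp add: j_def)
      show ?case
      proof (cases "act V (gen (Q_gen j)) v = \<zero>\<^bsub>V\<^esub>")
        case True
        then show ?thesis using v less unfolding j_def[symmetric] by (intro bexI[of _ v]) auto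
      next
        case False
        let ?w = "act V (gen (Q_gen j)) v"
        have w: "?w \<in> carrier V" using v j by (intro closed)
        have self: "act V (gen (Q_gen j)) ?w = \<zero>\<^bsub>V\<^esub>"
        proof -
          let ?x = "act V (gen (Q_gen j)) ?w"
          have x: "?x \<in> carrier V" by (rule closed[OF j(2) w])
          have "?x \<ominus>\<^bsub>V\<^esub> (-1) \<odot>\<^bsub>V\<^esub> ?x = \<zero>\<^bsub>V\<^esub>"
            using comm[OF j(2,2) v(1)] QQ_zero[OF _ j(1) v(1), of j] j by simp
          then have "2 \<odot>\<^bsub>V\<^esub> ?x = \<zero>\<^bsub>V\<^esub>"
            using x V.smult_l_distr[of 1 1 ?x] by (simp add: minus_eq_smult)
          then have "(1 / 2) \<odot>\<^bsub>V\<^esub> (2 \<odot>\<^bsub>V\<^esub> ?x) = \<zero>\<^bsub>V\<^esub>" using V.smult_r_null[of "1/2"] by simp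
          then show ?thesis using x by simp
        qed
        have "act V (gen (Q_gen i)) ?w = \<zero>\<^bsub>V\<^esub>" if i: "int t < i" "i \<le> j" for i
        proof (cases "i = j")
          case False
          then show ?thesis
            using v j i less QQ_zero[of j i v] by (intro swap) auto
        qed (use self in simp)
        then show ?thesis using w False unfolding j_def[symmetric] by (intro bexI[of _ ?w]) auto
      qed
    qed
    \<comment> \<open>Finitely many $Q$'s suffice: for \<open>i > int t + int (q + 2)\<close> the
      bracket of \<open>L_gen (i - 1)\<close> and \<open>Q_gen 1\<close> is $(i-2)/2$ times
      \<open>Q_gen i\<close>. There $L_{i-1}$ kills \<open>V\<close>, and the coefficient is nonzero
      because $i>2$.\<close>
    obtain v where v: "v \<in> carrier V" "v \<noteq> \<zero>\<^bsub>V\<^esub>"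
      "\<And>i. int t < i \<Longrightarrow> i \<le> int t + int (q + 2) \<Longrightarrow> act V (gen (Q_gen i)) v = \<zero>\<^bsub>V\<^esub>"
      using ex[of "q + 2"] by blast
    have "act V (gen (Q_gen i)) v = \<zero>\<^bsub>V\<^esub>" if i: "i > int t + int (q + 2)" for i
    proof -
      let ?c = "of_int (i - 1) / 2 - (of_int 1 - 1 / 2) :: complex"
      have c: "?c = of_int (i - 2) / 2" by (simp add: field_simps)
      have "?c \<noteq> 0" unfolding c using i by (simp only: divide_eq_0_iff of_int_eq_0_iff) simp
      have Q1: "act V (gen (Q_gen 1)) v \<in> carrier V" using v by (intro closed) auto
      have "act V (basis_bracket (L_gen (i - 1)) (Q_gen 1)) v = \<zero>\<^bsub>V\<^esub>"
        using comm[of "L_gen (i - 1)" "Q_gen 1" v] v(1) i b_L[of "i - 1"] Q1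
        by (simp add: minus_eq_smult V.smult_r_null[simplified])
      then have "?c \<odot>\<^bsub>V\<^esub> act V (gen (Q_gen i)) v = \<zero>\<^bsub>V\<^esub>"
        using act_single[of "Q_gen i" v ?c] v(1) i by simp
      then have "inverse ?c \<odot>\<^bsub>V\<^esub> (?c \<odot>\<^bsub>V\<^esub> act V (gen (Q_gen i)) v) = \<zero>\<^bsub>V\<^esub>"
        using V.smult_r_null[of "inverse ?c"] by simp
      moreover have "act V (gen (Q_gen i)) v \<in> carrier V" using v(1) i by (intro closed) auto
      ultimately show ?thesis using \<open>?c \<noteq> 0\<close> by (simp del: of_int_diff)
    qed
    then have "v \<in> U" using v by (auto simp: U_def) (metis linorder_not_le)
    then show ?thesis using v by blast
  qed
  ultimately show ?thesis using i v by (auto simp: U_def)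
qed

section \<open>Simplicity and smoothness\<close>

context bms_setup
begin

lemma W_central_charge: "has_central_charge c1 c2 W"
  unfolding has_central_charge_def
proof
  fix w assume "w \<in> carrier W"
  then obtain g where g: "g \<in> PV" "w = cl g" by (auto simp: W_carrier)
  have "cl (lmul c1_gen g) = cl (c1 *\<^sub>c g)" "cl (lmul c2_gen g) = cl (c2 *\<^sub>c g)"
    using g c1_eqv c2_eqv by (auto simp: cl_eq)
  then show "act W (gen c1_gen) w = c1 \<odot>\<^bsub>W\<^esub> w \<and> act W (gen c2_gen) w = c2 \<odot>\<^bsub>W\<^esub> w"
    using g by (simp add: W_act W_smult lmulx_simps)
qed

definition killed_above :: "int \<Rightarrow> 'v word_space \<Rightarrow> bool" where
  "killed_above N g \<longleftrightarrow> (\<forall>i>N. lmul (L_gen i) g \<in> K \<and> lmul (M_gen i) g \<in> K \<and> lmul (Q_gen i) g \<in> K)"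

text \<open>A bracket with a letter of index \<open>m\<close> shifts indices by at most
  \<open>\<bar>m\<bar> + 1\<close>, whence the new bound \<open>N + \<bar>m\<bar> + 1\<close>. The
  condition \<open>N \<ge> 0\<close> keeps the shifted indices positive, which excludes central
  terms.\<close>

lemma killed_above_word:
  assumes v: "v \<in> carrier V"
  shows "\<exists>N\<ge>0. killed_above N (pv w v)"
proof (induction w)
  case Nil
  have "lmul b (pv [] v) \<in> K" if "b \<in> sub_basis q" "act V (gen b) v = \<zero>\<^bsub>V\<^esub>" for b
    using pv_act[OF that(1) v] that(2) pv_zero[of "[]"] eqv_K by simp
  then have "killed_above (int t + int q) (pv [] v)"
    unfolding killed_above_def using L_kill[OF _ v] M_kill[OF _ v] Q_kill[OF _ v]
    by (simp del: lmul_single)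
  then show ?case by (intro exI[of _ "int t + int q"]) simp
next
  case (Cons b w)
  then obtain N where N: "N \<ge> 0" "killed_above N (pv w v)" by blast
  let ?g = "pv w v"
  define m where "m = (case b of L_gen m \<Rightarrow> m | M_gen m \<Rightarrow> m | Q_gen m \<Rightarrow> m | _ \<Rightarrow> 0)"
  have k: "lmul (L_gen i) ?g \<in> K" "lmul (M_gen i) ?g \<in> K" "lmul (Q_gen i) ?g \<in> K" if "i > N" for i
    using N that by (auto simp: killed_above_def simp del: lmul_single)
  have step: "lmul x (lmul b ?g) \<in> K"
    if x: "lmul x ?g \<in> K" "lin (\<lambda>c. lmul c ?g) (basis_bracket x b) \<in> K" for x
  proof -
    have "ksign (parity x) (parity b) *\<^sub>c lmul b (lmul x ?g) + lin (\<lambda>c. lmul c ?g) (basis_bracket x b) \<in> K"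
      by (intro K_closed(2,3) lmul_K x)
    then show ?thesis using lmul_comm[of ?g x b] v eqv_K by simp
  qed
  have "lmul x (lmul b ?g) \<in> K" if i: "i > N + \<bar>m\<bar> + 1" and x: "x = L_gen i \<or> x = M_gen i \<or> x = Q_gen i" for i x
  proof (rule step)
    have im: "i + m > N" "i + m - 1 > N" "m + i > N" "i > N" using i by linarith+
    show "lmul x ?g \<in> K" using k[OF im(4)] x by blast
    show "lin (\<lambda>c. lmul c ?g) (basis_bracket x b) \<in> K"
      using x k[OF im(1)] k[OF im(2)] k[OF im(3)] im N(1)
      by (elim disjE; cases b) (simp_all add: m_def lin_add K_closed del: lmul_single)
  qed
  then have "killed_above (N + \<bar>m\<bar> + 1) (lmul b ?g)" by (simp add: killed_above_def del: lmul_single)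
  then show ?case using N by (intro exI[of _ "N + \<bar>m\<bar> + 1"]) simp
qed

lemma killed_above_ex: "g \<in> PV \<Longrightarrow> \<exists>N. killed_above N g"
proof (induction rule: PV_induct)
  case (add x y)
  then obtain N N' where "killed_above N x" "killed_above N' y" by blast
  then have "killed_above (max N N') (x + y)" by (simp add: killed_above_def lmul_simps K_closed)
  then show ?case by blast
next
  case (single c w v)
  then obtain N where "killed_above N (pv w v)" using killed_above_word by blast
  then have "killed_above N (c *\<^sub>c pv w v)"
    by (simp add: killed_above_def lmul_simps K_closed del: lmul_single pm_scale_single)
  then show ?case by blast
qed (simp add: killed_above_def lmul_simps K_closed)

lemma W_smooth: "smooth_bms_module W"
  unfolding smooth_bms_module_def
proof
  fix w assume "w \<in> carrier W"
  then obtain g where g: "g \<in> PV" "w = cl g" by (auto simp: W_carrier)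
  obtain N where "killed_above N g" using killed_above_ex[OF g(1)] by blast
  moreover have "act W (gen b) w = \<zero>\<^bsub>W\<^esub>" if "lmul b g \<in> K" for b
    using that g cl_eq[of "lmul b g" 0] by (simp add: W_act W_zero lmulx_simps eqv_zero)
  ultimately show "\<exists>N. \<forall>i>N. act W (gen (L_gen i)) w = \<zero>\<^bsub>W\<^esub> \<and>
      act W (gen (M_gen i)) w = \<zero>\<^bsub>W\<^esub> \<and> act W (gen (Q_gen i)) w = \<zero>\<^bsub>W\<^esub>"
    unfolding killed_above_def by blast
qed

end

section \<open>Simplicity of the induced module\<close>

context bms_lowering
begin

lemma pv_act_lmulx:
  assumes x: "x \<in> bms_span (sub_basis q)" and v: "v \<in> carrier V"
  shows "pv [] (act V x v) \<doteq> lmulx x (pv [] v)"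
proof -
  have "pv [] (act V x v) \<doteq> lin (\<lambda>b. pv [] (act V (gen b) v)) x"
    unfolding eqv_def using K_rels(1,2) by (rule act_lin[OF K_subspace x v])
  also have "lin (\<lambda>b. pv [] (act V (gen b) v)) x \<doteq> lmulx x (pv [] v)"
    unfolding eqv_def lmulx_def lin_fun_diff[symmetric]
  proof (rule lin_in_subspace[OF K_subspace])
    fix b assume "b \<in> Poly_Mapping.keys x"
    then have "b \<in> sub_basis q" using x by (auto simp: bms_span_def)
    from eqv_sym[OF pv_act[OF this v]] show "pv [] (act V (gen b) v) - lmul b (pv [] v) \<in> K"
      by (simp add: eqv_def)
  qed
  finally show ?thesis .
qed

lemma W_simple:
  assumes simple: "simple_bms_module (sub_basis q) V"
  shows "simple_bms_module UNIV W"
  unfolding simple_bms_module_def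
proof (intro conjI allI impI)
  show "is_bms_module UNIV W" by (rule W_is_module)
  obtain v where v: "v \<in> carrier V" "v \<noteq> \<zero>\<^bsub>V\<^esub>"
    using simple V.M.zero_closed by (auto simp: simple_bms_module_def)
  have "cl (pv [] v) \<noteq> \<zero>\<^bsub>W\<^esub>"
    using pv_in_K_D[OF v(1)] v cl_eq[of "pv [] v" 0] by (auto simp: W_zero eqv_zero)
  moreover have "cl (pv [] v) \<in> carrier W" using v by simp
  ultimately show "carrier W \<noteq> {\<zero>\<^bsub>W\<^esub>}" by blast
next
  fix N assume N: "is_bms_submodule UNIV N W"
  define N' where "N' = {g \<in> PV. cl g \<in> N}"
  note N' = submodule_pullback[OF N, folded N'_def]
  have N'_lmul: "lmul b f \<in> N'" if "f \<in> N'" for b f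
    using N'(3)[OF that, of "gen b"] by (simp add: lmulx_simps)
  show "N = {\<zero>\<^bsub>W\<^esub>} \<or> N = carrier W"
  proof (cases "N' \<subseteq> K")
    case True
    then have eq: "N' = K" using N'(2) by blast
    have "cl g = \<zero>\<^bsub>W\<^esub>" if "g \<in> K" for g
      using that K_PV cl_eq[of g 0] by (simp add: W_zero eqv_zero)
    then show ?thesis using N'(5) K_closed(1) unfolding eq by auto
  next
    case False
    then obtain f where f: "f \<in> N'" "f \<notin> K" by blast
    then have "f \<in> PV" by (simp add: N'_def)
    then obtain v0 where v0: "v0 \<in> carrier V" "v0 \<noteq> \<zero>\<^bsub>V\<^esub>" "pv [] v0 \<in> N'"
      using lower_to_V[OF N'(1,2) N'_lmul] f by blast
    define U where "U = {v \<in> carrier V. pv [] v \<in> N'}"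
    note mem = eqv_mem[OF _ N'(1,2)]
    have "is_bms_submodule (sub_basis q) U V"
      unfolding is_bms_submodule_def
    proof (intro conjI ballI)
      have add: "a \<oplus>\<^bsub>V\<^esub> b \<in> U" if "a \<in> U" "b \<in> U" for a b
        using that mem[OF pv_add[of a b "[]"]] pm.subspace_add[OF N'(1)] by (auto simp: U_def)
      have smult: "c \<odot>\<^bsub>V\<^esub> a \<in> U" if "a \<in> U" for c a
        using that mem[OF pv_smult[of a "[]" c]] pm.subspace_scale[OF N'(1), of "pv [] a" c]
        by (simp add: U_def del: pm_scale_single)
      show "submodule U complex_ring V"
      proof (rule V.submoduleI)
        show "\<zero>\<^bsub>V\<^esub> \<in> U" using pv_zero[of "[]"] N'(2) by (auto simp: U_def)
        show "\<ominus>\<^bsub>V\<^esub> a \<in> U" if "a \<in> U" for a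
          using smult[OF that, of "-1"] that by (simp add: U_def smult_minus_one)
      qed (use add smult in \<open>auto simp: U_def\<close>)
      show "U = U \<inter> grade V 0 <+>\<^bsub>V\<^esub> U \<inter> grade V 1"
      proof
        show "U \<inter> grade V 0 <+>\<^bsub>V\<^esub> U \<inter> grade V 1 \<subseteq> U"
          using add unfolding set_add_def' by blast
        show "U \<subseteq> U \<inter> grade V 0 <+>\<^bsub>V\<^esub> U \<inter> grade V 1"
        proof
          fix v assume v: "v \<in> U"
          then have vc: "v \<in> carrier V" by (simp add: U_def)
          \<comment> \<open>On \<open>pv [] v\<close> the projection \<open>proj\<close> is just
            \<open>parity_part\<close>, so gradedness of \<open>U\<close> follows from that of
            \<open>N\<close>.\<close>
          have "parity_part s v \<in> U" for s
            using N'(4)[of "pv [] v" s] v by (simp add: U_def proj_single)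
          moreover have "v = parity_part 0 v \<oplus>\<^bsub>V\<^esub> parity_part 1 v" using parity_part_sum[OF vc, of 0] by simp
          ultimately show "v \<in> U \<inter> grade V 0 <+>\<^bsub>V\<^esub> U \<inter> grade V 1"
            using parity_part_grade[OF vc] unfolding set_add_def' by blast
        qed
      qed
      show "act V x v \<in> U" if "x \<in> bms_span (sub_basis q)" "v \<in> U" for x v
        using that mem[OF pv_act_lmulx[OF that(1), of v]] N'(3)[of "pv [] v" x] by (simp add: U_def)
    qed
    then have "U = {\<zero>\<^bsub>V\<^esub>} \<or> U = carrier V"
      using simple by (simp add: simple_bms_module_def)
    moreover have "v0 \<in> U" using v0 by (simp add: U_def)
    ultimately have U: "U = carrier V" using v0 by auto
    \<comment> \<open>Once \<open>N'\<close> contains \<open>1 \<otimes> V\<close>, multiplication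
      by letters produces all words.\<close>
    have pv: "pv w v \<in> N'" if "v \<in> carrier V" for w v
    proof (induction w)
      case Nil
      show ?case using that U by (auto simp: U_def)
    next
      case (Cons b w)
      from N'_lmul[OF this, of b] show ?case by simp
    qed
    have "g \<in> N'" if "g \<in> PV" for g
      using that
    proof (induction rule: PV_induct)
      case (single c w v)
      then show ?case by (intro pm.subspace_scale[OF N'(1)] pv)
    qed (use pm.subspace_0[OF N'(1)] pm.subspace_add[OF N'(1)] in auto)
    then have "N' = PV" by (auto simp: N'_def)
    then show ?thesis using N'(5) by (simp add: W_carrier)
  qed
qed

end

theorem theorem4p1:
  fixes V :: "'v bms_module" and q t :: nat and c1 c2 :: complex
  assumes simple: "simple_bms_module (sub_basis q) V"
    and charge: "has_central_charge c1 c2 V"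
    and a_pos: "t > 0 \<Longrightarrow> inj_on (act V (gen (M_gen (int t)))) (carrier V)"
    and a_zero: "\<And>n::int. t = 0 \<Longrightarrow> n \<noteq> 0 \<Longrightarrow>
      inj_on (act V (gen (M_gen 0) + (1 / 24 * (of_int n ^ 2 - 1)) *\<^sub>c gen c2_gen)) (carrier V)"
    and b_M: "\<And>i v. i > int t \<Longrightarrow> v \<in> carrier V \<Longrightarrow> act V (gen (M_gen i)) v = \<zero>\<^bsub>V\<^esub>"
    and b_L: "\<And>j v. j > int t + int q \<Longrightarrow> v \<in> carrier V \<Longrightarrow> act V (gen (L_gen j)) v = \<zero>\<^bsub>V\<^esub>"
  shows "(\<forall>i > int t. \<forall>v\<in>carrier V. act V (gen (Q_gen i)) v = \<zero>\<^bsub>V\<^esub>)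
       \<and> simple_bms_module UNIV (Ind q V)
       \<and> in_smooth_category c1 c2 (Ind q V)"
proof -
  have b_Q: "act V (gen (Q_gen i)) v = \<zero>\<^bsub>V\<^esub>" if "i > int t" "v \<in> carrier V" for i v
    by (rule Q_annihilates[OF simple b_M b_L that])
  have V: "is_bms_module (sub_basis q) V" using simple by (simp add: simple_bms_module_def)
  interpret ind_mod "sub_basis q" V by (rule ind_modI[OF V])
  interpret bms_setup q V t c1 c2
    by unfold_locales (fact charge b_M b_L b_Q)+
  interpret bms_lowering q V t c1 c2
  proof unfold_locales
    assume t: "t > 0"
    have "v = \<zero>\<^bsub>V\<^esub>" if "v \<in> carrier V" "act V (gen (M_gen (int t))) v = \<zero>\<^bsub>V\<^esub>" for v
      using inj_onD[OF a_pos[OF t], of v "\<zero>\<^bsub>V\<^esub>"] that act_zero_right[of "gen (M_gen (int t))"] by simp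
    then show "good 0" by (auto simp: good_def)
  next
    fix n :: int assume t: "t = 0" and n: "n \<noteq> 0"
    let ?k = "1 / 24 * (of_int n ^ 2 - 1) :: complex"
    let ?x = "gen (M_gen 0) + ?k *\<^sub>c gen c2_gen"
    have x: "?x \<in> bms_span (sub_basis q)"
      by (intro bms_span_closed(1,2) gen_in_span) simp_all
    \<comment> \<open>\<open>c2_gen\<close> acts by the scalar \<open>c2\<close>, so hypothesis (a)
      at \<open>n\<close> becomes goodness of \<open>?k * c2\<close>.\<close>
    have act: "act V ?x v = act V (gen (M_gen (int t))) v \<oplus>\<^bsub>V\<^esub> (?k * c2) \<odot>\<^bsub>V\<^esub> v" if v: "v \<in> carrier V" for v
    proof -
      have "act V ?x v = act V (gen (M_gen 0)) v \<oplus>\<^bsub>V\<^esub> act V (?k *\<^sub>c gen c2_gen) v"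
        using v by (intro act_add_left bms_span_closed(2) gen_in_span) simp_all
      also have "act V (?k *\<^sub>c gen c2_gen) v = ?k \<odot>\<^bsub>V\<^esub> act V (gen c2_gen) v"
        using v by (intro act_smult_left gen_in_span) simp_all
      also have "act V (gen c2_gen) v = c2 \<odot>\<^bsub>V\<^esub> v"
        using charge v by (simp add: has_central_charge_def)
      finally show ?thesis using v t by simp
    qed
    show "good (?k * c2)"
      unfolding good_def
    proof (intro ballI impI)
      fix v assume v: "v \<in> carrier V" "act V (gen (M_gen (int t))) v \<oplus>\<^bsub>V\<^esub> (?k * c2) \<odot>\<^bsub>V\<^esub> v = \<zero>\<^bsub>V\<^esub>"
      then have "act V ?x v = act V ?x \<zero>\<^bsub>V\<^esub>" using act[OF v(1)] act_zero_right[OF x] by (simp only:)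
      then show "v = \<zero>\<^bsub>V\<^esub>" using inj_onD[OF a_zero[OF t n]] v(1) V.M.zero_closed by blast
    qed
  qed
  show ?thesis
    unfolding Ind_def in_smooth_category_def
    using b_Q W_simple[OF simple] W_is_module W_smooth W_central_charge by blast
qed

end
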